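(* Let $n_3$ denote the number of rational plane curves of degree $3$ that pass through $8$ points in general position in the complex projective plane $\mathbb{P}^2$. Then $n_3=12$.
   Context: $\mathbb{P}^2$ is the complex projective plane. A degree-$d$ plane curve is the zero set in $\mathbb{P}^2$ of a nonzero homogeneous polynomial of degree $d$ in three variables, where $d$ is the minimal degree of such a polynomial. A curve is rational if it is irreducible and of geometric genus $0$, i.e. its normalization is a (connected) Riemann surface of genus $0$. "Points in general position" means that the statement holds for all tuples of points in some dense open subset of the space of all such tuples. *)

theory Defs
  imports
    "HOL-Analysis.Analysis"
    "HOL-Library.Poly_Mapping"
    "HOL-Library.Function_Algebras"
begin

section \<open>The complex projective plane\<close>

definition proportional :: "complex^3 \<Rightarrow> complex^3 \<Rightarrow> bool" where
  "proportional v w \<longleftrightarrow> v \<noteq> 0 \<and> w \<noteq> 0 \<and> (\<exists>c. w = c *s v)"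

lemma part_equivp_proportional: "part_equivp proportional"
proof (rule part_equivpI)
  have "proportional (axis 1 1) (axis 1 1)"
    unfolding proportional_def
    by (metis axis_eq_0_iff one_neq_zero vector_smult_lid)
  then show "\<exists>v. proportional v v" by blast
  show "symp proportional"
  proof (rule sympI)
    fix v w assume "proportional v w"
    then obtain c where c: "v \<noteq> 0" "w \<noteq> 0" "w = c *s v"
      unfolding proportional_def by blast
    then have "c \<noteq> 0" by auto
    with c have "v = inverse c *s w" by (simp add: vector_smult_assoc)
    with c show "proportional w v" unfolding proportional_def by blast
  qed
  show "transp proportional"
    unfolding transp_def proportional_def by (metis vector_smult_assoc)
qed

text \<open>The equivalence relation is partial: its domain is the set of nonzero vectors.
  The value of \<open>proj\<close> at the zero vector is irrelevant.\<close>

quotient_type cp2 = "complex^3" / partial: proportional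
  morphisms rep_cp2 proj
  by (rule part_equivp_proportional)

text \<open>The quotient topology from \<open>\<complex>\<^sup>3 - {0}\<close>.\<close>

instantiation cp2 :: topological_space
begin

definition open_cp2 :: "cp2 set \<Rightarrow> bool" where
  "open_cp2 U \<longleftrightarrow> open {v. v \<noteq> 0 \<and> proj v \<in> U}"

instance
proof
  have "{v :: complex^3. v \<noteq> 0 \<and> proj v \<in> UNIV} = - {0}" by auto
  then show "open (UNIV :: cp2 set)" unfolding open_cp2_def by (simp add: open_Compl)
next
  fix S T :: "cp2 set" assume "open S" "open T"
  moreover have "{v. v \<noteq> 0 \<and> proj v \<in> S \<inter> T} =
    {v. v \<noteq> 0 \<and> proj v \<in> S} \<inter> {v. v \<noteq> 0 \<and> proj v \<in> T}" by auto
  ultimately show "open (S \<inter> T)" unfolding open_cp2_def by (simp add: open_Int)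
next
  fix K :: "cp2 set set" assume "\<forall>S\<in>K. open S"
  moreover have "{v. v \<noteq> 0 \<and> proj v \<in> \<Union>K} = (\<Union>S\<in>K. {v. v \<noteq> 0 \<and> proj v \<in> S})"
    by auto
  ultimately show "open (\<Union>K)" unfolding open_cp2_def by (simp add: open_UN)
qed

end

text \<open>The affine coordinate \<open>x\<^sub>j / x\<^sub>i\<close> on the affine chart \<open>x\<^sub>i \<noteq> 0\<close>.\<close>

definition affine_chart :: "3 \<Rightarrow> cp2 set" where
  "affine_chart i = {p. rep_cp2 p $ i \<noteq> 0}"

definition affine_coord :: "3 \<Rightarrow> 3 \<Rightarrow> cp2 \<Rightarrow> complex" where
  "affine_coord i j p = rep_cp2 p $ j / rep_cp2 p $ i"


section \<open>Homogeneous polynomials in three variables, plane curves\<close>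

type_synonym poly3 = "(3 \<Rightarrow>\<^sub>0 nat) \<Rightarrow>\<^sub>0 complex"

definition poly_eval :: "poly3 \<Rightarrow> complex^3 \<Rightarrow> complex" where
  "poly_eval P v = (\<Sum>m\<in>Poly_Mapping.keys P.
     Poly_Mapping.lookup P m * (\<Prod>i\<in>UNIV. (v $ i) ^ Poly_Mapping.lookup m i))"

definition homogeneous :: "nat \<Rightarrow> poly3 \<Rightarrow> bool" where
  "homogeneous d P \<longleftrightarrow>
     (\<forall>m\<in>Poly_Mapping.keys P. (\<Sum>i\<in>UNIV. Poly_Mapping.lookup m i) = d)"

definition zero_locus :: "poly3 \<Rightarrow> cp2 set" where
  "zero_locus P = {proj v | v. v \<noteq> 0 \<and> poly_eval P v = 0}"

definition minimal_equation :: "nat \<Rightarrow> poly3 \<Rightarrow> cp2 set \<Rightarrow> bool" where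
  "minimal_equation d P C \<longleftrightarrow>
     P \<noteq> 0 \<and> homogeneous d P \<and> C = zero_locus P \<and>
     (\<forall>e<d. \<not> (\<exists>Q. Q \<noteq> 0 \<and> homogeneous e Q \<and> C = zero_locus Q))"

definition plane_curve :: "nat \<Rightarrow> cp2 set \<Rightarrow> bool" where
  "plane_curve d C \<longleftrightarrow> (\<exists>P. minimal_equation d P C)"

text \<open>The minimal equation is unique up to a nonzero scalar, so the existential quantifier
  over \<open>P\<close> involves no choice.\<close>

definition singular_points :: "cp2 set \<Rightarrow> cp2 set" where
  "singular_points C = {proj v | v. v \<noteq> 0 \<and>
     (\<exists>d P. minimal_equation d P C \<and> poly_eval P v = 0 \<and>
        (\<forall>i. deriv (\<lambda>t. poly_eval P (v + t *s axis i 1)) 0 = 0))}"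

definition algebraic_set :: "cp2 set \<Rightarrow> bool" where
  "algebraic_set Z \<longleftrightarrow>
     (\<exists>S. (\<forall>F\<in>S. \<exists>d. homogeneous d F) \<and> Z = (\<Inter>F\<in>S. zero_locus F))"

definition irreducible_set :: "cp2 set \<Rightarrow> bool" where
  "irreducible_set C \<longleftrightarrow> C \<noteq> {} \<and>
     (\<forall>Y Z. algebraic_set Y \<and> algebraic_set Z \<and> C = Y \<union> Z \<longrightarrow> C = Y \<or> C = Z)"


section \<open>Riemann surfaces and their genus\<close>

text \<open>A chart \<open>(U, f)\<close> is a map \<open>f\<close> on the open set \<open>U\<close>; values of \<open>f\<close> outside \<open>U\<close> are
  irrelevant.\<close>

type_synonym 'a chart = "'a set \<times> ('a \<Rightarrow> complex)"

definition transition :: "'a chart \<Rightarrow> 'a chart \<Rightarrow> complex \<Rightarrow> complex" where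
  "transition k l = snd l \<circ> inv_into (fst k) (snd k)"

definition complex_atlas :: "'a topology \<Rightarrow> 'a chart set \<Rightarrow> bool" where
  "complex_atlas X A \<longleftrightarrow>
     (\<Union>k\<in>A. fst k) = topspace X \<and>
     (\<forall>(U, f)\<in>A. openin X U \<and> open (f ` U) \<and>
        homeomorphic_map (subtopology X U) (top_of_set (f ` U)) f) \<and>
     (\<forall>k\<in>A. \<forall>l\<in>A. transition k l holomorphic_on snd k ` (fst k \<inter> fst l))"

definition riemann_surface :: "'a topology \<Rightarrow> 'a chart set \<Rightarrow> bool" where
  "riemann_surface X A \<longleftrightarrow>
     topspace X \<noteq> {} \<and> connected_space X \<and> Hausdorff_space X \<and> complex_atlas X A"

text \<open>A holomorphic 1-form is given by its coefficient functions: in the chart \<open>k\<close> it is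
  \<open>\<omega> k z dz\<close>. Coefficients are zero where they have no meaning, so that distinct families are
  distinct forms.\<close>

type_synonym 'a form = "'a chart \<Rightarrow> complex \<Rightarrow> complex"

definition holomorphic_forms :: "'a chart set \<Rightarrow> 'a form set" where
  "holomorphic_forms A = {\<omega>.
     (\<forall>k\<in>A. \<omega> k holomorphic_on snd k ` fst k) \<and>
     (\<forall>k\<in>A. \<forall>l\<in>A. \<forall>z\<in>snd k ` (fst k \<inter> fst l).
        \<omega> k z = \<omega> l (transition k l z) * deriv (transition k l) z) \<and>
     (\<forall>k z. k \<notin> A \<or> z \<notin> snd k ` fst k \<longrightarrow> \<omega> k z = 0)}"

definition form_scale :: "complex \<Rightarrow> 'a form \<Rightarrow> 'a form" where
  "form_scale c \<omega> = (\<lambda>k z. c * \<omega> k z)"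

interpretation form_space: vector_space form_scale
  by unfold_locales (auto simp: form_scale_def fun_eq_iff algebra_simps)

text \<open>The genus is the dimension of the space of global holomorphic 1-forms. It is stated as a
  relation since the library's \<open>dim\<close> is \<open>0\<close> on spaces of infinite dimension.\<close>

definition has_genus :: "'a chart set \<Rightarrow> nat \<Rightarrow> bool" where
  "has_genus A g \<longleftrightarrow>
     (\<exists>B. finite B \<and> card B = g \<and> form_space.independent B \<and>
        form_space.span B = holomorphic_forms A)"


section \<open>Normalization, rational curves\<close>

definition holomorphic_map_cp2 :: "'a topology \<Rightarrow> 'a chart set \<Rightarrow> ('a \<Rightarrow> cp2) \<Rightarrow> bool" where
  "holomorphic_map_cp2 X A \<nu> \<longleftrightarrow>
     continuous_map X euclidean \<nu> \<and>
     (\<forall>(U, f)\<in>A. \<forall>i j. (\<lambda>z. affine_coord i j (\<nu> (inv_into U f z)))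
        holomorphic_on f ` {x \<in> U. \<nu> x \<in> affine_chart i})"

text \<open>The normalization of an irreducible plane curve \<open>C\<close>: a compact Riemann surface with a
  holomorphic map onto \<open>C\<close> that is injective over the smooth points of \<open>C\<close> and has finitely many
  points over the singular ones (Griffiths, Introduction to Algebraic Curves). It is unique up to
  isomorphism over \<open>C\<close>.\<close>

definition is_normalization ::
  "cp2 set \<Rightarrow> 'a topology \<Rightarrow> 'a chart set \<Rightarrow> ('a \<Rightarrow> cp2) \<Rightarrow> bool" where
  "is_normalization C X A \<nu> \<longleftrightarrow>
     riemann_surface X A \<and> compact_space X \<and> holomorphic_map_cp2 X A \<nu> \<and>
     \<nu> ` topspace X = C \<and>
     finite {x \<in> topspace X. \<nu> x \<in> singular_points C} \<and>
     inj_on \<nu> {x \<in> topspace X. \<nu> x \<notin> singular_points C}"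

text \<open>The points of the Riemann surface are drawn from the type \<open>cp2\<close>, with an arbitrary
  topology. This is no restriction: a compact Riemann surface has the cardinality of the continuum,
  so it is isomorphic to one of this form.\<close>

definition has_geometric_genus :: "cp2 set \<Rightarrow> nat \<Rightarrow> bool" where
  "has_geometric_genus C g \<longleftrightarrow>
     (\<exists>(X :: cp2 topology) A \<nu>. is_normalization C X A \<nu> \<and> has_genus A g)"

definition rational_curve :: "cp2 set \<Rightarrow> bool" where
  "rational_curve C \<longleftrightarrow> irreducible_set C \<and> has_geometric_genus C 0"


section \<open>Points in general position\<close>

text \<open>Tuples of points carry the product of the classical topologies.\<close>

definition for_general_points :: "(cp2 ^ 'n::finite \<Rightarrow> bool) \<Rightarrow> bool" where
  "for_general_points Q \<longleftrightarrow> (\<exists>U. open U \<and> closure U = UNIV \<and> (\<forall>p\<in>U. Q p))"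

definition rational_curves_through :: "nat \<Rightarrow> cp2 ^ 'n::finite \<Rightarrow> cp2 set set" where
  "rational_curves_through d p =
     {C. plane_curve d C \<and> rational_curve C \<and> (\<forall>i. p $ i \<in> C)}"

end

theory Submission
imports Defs "HOL-Complex_Analysis.Complex_Analysis" "HOL-Computational_Algebra.Computational_Algebra"
    "HOL-Computational_Algebra.Field_as_Ring" "Subresultants.Subresultant_Gcd"
begin

text \<open>The cubics through eight general points form a pencil. Its smooth members are not rational: with
  \<open>V\<close> a local lift of the normalization to \<open>\<complex>\<^sup>3\<close>, the quotient of \<open>V \<times> V'\<close> by the gradient of the cubic is
  a nonzero holomorphic 1-form. Its singular members contain no line, since a line would carry at most
  two of the points and a conic at most five; the lines through the singular point then parametrize
  them by the Riemann sphere.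

  It remains to count the singular members. Write a member with respect to one of the base points as
  \<open>z\<^sup>2 L + z Q + K\<close> with binary forms \<open>L, Q, K\<close>. It is singular iff the binary quartic \<open>Q\<^sup>2 - 4 L K\<close>, whose
  coefficients are quadratic in the parameter of the pencil, has a double root. Its discriminant has
  degree 6 in these coefficients, hence degree 12 in the parameter. That it has 12 simple roots is a
  polynomial condition on the points, which holds generically as it holds for one explicit pencil.\<close>

text \<open>Curves are point sets, and the geometric genus is witnessed by some normalization. Two
  facts therefore have to be independent of equations and choices: distinct parameters give distinct
  curves, and no surface over a smooth cubic has genus 0. The first holds because a cubic vanishing
  on a singular cubic without lines is a multiple of it; substituting the rational parametrization
  replaces the Nullstellensatz. In the second, \<open>V \<times> V'\<close> and the gradient acquire
  the same factor when \<open>V\<close> is rescaled, exactly in degree three, so the local quotients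
  glue. The discriminant of a ternary cubic, written out in its ten coefficients, has about two
  thousand terms. Projecting from a base point kills the coefficient of \<open>z^3\<close> and turns
  the curve into a double cover of the line of directions, branched over a quartic whose
  discriminant is short in terms of its two invariants. A singularity at the base point itself then
  appears as \<open>L = 0\<close>. As the parameter of the pencil is affine, the member at infinity
  is required to be smooth.\<close>

no_notation fps_nth (infixl "$" 75)
no_notation Matrix.vec_index (infixl "$" 100)
no_notation Matrix.scalar_prod (infix "\<bullet>" 70)
hide_const (open) Determinants.det Module.smult
hide_fact (open) Matrix.vec_eq_iff

abbreviation (input) "lookup \<equiv> Poly_Mapping.lookup"

section \<open>Ternary cubic forms\<close>

text \<open>The coefficients \<open>c 0, \<dots>, c 9\<close> belong to the monomials
  \<open>x\<^sup>3, x\<^sup>2y, xy\<^sup>2, y\<^sup>3, x\<^sup>2z, xyz, y\<^sup>2z, xz\<^sup>2, yz\<^sup>2, z\<^sup>3\<close>.\<close>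

definition cubic :: "(nat \<Rightarrow> complex) \<Rightarrow> complex^3 \<Rightarrow> complex" where
  "cubic c v = c 0 * v$1^3 + c 1 * (v$1^2 * v$2) + c 2 * (v$1 * v$2^2) + c 3 * v$2^3
    + c 4 * (v$1^2 * v$3) + c 5 * (v$1 * v$2 * v$3) + c 6 * (v$2^2 * v$3)
    + c 7 * (v$1 * v$3^2) + c 8 * (v$2 * v$3^2) + c 9 * v$3^3"

text \<open>The symmetric trilinear form behind the cubic; the divisors 3 and 6 count the orderings
  of the factors of a monomial. It makes expansions along sums formal. The differential at
  \<open>v\<close> is three times \<open>polar c v v\<close>, so \<open>q\<close> is singular iff
  \<open>polar c q q\<close> vanishes.\<close>

definition polar :: "(nat \<Rightarrow> complex) \<Rightarrow> complex^3 \<Rightarrow> complex^3 \<Rightarrow> complex^3 \<Rightarrow> complex" where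
  "polar c u v w =
      c 0 * (u$1 * v$1 * w$1) + c 3 * (u$2 * v$2 * w$2) + c 9 * (u$3 * v$3 * w$3)
    + c 1 / 3 * (u$1 * v$1 * w$2 + u$1 * v$2 * w$1 + u$2 * v$1 * w$1)
    + c 2 / 3 * (u$1 * v$2 * w$2 + u$2 * v$1 * w$2 + u$2 * v$2 * w$1)
    + c 4 / 3 * (u$1 * v$1 * w$3 + u$1 * v$3 * w$1 + u$3 * v$1 * w$1)
    + c 6 / 3 * (u$2 * v$2 * w$3 + u$2 * v$3 * w$2 + u$3 * v$2 * w$2)
    + c 7 / 3 * (u$1 * v$3 * w$3 + u$3 * v$1 * w$3 + u$3 * v$3 * w$1)
    + c 8 / 3 * (u$2 * v$3 * w$3 + u$3 * v$2 * w$3 + u$3 * v$3 * w$2)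
    + c 5 / 6 * (u$1 * v$2 * w$3 + u$1 * v$3 * w$2 + u$2 * v$1 * w$3
               + u$2 * v$3 * w$1 + u$3 * v$1 * w$2 + u$3 * v$2 * w$1)"

lemma polar_commute: "polar c u v w = polar c v u w" "polar c u v w = polar c u w v"
  by (simp_all add: polar_def algebra_simps)

lemma polar_add:
  "polar c (u + u') v w = polar c u v w + polar c u' v w"
  "polar c u (v + v') w = polar c u v w + polar c u v' w"
  "polar c u v (w + w') = polar c u v w + polar c u v w'"
  by (simp_all add: polar_def algebra_simps add_divide_distrib)

lemma polar_scale:
  "polar c (k *s u) v w = k * polar c u v w"
  "polar c u (k *s v) w = k * polar c u v w"
  "polar c u v (k *s w) = k * polar c u v w"
  by (simp_all add: polar_def algebra_simps)

lemma polar_zero: "polar c 0 v w = 0" "polar c u 0 w = 0" "polar c u v 0 = 0"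
  by (simp_all add: polar_def)

lemma cubic_polar: "cubic c v = polar c v v v"
  by (simp add: polar_def cubic_def field_simps power2_eq_square power3_eq_cube)

lemma cubic_add:
  "cubic c (u + v) = polar c u u u + 3 * polar c u u v + 3 * polar c u v v + polar c v v v"
  unfolding cubic_polar polar_add
  by (simp add: polar_commute(1)[of c v u] polar_commute(2)[of c u v u] polar_commute(2)[of c v v u])

lemma polar_eq_cubic:
  "6 * polar c u v w = cubic c (u + v + w) - cubic c (u + v) - cubic c (u + w) - cubic c (v + w)
     + cubic c u + cubic c v + cubic c w"
  by (simp add: cubic_polar polar_add polar_commute)

lemma cubic_scale: "cubic c (k *s v) = k ^ 3 * cubic c v"
  by (simp add: cubic_polar polar_scale power3_eq_cube)

lemma cubic_zero [simp]: "cubic c 0 = 0"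
  by (simp add: cubic_polar polar_zero)

lemma polar_lincomb: "polar (\<lambda>k. a * c k + b * d k) u v w = a * polar c u v w + b * polar d u v w"
  by (simp add: polar_def algebra_simps add_divide_distrib)

lemma cubic_lincomb: "cubic (\<lambda>k. a * c k + b * d k) v = a * cubic c v + b * cubic d v"
  by (simp add: cubic_polar polar_lincomb)

lemma polar_lincomb': "polar (\<lambda>k. c k + t * d k) u v w = polar c u v w + t * polar d u v w"
  using polar_lincomb[of 1 c t d] by simp

text \<open>By polarization the trilinear form vanishes with the cubic, and its values at coordinate
  vectors are the coefficients up to the factors 1, 1/3 and 1/6.\<close>

lemma cubic_eq_0_coeffs:
  assumes "\<And>v. cubic c v = 0" "k < 10"
  shows "c k = 0"
proof -
  have p: "polar c u v w = 0" for u v w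
    using polar_eq_cubic[of c u v w] assms(1) by simp
  let ?e1 = "axis 1 1 :: complex^3" and ?e2 = "axis 2 1 :: complex^3" and ?e3 = "axis 3 1 :: complex^3"
  have "c 0 = 0" using p[of ?e1 ?e1 ?e1] by (simp add: polar_def axis_def)
  moreover have "c 1 = 0" using p[of ?e1 ?e1 ?e2] by (simp add: polar_def axis_def)
  moreover have "c 2 = 0" using p[of ?e1 ?e2 ?e2] by (simp add: polar_def axis_def)
  moreover have "c 3 = 0" using p[of ?e2 ?e2 ?e2] by (simp add: polar_def axis_def)
  moreover have "c 4 = 0" using p[of ?e1 ?e1 ?e3] by (simp add: polar_def axis_def)
  moreover have "c 5 = 0" using p[of ?e1 ?e2 ?e3] by (simp add: polar_def axis_def)
  moreover have "c 6 = 0" using p[of ?e2 ?e2 ?e3] by (simp add: polar_def axis_def)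
  moreover have "c 7 = 0" using p[of ?e1 ?e3 ?e3] by (simp add: polar_def axis_def)
  moreover have "c 8 = 0" using p[of ?e2 ?e3 ?e3] by (simp add: polar_def axis_def)
  moreover have "c 9 = 0" using p[of ?e3 ?e3 ?e3] by (simp add: polar_def axis_def)
  moreover have "k \<in> {0,1,2,3,4,5,6,7,8,9}" using assms(2) by auto
  ultimately show ?thesis by auto
qed

lemma deriv_cubic: "deriv (\<lambda>t. cubic c (v + t *s h)) 0 = 3 * polar c v v h"
proof -
  have eq: "(\<lambda>t. cubic c (v + t *s h)) = (\<lambda>t. polar c v v v + 3 * t * polar c v v h
     + 3 * t^2 * polar c v h h + t^3 * polar c h h h)"
    by (auto simp: cubic_add polar_scale fun_eq_iff power2_eq_square power3_eq_cube algebra_simps)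
  have "((\<lambda>t. cubic c (v + t *s h)) has_field_derivative 3 * polar c v v h) (at 0)"
    unfolding eq by (auto intro!: derivative_eq_intros)
  then show ?thesis by (rule DERIV_imp_deriv)
qed

subsection \<open>Forms given by polynomials\<close>

definition expo :: "nat \<Rightarrow> nat \<Rightarrow> nat \<Rightarrow> 3 \<Rightarrow>\<^sub>0 nat" where
  "expo i j k = Poly_Mapping.single 1 i + Poly_Mapping.single 2 j + Poly_Mapping.single 3 k"

lemma lookup_expo:
  "lookup (expo i j k) 1 = i" "lookup (expo i j k) 2 = j"
  "lookup (expo i j k) 3 = k"
  by (simp_all add: expo_def lookup_add lookup_single)

lemma expo_lookup:
  "m = expo (lookup m 1) (lookup m 2) (lookup m 3)"
proof (rule poly_mapping_eqI)
  fix i :: 3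
  show "lookup m i = lookup (expo (lookup m 1)
    (lookup m 2) (lookup m 3)) i"
    using exhaust_3[of i] by (auto simp: lookup_expo)
qed

definition cubic_expos :: "(3 \<Rightarrow>\<^sub>0 nat) list" where
  "cubic_expos = [expo 3 0 0, expo 2 1 0, expo 1 2 0, expo 0 3 0, expo 2 0 1, expo 1 1 1,
     expo 0 2 1, expo 1 0 2, expo 0 1 2, expo 0 0 3]"

lemma expo_inject: "expo i j k = expo i' j' k' \<longleftrightarrow> i = i' \<and> j = j' \<and> k = k'"
  by (metis lookup_expo)

lemma nth_cubic_expos:
  "cubic_expos ! 0 = expo 3 0 0" "cubic_expos ! Suc 0 = expo 2 1 0" "cubic_expos ! 2 = expo 1 2 0"
  "cubic_expos ! 3 = expo 0 3 0" "cubic_expos ! 4 = expo 2 0 1" "cubic_expos ! 5 = expo 1 1 1"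
  "cubic_expos ! 6 = expo 0 2 1" "cubic_expos ! 7 = expo 1 0 2" "cubic_expos ! 8 = expo 0 1 2"
  "cubic_expos ! 9 = expo 0 0 3"
  by (simp_all add: cubic_expos_def)

lemma distinct_cubic_expos: "distinct cubic_expos"
  by (simp add: cubic_expos_def expo_inject)

lemma cubic_expos_complete:
  assumes "i + j + k = 3"
  shows "expo i j k \<in> set cubic_expos"
proof -
  have "i \<in> {0,1,2,3}" "j \<in> {0,1,2,3}" "k = 3 - i - j" using assms by auto
  then show ?thesis using assms by (auto simp: cubic_expos_def)
qed

lemma prod_3: "prod f (UNIV :: 3 set) = f 1 * f 2 * f 3"
  unfolding UNIV_3 by (simp add: ac_simps)

definition coeffs_of :: "poly3 \<Rightarrow> nat \<Rightarrow> complex" where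
  "coeffs_of P k = lookup P (cubic_expos ! k)"

lemma poly_eval_superset:
  assumes "finite M" "Poly_Mapping.keys P \<subseteq> M"
  shows "poly_eval P v = (\<Sum>m\<in>M. lookup P m * (\<Prod>i\<in>UNIV. (v $ i) ^ lookup m i))"
  unfolding poly_eval_def
  by (rule sum.mono_neutral_left) (use assms in \<open>auto simp: in_keys_iff\<close>)

lemma homogeneous_keys: "homogeneous 3 P \<Longrightarrow> Poly_Mapping.keys P \<subseteq> set cubic_expos"
proof
  fix m assume "homogeneous 3 P" "m \<in> Poly_Mapping.keys P"
  then have "lookup m 1 + lookup m 2 + lookup m 3 = 3"
    by (auto simp: homogeneous_def sum_3)
  then show "m \<in> set cubic_expos"
    using cubic_expos_complete expo_lookup by metis
qed

lemma sum_cubic_expos: "(\<Sum>m\<in>set cubic_expos. f m) = f (expo 3 0 0) + f (expo 2 1 0) + f (expo 1 2 0)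
   + f (expo 0 3 0) + f (expo 2 0 1) + f (expo 1 1 1) + f (expo 0 2 1) + f (expo 1 0 2)
   + f (expo 0 1 2) + f (expo 0 0 3)"
  for f :: "_ \<Rightarrow> complex"
  using sum.distinct_set_conv_list[OF distinct_cubic_expos, of f]
  by (simp add: cubic_expos_def add.assoc)

lemma poly_eval_cubic:
  assumes "homogeneous 3 P"
  shows "poly_eval P v = cubic (coeffs_of P) v"
  unfolding poly_eval_superset[OF finite_set homogeneous_keys[OF assms]] sum_cubic_expos
  by (simp add: cubic_def coeffs_of_def prod_3 lookup_expo nth_cubic_expos mult.assoc)

lemma coeffs_of_eq_0:
  assumes "homogeneous 3 P" "\<And>k. k < 10 \<Longrightarrow> coeffs_of P k = 0"
  shows "P = 0"
proof -
  have "m \<notin> Poly_Mapping.keys P" for m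
  proof
    assume m: "m \<in> Poly_Mapping.keys P"
    then have "m \<in> set cubic_expos" using homogeneous_keys assms(1) by blast
    then obtain k where "k < length cubic_expos" "m = cubic_expos ! k" by (metis in_set_conv_nth)
    moreover have "length cubic_expos = 10" by (simp add: cubic_expos_def)
    ultimately show False using assms(2)[of k] m by (auto simp: coeffs_of_def in_keys_iff)
  qed
  then show ?thesis by (metis all_not_in_conv keys_eq_empty)
qed

definition poly_of :: "(nat \<Rightarrow> complex) \<Rightarrow> poly3" where
  "poly_of c = (\<Sum>k<10. Poly_Mapping.single (cubic_expos ! k) (c k))"

lemma length_cubic_expos: "length cubic_expos = 10"
  by (simp add: cubic_expos_def)

lemma coeffs_of_poly_of: "k < 10 \<Longrightarrow> coeffs_of (poly_of c) k = c k"
proof -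
  assume k: "k < 10"
  have "coeffs_of (poly_of c) k = (\<Sum>j<10. c j when cubic_expos ! j = cubic_expos ! k)"
    by (simp add: coeffs_of_def poly_of_def lookup_sum lookup_single)
  also have "\<dots> = (\<Sum>j<10. if j = k then c j else 0)"
    using k by (intro sum.cong)
      (auto simp: when_def nth_eq_iff_index_eq[OF distinct_cubic_expos] length_cubic_expos)
  finally show ?thesis using k by simp
qed

lemma homogeneous_poly_of: "homogeneous 3 (poly_of c)"
  unfolding homogeneous_def
proof
  fix m assume "m \<in> Poly_Mapping.keys (poly_of c)"
  then have "m \<in> (\<Union>k<10. Poly_Mapping.keys (Poly_Mapping.single (cubic_expos ! k) (c k)))"
    unfolding poly_of_def by (rule keys_sum[THEN subsetD])
  then have "\<exists>k<10. m = cubic_expos ! k" by (auto split: if_splits)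
  then have "m \<in> set cubic_expos" by (auto simp: length_cubic_expos)
  then show "(\<Sum>i\<in>UNIV. lookup m i) = 3"
    by (auto simp: cubic_expos_def sum_3 lookup_expo)
qed

lemma cubic_cong: "(\<And>k. k < 10 \<Longrightarrow> c k = d k) \<Longrightarrow> cubic c v = cubic d v"
  by (simp add: cubic_def)

lemma poly_eval_poly_of: "poly_eval (poly_of c) v = cubic c v"
  using poly_eval_cubic[OF homogeneous_poly_of] cubic_cong[of "coeffs_of (poly_of c)" c] coeffs_of_poly_of
  by metis

lemma poly_eval_scale:
  assumes "homogeneous d P"
  shows "poly_eval P (k *s v) = k ^ d * poly_eval P v"
  unfolding poly_eval_def sum_distrib_left
proof (rule sum.cong)
  fix m assume "m \<in> Poly_Mapping.keys P"
  then have d: "(\<Sum>i\<in>UNIV. lookup m i) = d" using assms by (auto simp: homogeneous_def)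
  have "(\<Prod>i\<in>UNIV. (k *s v) $ i ^ lookup m i) = k ^ d * (\<Prod>i\<in>UNIV. v $ i ^ lookup m i)"
    by (simp add: power_mult_distrib prod.distrib power_sum[symmetric] d)
  then show "lookup P m * (\<Prod>i\<in>UNIV. (k *s v) $ i ^ lookup m i) =
    k ^ d * (lookup P m * (\<Prod>i\<in>UNIV. v $ i ^ lookup m i))" by simp
qed simp

lemma monomial_cubic:
  assumes "i + j + k = 3"
  shows "\<exists>c. \<forall>v. a * (v$1^i * v$2^j * v$3^k) = cubic c v"
proof -
  define P where "P = Poly_Mapping.single (expo i j k) a"
  have "homogeneous 3 P" using assms by (auto simp: homogeneous_def P_def sum_3 lookup_expo split: if_splits)
  from poly_eval_cubic[OF this]
  have "a * (v$1^i * v$2^j * v$3^k) = cubic (coeffs_of P) v" for v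
    using poly_eval_superset[of "{expo i j k}" P v]
    by (simp add: P_def prod_3 lookup_expo split: if_splits)
  then show ?thesis by blast
qed

lemma sum_cubic:
  assumes "finite M" "\<And>m. m \<in> M \<Longrightarrow> \<exists>c. \<forall>v. f m v = cubic c v"
  shows "\<exists>c. \<forall>v. (\<Sum>m\<in>M. f m v) = cubic c v"
  using assms
proof (induction M rule: finite_induct)
  case empty
  have "cubic (\<lambda>_. 0) v = 0" for v by (simp add: cubic_def)
  then show ?case by (metis sum.empty)
next
  case (insert m M)
  then obtain c d where "\<forall>v. f m v = cubic c v" "\<forall>v. (\<Sum>m\<in>M. f m v) = cubic d v" by blast
  then have "(\<Sum>m\<in>insert m M. f m v) = cubic (\<lambda>k. c k + d k) v" for v
    using insert cubic_lincomb[of 1 c 1 d v] by simp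
  then show ?case by blast
qed

text \<open>Lifts a form of degree below three to the space of cubics, where a supposed equation of
  smaller degree can be compared with the cubic itself.\<close>

lemma lower_degree_times_power:
  assumes "homogeneous e Q" "e < 3"
  shows "\<exists>c. \<forall>v. poly_eval Q v * v$i ^ (3 - e) = cubic c v"
proof -
  have "\<exists>c. \<forall>v. lookup Q m * (\<Prod>l\<in>UNIV. (v $ l) ^ lookup m l) * v$i ^ (3 - e) = cubic c v"
    if m: "m \<in> Poly_Mapping.keys Q" for m
  proof -
    define x where "x = lookup m 1 + (if i = 1 then 3 - e else 0)"
    define y where "y = lookup m 2 + (if i = 2 then 3 - e else 0)"
    define z where "z = lookup m 3 + (if i = 3 then 3 - e else 0)"
    have e: "lookup m 1 + lookup m 2 + lookup m 3 = e"
      using assms(1) m by (auto simp: homogeneous_def sum_3)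
    have i: "i = 1 \<or> i = 2 \<or> i = 3" by (rule exhaust_3)
    have "x + y + z = 3" using i e assms(2) by (auto simp: x_def y_def z_def)
    from monomial_cubic[OF this, of "lookup Q m"] obtain c where
      c: "\<forall>v. lookup Q m * (v$1^x * v$2^y * v$3^z) = cubic c v" by blast
    have "(\<Prod>l\<in>UNIV. (v $ l) ^ lookup m l) * v$i ^ (3 - e) = v$1^x * v$2^y * v$3^z" for v :: "complex^3"
      using i by (auto simp: prod_3 x_def y_def z_def power_add)
    then show ?thesis using c by (metis mult.assoc)
  qed
  from sum_cubic[OF finite_keys this] show ?thesis
    by (simp add: poly_eval_def sum_distrib_right)
qed

section \<open>The topology of the projective plane\<close>

lemma proj_rep [simp]: "proj (rep_cp2 p) = p"
  using Quotient3_abs_rep[OF Quotient3_cp2] .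

lemma rep_nonzero [simp]: "rep_cp2 p \<noteq> 0"
  using Quotient3_rep_reflp[OF Quotient3_cp2, of p] by (simp add: proportional_def)

lemma proj_eq_iff:
  assumes "v \<noteq> 0" "w \<noteq> 0"
  shows "proj v = proj w \<longleftrightarrow> (\<exists>c. w = c *s v)"
proof -
  have "proportional x x" if "x \<noteq> 0" for x
    using that unfolding proportional_def by (metis vector_smult_lid)
  then show ?thesis
    using Quotient3_rel[OF Quotient3_cp2, of v w] assms by (auto simp: proportional_def)
qed

lemma proj_scale: "c \<noteq> 0 \<Longrightarrow> v \<noteq> 0 \<Longrightarrow> proj (c *s v) = proj v"
  using proj_eq_iff[of v "c *s v"] by auto

lemma rep_proj:
  assumes "v \<noteq> 0"
  obtains c where "c \<noteq> 0" "rep_cp2 (proj v) = c *s v"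
proof -
  obtain c where c: "rep_cp2 (proj v) = c *s v"
    using proj_eq_iff[OF assms rep_nonzero, of "proj v"] by auto
  then have "c \<noteq> 0" using rep_nonzero[of "proj v"] by auto
  with c that show ?thesis by blast
qed

lemma open_cp2_iff: "open U \<longleftrightarrow> open {v. v \<noteq> 0 \<and> proj v \<in> U}"
  by (rule open_cp2_def)

lemma continuous_proj: "continuous_on (- {0}) proj"
proof (subst continuous_on_open_vimage)
  show "open (- {0 :: complex^3})" by (simp add: open_Compl)
  show "\<forall>B. open B \<longrightarrow> open (proj -` B \<inter> - {0})"
    unfolding open_cp2_iff by (auto simp: vimage_def Int_def conj_commute)
qed

text \<open>The universal property of the quotient topology, over an open subset.\<close>

lemma continuous_on_cp2I:
  assumes "open S" "continuous_on {v. v \<noteq> 0 \<and> proj v \<in> S} (\<lambda>v. f (proj v))"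
  shows "continuous_on S f"
proof (subst continuous_on_open_vimage[OF assms(1)], intro allI impI)
  fix B :: "'a set" assume B: "open B"
  have o: "open {v. v \<noteq> 0 \<and> proj v \<in> S}" using assms(1) by (simp add: open_cp2_iff)
  have "open ((\<lambda>v. f (proj v)) -` B \<inter> {v. v \<noteq> 0 \<and> proj v \<in> S})"
    using assms(2) B unfolding continuous_on_open_vimage[OF o] by blast
  then show "open (f -` B \<inter> S)"
    unfolding open_cp2_iff by (auto simp: vimage_def Int_def conj_ac)
qed

lemma continuous_scale: "continuous_on UNIV (\<lambda>v. k *s v :: complex^3)"
  by (intro continuous_on_vec_lambda[where f = "\<lambda>i v. k * v $ i", unfolded vector_scalar_mult_def[symmetric]] continuous_intros)

text \<open>The projection is the quotient by a group of homeomorphisms: the cone over the image is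
  the union of the rescaled copies of \<open>W\<close>, all of them open.\<close>

lemma open_proj_image:
  assumes "open W" "0 \<notin> W"
  shows "open (proj ` W)"
proof -
  have "{v. v \<noteq> 0 \<and> proj v \<in> proj ` W} = (\<Union>k\<in>-{0}. (\<lambda>v. k *s v) -` W)" (is "?L = ?R")
  proof (intro equalityI subsetI)
    fix v assume "v \<in> ?L"
    then obtain w where w: "v \<noteq> 0" "w \<in> W" "proj v = proj w" by auto
    then have "w \<noteq> 0" using assms by auto
    then obtain k where "w = k *s v" using w proj_eq_iff by blast
    with w \<open>w \<noteq> 0\<close> show "v \<in> ?R" by auto
  next
    fix v assume "v \<in> ?R"
    then obtain k where k: "k \<noteq> 0" "k *s v \<in> W" by auto
    then have "v \<noteq> 0" using assms by auto
    with k proj_scale[of k v] show "v \<in> ?L" by (metis (mono_tags, lifting) imageI mem_Collect_eq)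
  qed
  moreover have "open ((\<lambda>v. k *s v) -` W)" for k
    using continuous_scale assms(1) by (simp add: continuous_on_open_vimage)
  ultimately show ?thesis by (simp add: open_cp2_iff open_UN)
qed

lemma affine_chart_proj: "v \<noteq> 0 \<Longrightarrow> proj v \<in> affine_chart i \<longleftrightarrow> v $ i \<noteq> 0"
  by (rule rep_proj[of v]) (auto simp: affine_chart_def)

lemma affine_coord_proj: "v \<noteq> 0 \<Longrightarrow> affine_coord i j (proj v) = v $ j / v $ i"
  by (rule rep_proj[of v]) (auto simp: affine_coord_def)

lemma open_affine_chart: "open (affine_chart i)"
proof -
  have "{v. v \<noteq> 0 \<and> proj v \<in> affine_chart i} = {v. v $ i \<noteq> 0}"
    using affine_chart_proj by (auto simp: affine_chart_proj) (metis affine_chart_proj zero_index)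
  moreover have "open {v :: complex^3. v $ i \<noteq> 0}"
    by (intro open_Collect_neq continuous_intros)
  ultimately show ?thesis by (simp add: open_cp2_iff)
qed

lemma continuous_affine_coord: "continuous_on (affine_chart i) (affine_coord i j)"
proof (rule continuous_on_cp2I[OF open_affine_chart])
  have "continuous_on {v :: complex^3. v \<noteq> 0 \<and> proj v \<in> affine_chart i} (\<lambda>v. v $ j / v $ i)"
    by (intro continuous_intros) (auto simp: affine_chart_proj)
  then show "continuous_on {v. v \<noteq> 0 \<and> proj v \<in> affine_chart i} (\<lambda>v. affine_coord i j (proj v))"
    by (rule continuous_on_eq) (auto simp: affine_coord_proj)
qed

lemma proj_in_zero_locus:
  assumes "homogeneous d P" "v \<noteq> 0"
  shows "proj v \<in> zero_locus P \<longleftrightarrow> poly_eval P v = 0"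
proof
  assume "proj v \<in> zero_locus P"
  then obtain w where w: "w \<noteq> 0" "poly_eval P w = 0" "proj v = proj w" by (auto simp: zero_locus_def)
  then obtain c where "v = c *s w" using proj_eq_iff[of w v] assms(2) by auto
  then show "poly_eval P v = 0" using w poly_eval_scale[OF assms(1)] by simp
qed (use assms in \<open>auto simp: zero_locus_def\<close>)

definition cubic_curve :: "(nat \<Rightarrow> complex) \<Rightarrow> cp2 set" where
  "cubic_curve c = {proj v | v. v \<noteq> 0 \<and> cubic c v = 0}"

lemma zero_locus_cubic: "homogeneous 3 P \<Longrightarrow> zero_locus P = cubic_curve (coeffs_of P)"
  by (simp add: zero_locus_def cubic_curve_def poly_eval_cubic)

lemma zero_locus_poly_of: "zero_locus (poly_of c) = cubic_curve c"
  by (simp add: zero_locus_def cubic_curve_def poly_eval_poly_of)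

lemma proj_in_cubic_curve: "v \<noteq> 0 \<Longrightarrow> proj v \<in> cubic_curve c \<longleftrightarrow> cubic c v = 0"
  using proj_in_zero_locus[OF homogeneous_poly_of] by (simp add: zero_locus_poly_of poly_eval_poly_of)

section \<open>The Riemann sphere as a line in the plane\<close>

text \<open>The geometric genus draws the points of a surface from \<open>cp2\<close>, so the
  Riemann sphere is realized inside the plane, as a coordinate line with the two affine coordinates
  as charts.\<close>

definition line_z :: "cp2 set" where
  "line_z = {p. rep_cp2 p $ 3 = 0}"

abbreviation line_part :: "3 \<Rightarrow> cp2 set" where
  "line_part i \<equiv> line_z \<inter> affine_chart i"

definition line_chart :: "3 \<Rightarrow> 3 \<Rightarrow> cp2 chart" where
  "line_chart i j = (line_part i, affine_coord i j)"

definition line_point :: "3 \<Rightarrow> 3 \<Rightarrow> complex \<Rightarrow> cp2" where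
  "line_point i j z = proj (axis i 1 + z *s axis j 1)"

definition line_atlas :: "cp2 chart set" where
  "line_atlas = {line_chart 1 2, line_chart 2 1}"

abbreviation line_idx :: "3 \<Rightarrow> 3 \<Rightarrow> bool" where
  "line_idx i j \<equiv> (i = 1 \<and> j = 2) \<or> (i = 2 \<and> j = 1)"

lemma proj_in_line_z: "v \<noteq> 0 \<Longrightarrow> proj v \<in> line_z \<longleftrightarrow> v $ 3 = 0"
  by (rule rep_proj[of v]) (auto simp: line_z_def)

lemma line_vec_nonzero: "line_idx i j \<Longrightarrow> axis i 1 + z *s axis j 1 \<noteq> (0 :: complex^3)"
  by (auto simp: vec_eq_iff axis_def forall_3)

lemma line_point_in: "line_idx i j \<Longrightarrow> line_point i j z \<in> line_part i"
  unfolding line_point_def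
  using proj_in_line_z[OF line_vec_nonzero] affine_chart_proj[OF line_vec_nonzero]
  by (auto simp: axis_def)

lemma coord_line_point: "line_idx i j \<Longrightarrow> affine_coord i j (line_point i j z) = z"
  unfolding line_point_def using affine_coord_proj[OF line_vec_nonzero, of i j] by (auto simp: axis_def)

lemma line_point_coord:
  assumes "line_idx i j" "p \<in> line_part i"
  shows "line_point i j (affine_coord i j p) = p"
proof -
  let ?v = "rep_cp2 p"
  have v: "?v $ 3 = 0" "?v $ i \<noteq> 0" using assms(2) by (auto simp: line_z_def affine_chart_def)
  have "?v = ?v $ i *s (axis i 1 + affine_coord i j p *s axis j 1)"
    using v assms(1) by (auto simp: vec_eq_iff forall_3 axis_def affine_coord_def)
  then have "proj ?v = line_point i j (affine_coord i j p)"
    unfolding line_point_def using proj_scale[OF v(2) line_vec_nonzero[OF assms(1)]] by metis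
  then show ?thesis by simp
qed

lemma continuous_line_point: "line_idx i j \<Longrightarrow> continuous_on UNIV (line_point i j)"
proof -
  assume ij: "line_idx i j"
  have "continuous_on UNIV (\<lambda>z. axis i 1 + z *s axis j 1 :: complex^3)"
    by (intro continuous_intros continuous_on_vec_lambda[where f = "\<lambda>l z. z * axis j 1 $ l", unfolded vector_scalar_mult_def[symmetric]])
  then have "continuous_on UNIV (proj \<circ> (\<lambda>z. axis i 1 + z *s axis j 1))"
    by (rule continuous_on_compose) (rule continuous_on_subset[OF continuous_proj], use line_vec_nonzero[OF ij] in auto)
  then show ?thesis by (simp add: line_point_def o_def)
qed

lemma line_z_range: "line_idx i j \<Longrightarrow> line_part i = range (line_point i j)"
  using line_point_in line_point_coord by (metis (no_types, lifting) image_subset_iff rangeI subsetI subset_antisym)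

lemma line_z_cover: "p \<in> line_z \<Longrightarrow> p \<in> affine_chart 1 \<or> p \<in> affine_chart 2"
  using rep_nonzero[of p] by (auto simp: line_z_def affine_chart_def vec_eq_iff forall_3)

lemma line_coord_swap: "affine_coord i j p = inverse (affine_coord j i p)"
  by (simp add: affine_coord_def)

lemma inv_line_chart:
  assumes "line_idx i j"
  shows "inv_into (line_part i) (affine_coord i j) z = line_point i j z"
proof (rule inv_into_f_eq)
  show "inj_on (affine_coord i j) (line_part i)"
    using line_point_coord[OF assms] by (metis inj_onI)
qed (use line_point_in coord_line_point assms in auto)

lemma image_line_chart: "line_idx i j \<Longrightarrow> affine_coord i j ` (line_part i) = UNIV"
  using line_point_in coord_line_point by (metis UNIV_eq_I image_eqI)

lemma transition_line_self: "line_idx i j \<Longrightarrow> transition (line_chart i j) (line_chart i j) = (\<lambda>z. z)"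
  by (auto simp: transition_def line_chart_def fun_eq_iff inv_line_chart coord_line_point)

lemma transition_line_swap: "line_idx i j \<Longrightarrow> transition (line_chart i j) (line_chart j i) = inverse"
  unfolding transition_def line_chart_def
  by (auto simp: fun_eq_iff inv_line_chart coord_line_point line_coord_swap[of j i])

lemma line_overlap:
  assumes "line_idx i j"
  shows "affine_coord i j ` (line_part i \<inter> line_part j) = - {0}"
proof -
  have *: "line_point i j z \<in> affine_chart j \<longleftrightarrow> z \<noteq> 0" for z
    unfolding line_point_def using affine_chart_proj[OF line_vec_nonzero[OF assms]] assms
    by (auto simp: axis_def)
  show ?thesis
  proof (intro equalityI subsetI)
    fix z assume "z \<in> affine_coord i j ` (line_part i \<inter> line_part j)"
    then obtain p where "p \<in> line_part i" "p \<in> affine_chart j" "z = affine_coord i j p" by blast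
    then show "z \<in> - {0}" using line_point_coord[OF assms, of p] *[of z] by simp
  next
    fix z :: complex assume "z \<in> - {0}"
    then have "line_point i j z \<in> line_part i \<inter> line_part j"
      using * line_point_in[OF assms, of z] by auto
    then show "z \<in> affine_coord i j ` (line_part i \<inter> line_part j)"
      using coord_line_point[OF assms, of z] by (metis imageI)
  qed
qed

text \<open>Two points in a common chart are separated by their coordinates. Otherwise they are the
  two poles, and the open unit discs around them are disjoint because the two coordinates are
  reciprocal.\<close>

lemma Hausdorff_line: "Hausdorff_space (top_of_set line_z)"
  unfolding Hausdorff_space_def
proof (intro allI impI, elim conjE)
  fix p q assume p: "p \<in> topspace (top_of_set line_z)" and q: "q \<in> topspace (top_of_set line_z)" and ne: "p \<noteq> q"
  let ?sep = "\<exists>U V. openin (top_of_set line_z) U \<and> openin (top_of_set line_z) V \<and> p \<in> U \<and> q \<in> V \<and> disjnt U V"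
  have op: "openin (top_of_set line_z) (line_z \<inter> (affine_coord i j -` B \<inter> affine_chart i))"
    if "open B" for i j B
  proof (rule openin_open_Int)
    show "open (affine_coord i j -` B \<inter> affine_chart i)"
      using that continuous_affine_coord[of i j] continuous_on_open_vimage[OF open_affine_chart] by blast
  qed
  have same: ?sep
    if ij: "line_idx i j" and pq: "p \<in> affine_chart i" "q \<in> affine_chart i" for i j
  proof -
    have "affine_coord i j p \<noteq> affine_coord i j q"
      using line_point_coord[OF ij] p q pq ne by (metis IntI topspace_euclidean_subtopology)
    then obtain B C where BC: "open B" "open C" "affine_coord i j p \<in> B" "affine_coord i j q \<in> C" "B \<inter> C = {}"
      using hausdorff by metis
    show ?thesis
      by (rule exI[of _ "line_z \<inter> (affine_coord i j -` B \<inter> affine_chart i)"],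
          rule exI[of _ "line_z \<inter> (affine_coord i j -` C \<inter> affine_chart i)"])
        (use op BC p q pq in \<open>auto simp: disjnt_def\<close>)
  qed
  have opp: ?sep
    if ij: "line_idx i j" and pq: "p \<in> affine_chart i" "p \<notin> affine_chart j" "q \<in> affine_chart j" "q \<notin> affine_chart i" for i j
  proof -
    have 0: "affine_coord i j p = 0" "affine_coord j i q = 0" using pq by (auto simp: affine_chart_def affine_coord_def)
    have "disjnt (line_z \<inter> (affine_coord i j -` ball 0 1 \<inter> affine_chart i)) (line_z \<inter> (affine_coord j i -` ball 0 1 \<inter> affine_chart j))"
    proof -
      have "\<not> (norm (affine_coord i j x) < 1 \<and> norm (affine_coord j i x) < 1)"
        if "x \<in> affine_chart i" "x \<in> affine_chart j" for x
      proof -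
        have "affine_coord i j x * affine_coord j i x = 1" using that by (simp add: affine_chart_def affine_coord_def)
        then have "norm (affine_coord i j x) * norm (affine_coord j i x) = 1" by (metis norm_mult norm_one)
        then show ?thesis by (metis mult_strict_mono' norm_ge_zero mult_1 less_irrefl)
      qed
      then show ?thesis by (auto simp: disjnt_def)
    qed
    then show ?thesis
      by (intro exI[of _ "line_z \<inter> (affine_coord i j -` ball 0 1 \<inter> affine_chart i)"]
          exI[of _ "line_z \<inter> (affine_coord j i -` ball 0 1 \<inter> affine_chart j)"] conjI op open_ball)
        (use p q pq 0 in auto)
  qed
  have "p \<in> line_z" "q \<in> line_z" using p q by auto
  then show ?sep
    using line_z_cover[of p] line_z_cover[of q] same[of 1 2] same[of 2 1] opp[of 1 2] opp[of 2 1] by blast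
qed

lemma line_z_eq: "line_z = range (line_point 1 2) \<union> range (line_point 2 1)"
  using line_z_range[of 1 2] line_z_range[of 2 1] line_z_cover by blast

lemma connected_line: "connected line_z"
  unfolding line_z_eq
proof (rule connected_Un)
  show "connected (range (line_point 1 2))" "connected (range (line_point 2 1))"
    by (auto intro!: connected_continuous_image continuous_line_point connected_UNIV)
  have "line_point 1 2 1 = line_point 2 1 1"
    by (simp add: line_point_def add.commute)
  then show "range (line_point 1 2) \<inter> range (line_point 2 1) \<noteq> {}" by blast
qed

text \<open>The line is the union of two closed discs, since one of two reciprocal coordinates has
  norm at most 1.\<close>

lemma compact_line: "compact line_z"
proof -
  have "line_z = line_point 1 2 ` cball 0 1 \<union> line_point 2 1 ` cball 0 1"
  proof
    show "line_point 1 2 ` cball 0 1 \<union> line_point 2 1 ` cball 0 1 \<subseteq> line_z"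
      unfolding line_z_eq by auto
    have *: "p \<in> line_point 1 2 ` cball 0 1 \<union> line_point 2 1 ` cball 0 1"
      if p: "p \<in> line_z" "p \<in> affine_chart i" and ij: "line_idx i j" for p i j
    proof (cases "norm (affine_coord i j p) \<le> 1")
      case True
      then have "p \<in> line_point i j ` cball 0 1"
        using line_point_coord[OF ij, of p] p by (metis IntI image_eqI mem_cball_0)
      then show ?thesis using ij by blast
    next
      case False
      then have j: "p \<in> affine_chart j" by (auto simp: affine_chart_def affine_coord_def)
      have "norm (affine_coord j i p) \<le> 1"
        using False unfolding line_coord_swap[of j i] norm_inverse by (simp add: inverse_le_1_iff)
      moreover have "line_point j i (affine_coord j i p) = p"
        using line_point_coord[of j i p] ij p j by blast
      ultimately have "p \<in> line_point j i ` cball 0 1" by (metis image_eqI mem_cball_0)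
      then show ?thesis using ij by blast
    qed
    show "line_z \<subseteq> line_point 1 2 ` cball 0 1 \<union> line_point 2 1 ` cball 0 1"
      using line_z_cover *[of _ 1 2] *[of _ 2 1] by blast
  qed
  moreover have "compact (line_point 1 2 ` cball 0 1 \<union> line_point 2 1 ` cball 0 1)"
    by (auto intro!: compact_Un compact_continuous_image continuous_on_subset[OF continuous_line_point])
  ultimately show ?thesis by simp
qed

lemma riemann_surface_line: "riemann_surface (top_of_set line_z) line_atlas"
  unfolding riemann_surface_def complex_atlas_def
proof (intro conjI)
  show "topspace (top_of_set line_z) \<noteq> {}" using line_z_eq by auto
  show "connected_space (top_of_set line_z)"
    using connected_line by (simp add: connected_space_subtopology)
  show "Hausdorff_space (top_of_set line_z)" by (rule Hausdorff_line)
  show "(\<Union>k\<in>line_atlas. fst k) = topspace (top_of_set line_z)"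
    using line_z_cover by (auto simp: line_atlas_def line_chart_def)
  have "openin (top_of_set line_z) (line_part i) \<and>
      homeomorphic_map (subtopology (top_of_set line_z) (line_part i)) euclidean (affine_coord i j)"
    if ij: "line_idx i j" for i j
  proof
    show "openin (top_of_set line_z) (line_part i)"
      by (rule openin_open_Int[OF open_affine_chart])
    have "homeomorphic_maps (top_of_set (line_part i)) euclidean (affine_coord i j) (line_point i j)"
      unfolding homeomorphic_maps_def
      using continuous_on_subset[OF continuous_affine_coord[of i j], of "line_part i"]
        continuous_line_point[OF ij] line_point_in[OF ij] coord_line_point[OF ij] line_point_coord[OF ij]
      by (auto simp: continuous_map_in_subtopology)
    moreover have "subtopology (top_of_set line_z) (line_part i) = top_of_set (line_part i)"
      by (simp add: subtopology_subtopology)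
    ultimately show "homeomorphic_map (subtopology (top_of_set line_z) (line_part i)) euclidean (affine_coord i j)"
      using homeomorphic_map_maps by metis
  qed
  from this[of 1 2] this[of 2 1]
  show "\<forall>(U, f)\<in>line_atlas. openin (top_of_set line_z) U \<and> open (f ` U) \<and>
        homeomorphic_map (subtopology (top_of_set line_z) U) (top_of_set (f ` U)) f"
    by (auto simp: line_atlas_def line_chart_def image_line_chart)
  show "\<forall>k\<in>line_atlas. \<forall>l\<in>line_atlas. transition k l holomorphic_on snd k ` (fst k \<inter> fst l)"
    using line_overlap[of 1 2] line_overlap[of 2 1]
    by (auto simp: line_atlas_def transition_line_self transition_line_swap)
      (auto simp: line_chart_def intro!: holomorphic_intros)
qed

text \<open>The coefficient in one chart is entire, and the change of chart \<open>1/z\<close> gives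
  it the factor \<open>-1/z^2\<close> times a function bounded near infinity. Hence it tends to 0 at
  infinity, and Liouville's theorem makes it zero.\<close>

lemma holomorphic_forms_line: "holomorphic_forms line_atlas = {0}"
proof (intro equalityI subsetI)
  fix \<omega> assume w: "\<omega> \<in> holomorphic_forms line_atlas"
  have zero: "\<omega> (line_chart i j) z = 0" if ij: "line_idx i j" for i j z
  proof -
    have mem: "line_chart i j \<in> line_atlas" "line_chart j i \<in> line_atlas" using ij by (auto simp: line_atlas_def)
    have im: "snd (line_chart i j) ` fst (line_chart i j) = UNIV" "snd (line_chart j i) ` fst (line_chart j i) = UNIV"
      using ij image_line_chart by (auto simp: line_chart_def)
    have hol: "\<omega> (line_chart i j) holomorphic_on UNIV" "\<omega> (line_chart j i) holomorphic_on UNIV"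
      using w mem im unfolding holomorphic_forms_def by auto
    have trans: "\<omega> (line_chart i j) z = \<omega> (line_chart j i) (inverse z) * (- inverse (z^2))" if "z \<noteq> 0" for z
    proof -
      have "z \<in> snd (line_chart i j) ` (fst (line_chart i j) \<inter> fst (line_chart j i))"
        using line_overlap[OF ij] that by (auto simp: line_chart_def)
      then have "\<omega> (line_chart i j) z = \<omega> (line_chart j i) (transition (line_chart i j) (line_chart j i) z)
          * deriv (transition (line_chart i j) (line_chart j i)) z"
        using w mem unfolding holomorphic_forms_def by blast
      moreover have "deriv inverse z = - inverse (z^2)"
        using DERIV_inverse[OF that] by (simp add: DERIV_imp_deriv power2_eq_square numeral_2_eq_2)
      ultimately show ?thesis using transition_line_swap[OF ij] by simp
    qed
    have lim: "((\<lambda>z. \<omega> (line_chart j i) (inverse z) * (- (inverse z^2))) \<longlongrightarrow> \<omega> (line_chart j i) 0 * (- (0^2))) at_infinity"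
    proof (intro tendsto_intros)
      have i0: "(inverse \<longlongrightarrow> (0::complex)) at_infinity" by (rule tendsto_inverse_0)
      have "isCont (\<omega> (line_chart j i)) 0"
        using holomorphic_on_imp_continuous_on[OF hol(2)] by (simp add: continuous_on_eq_continuous_at)
      then show "((\<lambda>z. \<omega> (line_chart j i) (inverse z)) \<longlongrightarrow> \<omega> (line_chart j i) 0) at_infinity"
        using i0 by (rule isCont_tendsto_compose)
      show "(inverse \<longlongrightarrow> (0::complex)) at_infinity" by (rule i0)
    qed
    have "\<forall>\<^sub>F z in at_infinity. \<omega> (line_chart j i) (inverse z) * (- (inverse z^2)) = \<omega> (line_chart i j) z"
      unfolding eventually_at_infinity using trans
      by (intro exI[of _ 1]) (metis norm_zero not_one_le_zero power_inverse)
    from Lim_transform_eventually[OF lim this] have "(\<omega> (line_chart i j) \<longlongrightarrow> 0) at_infinity" by simp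
    then show ?thesis by (rule Liouville_weak_0[OF hol(1)])
  qed
  have "\<omega> k z = 0" for k z
  proof (cases "k \<in> line_atlas")
    case True
    then show ?thesis using zero by (auto simp: line_atlas_def)
  next
    case False
    then show ?thesis using w unfolding holomorphic_forms_def mem_Collect_eq by blast
  qed
  then show "\<omega> \<in> {0}" by (auto simp: fun_eq_iff)
qed (auto simp: holomorphic_forms_def zero_fun_def)

lemma has_genus_line: "has_genus line_atlas 0"
  unfolding has_genus_def
  by (intro exI[of _ "{}"]) (auto simp: holomorphic_forms_line form_space.independent_empty)

section \<open>Singular cubics without lines\<close>

text \<open>Any \<open>a\<close>, \<open>b\<close> that span a subspace on which the cubic vanishes
  must be linearly dependent, so projectively no line lies on the curve.\<close>

definition no_line :: "(nat \<Rightarrow> complex) \<Rightarrow> bool" where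
  "no_line c \<longleftrightarrow> (\<forall>a b. (\<forall>s t. cubic c (s *s a + t *s b) = 0) \<longrightarrow>
     (\<exists>s t. (s, t) \<noteq> (0, 0) \<and> s *s a + t *s b = 0))"

definition basis3 :: "complex^3 \<Rightarrow> complex^3 \<Rightarrow> complex^3 \<Rightarrow> bool" where
  "basis3 u w q \<longleftrightarrow> (\<forall>v. \<exists>x y z. v = x *s u + y *s w + z *s q) \<and>
     (\<forall>x y z. x *s u + y *s w + z *s q = 0 \<longrightarrow> x = 0 \<and> y = 0 \<and> z = 0)"

lemma cubic_expand:
  "cubic c (x *s u + y *s w + z *s q) =
     z ^ 3 * polar c q q q + z\<^sup>2 * (3 * polar c q q u * x + 3 * polar c q q w * y)
   + z * (3 * polar c q u u * x\<^sup>2 + 6 * polar c q u w * x * y + 3 * polar c q w w * y\<^sup>2)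
   + (polar c u u u * x ^ 3 + 3 * polar c u u w * x\<^sup>2 * y + 3 * polar c u w w * x * y\<^sup>2 + polar c w w w * y ^ 3)"
  by (simp add: cubic_polar polar_add polar_scale polar_commute)
     (simp add: algebra_simps power2_eq_square power3_eq_cube)

lemma binary_quadratic_root:
  fixes a b c :: complex
  shows "\<exists>x y. (x, y) \<noteq> (0, 0) \<and> a * x\<^sup>2 + b * x * y + c * y\<^sup>2 = 0"
proof (cases "a = 0")
  case True
  then show ?thesis by (intro exI[of _ 1] exI[of _ 0]) simp
next
  case False
  then obtain x where "poly [:c, b, a:] x = 0"
    using alg_closed_imp_poly_has_root[of "[:c, b, a:]"] by auto
  then show ?thesis by (intro exI[of _ x] exI[of _ 1]) (simp add: algebra_simps power2_eq_square)
qed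

lemma binary_cubic_root:
  fixes a b c d :: complex
  shows "\<exists>x y. (x, y) \<noteq> (0, 0) \<and> a * x ^ 3 + b * x\<^sup>2 * y + c * x * y\<^sup>2 + d * y ^ 3 = 0"
proof (cases "a = 0")
  case True
  then show ?thesis by (intro exI[of _ 1] exI[of _ 0]) simp
next
  case False
  then obtain x where "poly [:d, c, b, a:] x = 0"
    using alg_closed_imp_poly_has_root[of "[:d, c, b, a:]"] by auto
  then show ?thesis by (intro exI[of _ x] exI[of _ 1]) (simp add: algebra_simps power2_eq_square power3_eq_cube)
qed

lemma coprime_no_common_root:
  fixes p q :: "complex poly"
  assumes "\<And>x. poly p x = 0 \<Longrightarrow> poly q x \<noteq> 0" "p \<noteq> 0"
  shows "coprime p q"
proof (rule coprimeI)
  fix r assume r: "r dvd p" "r dvd q"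
  show "is_unit r"
  proof (rule ccontr)
    assume nu: "\<not> is_unit r"
    have "r \<noteq> 0" using r assms(2) by auto
    then have "degree r \<noteq> 0" using nu is_unit_iff_degree by blast
    then obtain x where "poly r x = 0" using alg_closed_imp_poly_has_root[of r] by auto
    then show False using r assms(1)[of x] by (metis dvd_trans poly_eq_0_iff_dvd)
  qed
qed

locale singular_cubic =
  fixes c :: "nat \<Rightarrow> complex" and q :: "complex^3"
  assumes q_nonzero: "q \<noteq> 0"
    and singular: "\<And>h. polar c q q h = 0"
    and no_line: "no_line c"

lemma axis_scale_sum: "v = v$1 *s axis 1 1 + v$2 *s axis 2 1 + v$3 *s axis 3 1"
  for v :: "complex^3"
  by (simp add: vec_eq_iff forall_3 axis_def)

lemma basis3_exists:
  assumes "q \<noteq> (0 :: complex^3)"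
  shows "\<exists>u w. basis3 u w q"
proof -
  have *: "basis3 (axis i 1) (axis j 1) q" if "q $ k \<noteq> 0"
    "(i = 1 \<and> j = 2 \<and> k = 3) \<or> (i = 1 \<and> j = 3 \<and> k = 2) \<or> (i = 2 \<and> j = 3 \<and> k = 1)" for i j k :: 3
    unfolding basis3_def
  proof (intro conjI allI impI)
    fix v
    show "\<exists>x y z. v = x *s axis i 1 + y *s axis j 1 + z *s q"
      by (rule exI[of _ "v$i - v$k / q$k * q$i"], rule exI[of _ "v$j - v$k / q$k * q$j"], rule exI[of _ "v$k / q$k"])
        (use that in \<open>auto simp: vec_eq_iff forall_3 axis_def\<close>)
  qed (use that in \<open>auto simp: vec_eq_iff forall_3 axis_def\<close>)
  have "q$1 \<noteq> 0 \<or> q$2 \<noteq> 0 \<or> q$3 \<noteq> 0" using assms by (simp add: vec_eq_iff forall_3)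
  then show ?thesis using *[of 3 1 2] *[of 2 1 3] *[of 1 2 3] by blast
qed

context singular_cubic
begin

lemma singular': "polar c q h q = 0" "polar c h q q = 0"
  using singular by (metis polar_commute)+

text \<open>If the quadratic form \<open>polar c q\<close> were zero on the span of \<open>u\<close>
  and \<open>w\<close>, the equation would be a binary cubic in these directions, hence a cone over
  its roots, and each root would give a line through \<open>q\<close>. A nonzero quadratic form in
  two variables is nonzero at one of \<open>u\<close>, \<open>w\<close>,
  \<open>u + w\<close>.\<close>

lemma singular_basis:
  obtains u w where "basis3 u w q" "polar c q u u \<noteq> 0"
proof -
  obtain u w where b: "basis3 u w q" using basis3_exists[OF q_nonzero] by blast
  have "\<not> (polar c q u u = 0 \<and> polar c q u w = 0 \<and> polar c q w w = 0)"
  proof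
    assume 0: "polar c q u u = 0 \<and> polar c q u w = 0 \<and> polar c q w w = 0"
    obtain x y where xy: "(x, y) \<noteq> (0, 0)"
      "polar c u u u * x ^ 3 + 3 * polar c u u w * x\<^sup>2 * y + 3 * polar c u w w * x * y\<^sup>2 + polar c w w w * y ^ 3 = 0"
      using binary_cubic_root[of "polar c u u u" "3 * polar c u u w" "3 * polar c u w w" "polar c w w w"] by blast
    have "cubic c (s *s (x *s u + y *s w) + t *s q) = 0" for s t
    proof -
      have "s *s (x *s u + y *s w) + t *s q = (s * x) *s u + (s * y) *s w + t *s q"
        by (simp add: vec_eq_iff algebra_simps)
      then have "cubic c (s *s (x *s u + y *s w) + t *s q) =
          s ^ 3 * (polar c u u u * x ^ 3 + 3 * polar c u u w * x\<^sup>2 * y + 3 * polar c u w w * x * y\<^sup>2 + polar c w w w * y ^ 3)"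
        unfolding \<open>s *s (x *s u + y *s w) + t *s q = _\<close> cubic_expand
        using 0 singular by (simp add: algebra_simps power2_eq_square power3_eq_cube)
      then show ?thesis using xy by simp
    qed
    then obtain s t where st: "(s, t) \<noteq> (0, 0)" "s *s (x *s u + y *s w) + t *s q = 0"
      using no_line unfolding no_line_def by meson
    have "s *s (x *s u + y *s w) + t *s q = (s * x) *s u + (s * y) *s w + t *s q"
      by (simp add: vec_eq_iff algebra_simps)
    then have "s * x = 0 \<and> s * y = 0 \<and> t = 0" using b st(2) unfolding basis3_def by metis
    then show False using st xy by auto
  qed
  then consider "polar c q u u \<noteq> 0" | "polar c q w w \<noteq> 0"
    | "polar c q u u = 0" "polar c q w w = 0" "polar c q u w \<noteq> 0" by blast
  then show ?thesis
  proof cases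
    case 1
    then show ?thesis using that b by blast
  next
    case 2
    have "basis3 w u q" using b unfolding basis3_def by (metis add.commute)
    then show ?thesis using that 2 by blast
  next
    case 3
    have "polar c q (u + w) (u + w) \<noteq> 0"
      using 3 by (simp add: polar_add polar_commute(2)[of c q w u])
    moreover have "basis3 (u + w) w q"
      unfolding basis3_def
    proof (intro conjI allI impI)
      fix v
      obtain x y z where "v = x *s u + y *s w + z *s q" using b unfolding basis3_def by blast
      then have "v = x *s (u + w) + (y - x) *s w + z *s q" by (simp add: vec_eq_iff algebra_simps)
      then show "\<exists>x y z. v = x *s (u + w) + y *s w + z *s q" by blast
    next
      fix x y z
      assume "x *s (u + w) + y *s w + z *s q = 0"
      moreover have "x *s (u + w) + y *s w + z *s q = x *s u + (x + y) *s w + z *s q"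
        by (simp add: vec_eq_iff algebra_simps)
      ultimately have "x = 0 \<and> x + y = 0 \<and> z = 0" using b unfolding basis3_def by metis
      then show "x = 0" "y = 0" "z = 0" by auto
    qed
    ultimately show ?thesis using that by blast
  qed
qed

end

text \<open>With the singular point at \<open>q\<close> the cubic is \<open>z * tang x y + rest x y\<close>, so the lines through
  \<open>q\<close> parametrize it by \<open>(x, y) \<mapsto> tang x y (x u + y w) - rest x y q\<close>.\<close>

locale singular_cubic_basis = singular_cubic +
  fixes u w :: "complex^3"
  assumes basis: "basis3 u w q"
    and lead: "polar c q u u \<noteq> 0"
begin

text \<open>Three times the quadratic form \<open>polar c q\<close>; its zeros are the directions of
  the tangent cone at \<open>q\<close>.\<close>

definition tang :: "complex \<Rightarrow> complex \<Rightarrow> complex" where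
  "tang x y = 3 * polar c q u u * x\<^sup>2 + 6 * polar c q u w * x * y + 3 * polar c q w w * y\<^sup>2"

definition rest :: "complex \<Rightarrow> complex \<Rightarrow> complex" where
  "rest x y = polar c u u u * x ^ 3 + 3 * polar c u u w * x\<^sup>2 * y + 3 * polar c u w w * x * y\<^sup>2 + polar c w w w * y ^ 3"

definition param :: "complex \<Rightarrow> complex \<Rightarrow> complex^3" where
  "param x y = (tang x y * x) *s u + (tang x y * y) *s w + (- rest x y) *s q"

lemma cubic_eq: "cubic c (x *s u + y *s w + z *s q) = z * tang x y + rest x y"
  by (simp add: cubic_expand tang_def rest_def singular)

lemma coords: obtains x y z where "v = x *s u + y *s w + z *s q"
  using basis unfolding basis3_def by blast

lemma coords_eq_0: "x *s u + y *s w + z *s q = 0 \<longleftrightarrow> x = 0 \<and> y = 0 \<and> z = 0"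
  using basis unfolding basis3_def by auto

lemma coords_inject:
  "x *s u + y *s w + z *s q = x' *s u + y' *s w + z' *s q \<longleftrightarrow> x = x' \<and> y = y' \<and> z = z'"
proof
  assume "x *s u + y *s w + z *s q = x' *s u + y' *s w + z' *s q"
  then have "(x - x') *s u + (y - y') *s w + (z - z') *s q = 0" by (simp add: vec_eq_iff algebra_simps)
  then have "x - x' = 0 \<and> y - y' = 0 \<and> z - z' = 0" by (simp only: coords_eq_0)
  then show "x = x' \<and> y = y' \<and> z = z'" by simp
qed auto

lemma scale_coords: "k *s (x *s u + y *s w + z *s q) = (k * x) *s u + (k * y) *s w + (k * z) *s q"
  by (simp add: vec_eq_iff algebra_simps)

lemma tang_scale: "tang (k * x) (k * y) = k\<^sup>2 * tang x y"
  by (simp add: tang_def algebra_simps power2_eq_square)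

lemma rest_scale: "rest (k * x) (k * y) = k ^ 3 * rest x y"
  by (simp add: rest_def algebra_simps power2_eq_square power3_eq_cube)

lemma param_scale: "param (k * x) (k * y) = k ^ 3 *s param x y"
  unfolding param_def scale_coords tang_scale rest_scale
  by (simp add: power2_eq_square power3_eq_cube mult_ac)

text \<open>A common zero would put the whole line through \<open>q\<close> and
  \<open>x u + y w\<close> on the curve.\<close>

lemma no_common_zero:
  assumes "(x, y) \<noteq> (0, 0)" "tang x y = 0"
  shows "rest x y \<noteq> 0"
proof
  assume 0: "rest x y = 0"
  have eq: "s *s (x *s u + y *s w) + t *s q = (s * x) *s u + (s * y) *s w + t *s q" for s t
    by (simp add: vec_eq_iff algebra_simps)
  have "\<forall>s t. cubic c (s *s (x *s u + y *s w) + t *s q) = 0"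
    unfolding eq cubic_eq tang_scale rest_scale using 0 assms(2) by simp
  then obtain s t where "(s, t) \<noteq> (0, 0)" "s *s (x *s u + y *s w) + t *s q = 0"
    using no_line unfolding no_line_def by meson
  then show False unfolding eq coords_eq_0 using assms(1) by auto
qed

lemma param_nonzero: "(x, y) \<noteq> (0, 0) \<Longrightarrow> param x y \<noteq> 0"
  unfolding param_def coords_eq_0 using no_common_zero[of x y] by auto

lemma cubic_param: "cubic c (param x y) = 0"
  unfolding param_def cubic_eq tang_scale rest_scale by (simp add: power2_eq_square power3_eq_cube)

lemma param_surj:
  assumes "v \<noteq> 0" "cubic c v = 0"
  shows "\<exists>x y k. (x, y) \<noteq> (0, 0) \<and> k \<noteq> 0 \<and> param x y = k *s v"
proof -
  obtain x y z where v: "v = x *s u + y *s w + z *s q" by (rule coords)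
  show ?thesis
  proof (cases "(x, y) = (0, 0)")
    case True
    \<comment> \<open>Here \<open>v\<close> is a multiple of \<open>q\<close>, which is reached from
      the tangent directions.\<close>
    obtain x' y' where xy: "(x', y') \<noteq> (0, 0)" "tang x' y' = 0"
      using binary_quadratic_root[of "3 * polar c q u u" "6 * polar c q u w" "3 * polar c q w w"]
      unfolding tang_def by blast
    have "z \<noteq> 0" using True assms(1) v by auto
    then have "param x' y' = (- rest x' y' / z) *s v"
      unfolding v scale_coords param_def coords_inject using True xy by simp
    then show ?thesis using xy no_common_zero \<open>z \<noteq> 0\<close> by (metis divide_eq_0_iff neg_equal_0_iff_equal)
  next
    case False
    have 0: "z * tang x y + rest x y = 0" using assms(2) v cubic_eq by simp
    then have "tang x y \<noteq> 0" using no_common_zero[OF False] by auto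
    moreover have "param x y = tang x y *s v"
      unfolding v scale_coords param_def coords_inject using 0 by (simp add: add_eq_0_iff mult.commute)
    ultimately show ?thesis using False by blast
  qed
qed

text \<open>For \<open>tang x y \<noteq> 0\<close> the image is not \<open>q\<close>, and projecting
  it from \<open>q\<close> recovers the direction.\<close>

lemma param_inject:
  assumes "param x' y' = k *s param x y" "tang x y \<noteq> 0" "k \<noteq> 0"
  shows "x' * y = x * y'"
proof -
  have "tang x' y' * x' = k * (tang x y * x)" "tang x' y' * y' = k * (tang x y * y)"
    using assms(1) unfolding param_def scale_coords coords_inject by auto
  then have "k * tang x y * (x * y') * tang x' y' = k * tang x y * (x' * y) * tang x' y'" by Groebner_Basis.algebra
  moreover have "tang x' y' \<noteq> 0 \<or> (x = 0 \<and> y = 0)"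
    using \<open>tang x' y' * x' = k * (tang x y * x)\<close> \<open>tang x' y' * y' = k * (tang x y * y)\<close> assms by auto
  ultimately show ?thesis using assms by auto
qed

subsection \<open>Uniqueness of the equation\<close>

text \<open>In the chart \<open>y = 1\<close> the curve is the graph \<open>z = - a3 / a2\<close>.
  Since \<open>d\<close> vanishes at \<open>q\<close> it has no term in \<open>z^3\<close>, and
  inserting the graph gives \<open>a2^2 p3 - a2 a3 p2 + a3^2 p1 = 0\<close>. As \<open>a2\<close>
  and \<open>a3\<close> are coprime, \<open>a2\<close> divides \<open>p1\<close>, whose degree is at
  most 1 while that of \<open>a2\<close> is 2; so \<open>p1 = 0\<close>. Then \<open>a2\<close>
  divides \<open>p2\<close>, the quotient is a constant \<open>k\<close>, and
  \<open>p3 = k a3\<close> follows.\<close>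

lemma vanishing_cubic:
  assumes d: "\<And>v. cubic c v = 0 \<Longrightarrow> cubic d v = 0"
  obtains k where "\<And>v. cubic d v = k * cubic c v"
proof -
  define a2 where "a2 = [:3 * polar c q w w, 6 * polar c q u w, 3 * polar c q u u:]"
  define a3 where "a3 = [:polar c w w w, 3 * polar c u w w, 3 * polar c u u w, polar c u u u:]"
  define p1 where "p1 = [:3 * polar d q q w, 3 * polar d q q u:]"
  define p2 where "p2 = [:3 * polar d q w w, 6 * polar d q u w, 3 * polar d q u u:]"
  define p3 where "p3 = [:polar d w w w, 3 * polar d u w w, 3 * polar d u u w, polar d u u u:]"
  have deg: "degree a2 = 2" "a2 \<noteq> 0" using lead by (auto simp: a2_def)
  have a: "poly a2 x = tang x 1" "poly a3 x = rest x 1" for x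
    by (simp_all add: a2_def a3_def tang_def rest_def algebra_simps power2_eq_square power3_eq_cube)
  have p0: "polar d q q q = 0"
    using d[of q] by (simp add: cubic_polar singular)
  have dd: "cubic d (x *s u + 1 *s w + z *s q) = z\<^sup>2 * poly p1 x + z * poly p2 x + poly p3 x" for x z
    unfolding cubic_expand p0 by (simp add: p1_def p2_def p3_def algebra_simps power2_eq_square power3_eq_cube)
  \<comment> \<open>The additional factor \<open>a2\<close> makes the identity hold also at the
    zeros of \<open>a2\<close>, where there is no value of \<open>z\<close> to insert; it is
    cancelled afterwards.\<close>
  have "poly (a2 * (a2 ^ 2 * p3 - a2 * a3 * p2 + a3 ^ 2 * p1)) x = 0" for x
  proof (cases "tang x 1 = 0")
    case True
    then show ?thesis by (simp add: a)
  next
    case False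
    define k where "k = - rest x 1 / tang x 1"
    have k: "rest x 1 = - (k * tang x 1)" using False by (simp add: k_def)
    have "tang x 1 *s (x *s u + 1 *s w + k *s q) = param x 1"
      unfolding scale_coords param_def coords_inject k by (simp add: mult.commute)
    then have "tang x 1 ^ 3 * cubic d (x *s u + 1 *s w + k *s q) = 0"
      using d[OF cubic_param] by (metis cubic_scale)
    then have "k\<^sup>2 * poly p1 x + k * poly p2 x + poly p3 x = 0"
      unfolding dd using False by simp
    then have "tang x 1 * (tang x 1 ^ 2 * poly p3 x - tang x 1 * rest x 1 * poly p2 x + rest x 1 ^ 2 * poly p1 x) = 0"
      using k by Groebner_Basis.algebra
    then show ?thesis by (simp add: a)
  qed
  then have "a2 ^ 2 * p3 - a2 * a3 * p2 + a3 ^ 2 * p1 = 0"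
    using poly_all_0_iff_0 deg(2) by (metis mult_eq_0_iff)
  then have main: "a2 * (a3 * p2 - a2 * p3) = a3 ^ 2 * p1" by (simp add: algebra_simps power2_eq_square)
  have cop: "coprime a2 a3"
    by (rule coprime_no_common_root) (use no_common_zero[of _ 1] deg in \<open>auto simp: a\<close>)
  have "a2 dvd a3 ^ 2 * p1" using main by (metis dvd_triv_left)
  moreover have "coprime a2 (a3 ^ 2)" using cop by simp
  ultimately have "a2 dvd p1" using coprime_dvd_mult_right_iff by blast
  moreover have "degree p1 < degree a2" using deg(1) by (simp add: p1_def)
  ultimately have p1: "p1 = 0" by (metis dvd_imp_degree_le not_le)
  then have "a3 * p2 - a2 * p3 = 0" using main deg(2) by (metis mult_zero_right mult_eq_0_iff)
  then have e: "a3 * p2 = a2 * p3" by simp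
  then have "a2 dvd a3 * p2" by simp
  then have "a2 dvd p2" using cop coprime_dvd_mult_right_iff by blast
  then obtain r where r: "p2 = a2 * r" by blast
  have "degree p2 \<le> 2" by (simp add: p2_def)
  then have "degree r = 0" using degree_mult_eq[OF deg(2), of r] deg(1) unfolding r by (cases "r = 0") simp_all
  then obtain k where "r = [:k:]" by (metis degree_0_id)
  then have k2: "p2 = smult k a2" using r by simp
  then have "a2 * p3 = a2 * smult k a3" using e by (simp add: mult.commute)
  then have k3: "p3 = smult k a3" using deg(2) by (metis mult_left_cancel)
  have "cubic d (x *s u + y *s w + z *s q) = k * cubic c (x *s u + y *s w + z *s q)" for x y z
    unfolding cubic_expand p0
    using p1 k2 k3 unfolding p1_def p2_def p3_def a2_def a3_def
    by (simp add: singular algebra_simps)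
  then show ?thesis using that coords by metis
qed

lemma not_all_vanish: "\<exists>v. v \<noteq> 0 \<and> cubic c v \<noteq> 0"
proof -
  have "cubic c (1 *s u + 0 *s w + z *s q) = z * tang 1 0 + rest 1 0" for z
    by (rule cubic_eq)
  from this[of "(1 - rest 1 0) / tang 1 0"] have "cubic c (1 *s u + 0 *s w + ((1 - rest 1 0) / tang 1 0) *s q) = 1"
    using lead by (simp add: tang_def)
  then show ?thesis by (metis cubic_zero zero_neq_one)
qed

text \<open>If \<open>Q\<close> of lower degree had the same zeros, then \<open>Q\<close> times a
  power of any coordinate would be a cubic vanishing on the curve, so a multiple of the equation. A
  nonzero multiple would put that coordinate line on the curve. So all these products are zero, and
  \<open>Q\<close> vanishes at a point off the curve.\<close>

lemma minimal_equation_cubic: "minimal_equation 3 (poly_of c) (cubic_curve c)"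
  unfolding minimal_equation_def
proof (intro conjI allI impI notI)
  obtain v0 where v0: "v0 \<noteq> 0" "cubic c v0 \<noteq> 0" using not_all_vanish by blast
  show "homogeneous 3 (poly_of c)" "cubic_curve c = zero_locus (poly_of c)"
    by (rule homogeneous_poly_of) (simp add: zero_locus_poly_of)
  show "poly_of c = 0 \<Longrightarrow> False"
    using v0 poly_eval_poly_of[of c v0] by (simp add: poly_eval_def)
  fix e assume "e < 3" "\<exists>Q. Q \<noteq> 0 \<and> homogeneous e Q \<and> cubic_curve c = zero_locus Q"
  then obtain Q where e: "e < 3" and Q: "homogeneous e Q" "cubic_curve c = zero_locus Q" by blast
  have van: "cubic c v = 0 \<longleftrightarrow> poly_eval Q v = 0" if "v \<noteq> 0" for v
    using that proj_in_cubic_curve[OF that, of c] proj_in_zero_locus[OF Q(1) that] Q(2) by simp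
  have prod0: "poly_eval Q v * v $ i ^ (3 - e) = 0" for i v
  proof -
    obtain d where d: "\<forall>v. poly_eval Q v * v$i ^ (3 - e) = cubic d v"
      using lower_degree_times_power[OF Q(1) e] by blast
    have "cubic d v = 0" if "cubic c v = 0" for v
      using that van[of v] d by (cases "v = 0") (simp_all, metis mult_zero_left)
    then obtain k where k: "\<And>v. cubic d v = k * cubic c v" using vanishing_cubic[of d] by blast
    have "k = 0"
    proof (rule ccontr)
      assume "k \<noteq> 0"
      have line: "cubic c v = 0" if "v $ i = 0" for v
        using k[of v] d e that \<open>k \<noteq> 0\<close> by (metis mult_eq_0_iff power_eq_0_iff zero_less_diff)
      have "\<exists>a b. a \<noteq> b \<and> a \<noteq> i \<and> b \<noteq> i"
        using exhaust_3[of i] by (elim disjE) (rule exI[of _ 2] exI[of _ 1], rule exI[of _ 3] exI[of _ 2], simp)+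
      then obtain a b :: 3 where ab: "a \<noteq> b" "a \<noteq> i" "b \<noteq> i" by blast
      have "\<forall>s t. cubic c (s *s axis a 1 + t *s axis b 1) = 0"
        using line ab by (simp add: axis_def)
      then obtain s t where st: "(s, t) \<noteq> (0, 0)" "s *s axis a 1 + t *s axis b 1 = (0 :: complex^3)"
        using no_line unfolding no_line_def by meson
      have "(s *s axis a 1 + t *s axis b 1) $ a = s" "(s *s axis a 1 + t *s axis b 1) $ b = t"
        using ab by (simp_all add: axis_def)
      then show False using st by simp
    qed
    then show ?thesis using d k by simp
  qed
  have "\<exists>i. v0 $ i \<noteq> 0" using v0(1) by (auto simp: vec_eq_iff)
  then obtain i where "v0 $ i \<noteq> 0" by blast
  then have "poly_eval Q v0 = 0" using prod0[of v0 i] by simp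
  then show False using van v0 by blast
qed

lemma plane_curve_cubic: "plane_curve 3 (cubic_curve c)"
  unfolding plane_curve_def using minimal_equation_cubic by blast

text \<open>\<open>singular_points\<close> quantifies over all minimal equations, so each of them
  has to be controlled. Equality of zero loci is turned into proportionality by
  \<open>vanishing_cubic\<close>.\<close>

lemma minimal_equation_unique:
  assumes "minimal_equation e P (cubic_curve c)"
  obtains k where "e = 3" "k \<noteq> 0" "\<And>v. poly_eval P v = k * cubic c v"
proof -
  have "\<not> e < 3" "\<not> 3 < e"
    using assms minimal_equation_cubic unfolding minimal_equation_def by blast+
  then have e: "e = 3" by simp
  have P: "homogeneous 3 P" "cubic_curve c = cubic_curve (coeffs_of P)" "P \<noteq> 0"
    using assms zero_locus_cubic[of P] unfolding e minimal_equation_def by auto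
  have "cubic (coeffs_of P) v = 0" if "cubic c v = 0" for v
    using that P(2) proj_in_cubic_curve[of v c] proj_in_cubic_curve[of v "coeffs_of P"]
    by (cases "v = 0") auto
  then obtain k where k: "\<And>v. cubic (coeffs_of P) v = k * cubic c v"
    using vanishing_cubic[of "coeffs_of P"] by blast
  have "k \<noteq> 0"
    using k cubic_eq_0_coeffs[of "coeffs_of P"] coeffs_of_eq_0[OF P(1)] P(3) by auto
  then show ?thesis using that e k poly_eval_cubic[OF P(1)] by simp
qed

text \<open>At a singular point with coordinates \<open>x, y, z\<close> the derivative in direction
  \<open>q\<close> is \<open>tang x y\<close>, so this vanishes; then the equation leaves
  \<open>rest x y = 0\<close>, and a common zero of both must be \<open>(0, 0)\<close>.\<close>

lemma singular_points_cubic: "singular_points (cubic_curve c) = {proj q}"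
proof (intro equalityI subsetI)
  fix p assume "p \<in> singular_points (cubic_curve c)"
  then obtain v e P where v: "p = proj v" "v \<noteq> 0" "minimal_equation e P (cubic_curve c)"
    "poly_eval P v = 0" "\<forall>i. deriv (\<lambda>t. poly_eval P (v + t *s axis i 1)) 0 = 0"
    unfolding singular_points_def by blast
  obtain k where k: "k \<noteq> 0" "\<And>v. poly_eval P v = k * cubic c v"
    using minimal_equation_unique[OF v(3)] by metis
  have "polar c v v (axis i 1) = 0" for i
  proof -
    have "deriv (\<lambda>t. k * cubic c (v + t *s axis i 1)) 0 = 0" using v(5) by (simp add: k)
    moreover have "(\<lambda>t. k * cubic c (v + t *s axis i 1)) = (\<lambda>t. cubic (\<lambda>n. k * c n) (v + t *s axis i 1))"
      by (simp add: cubic_def fun_eq_iff algebra_simps)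
    ultimately have "3 * polar (\<lambda>n. k * c n) v v (axis i 1) = 0" using deriv_cubic by metis
    then show ?thesis using polar_lincomb[of k c 0 c v v "axis i 1"] k(1) by simp
  qed
  then have "polar c v v (q$1 *s axis 1 1 + q$2 *s axis 2 1 + q$3 *s axis 3 1) = 0"
    by (simp add: polar_add polar_scale)
  then have pq: "polar c v v q = 0" using axis_scale_sum[of q] by simp
  obtain x y z where xyz: "v = x *s u + y *s w + z *s q" by (rule coords)
  have "3 * polar c v v q = tang x y"
    unfolding xyz tang_def
    by (simp add: polar_add polar_scale polar_commute singular singular')
       (simp add: algebra_simps power2_eq_square)
  then have t: "tang x y = 0" using pq by simp
  moreover have "z * tang x y + rest x y = 0" using v(4) k xyz cubic_eq by simp
  ultimately have "(x, y) = (0, 0)" using no_common_zero[of x y] by auto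
  then have "v = z *s q" using xyz by simp
  then show "p \<in> {proj q}" using v(1,2) proj_scale[of z q] q_nonzero by auto
next
  fix p assume "p \<in> {proj q}"
  moreover have "poly_eval (poly_of c) q = 0"
    by (simp add: poly_eval_poly_of cubic_polar singular)
  moreover have "deriv (\<lambda>t. poly_eval (poly_of c) (q + t *s axis i 1)) 0 = 0" for i
    by (simp add: poly_eval_poly_of deriv_cubic singular)
  ultimately show "p \<in> singular_points (cubic_curve c)"
    unfolding singular_points_def using minimal_equation_cubic q_nonzero by blast
qed

end

section \<open>The normalization of a singular cubic and its irreducibility\<close>

lemma continuous_on_smult_vec:
  fixes u :: "complex^3"
  assumes "continuous_on S f"
  shows "continuous_on S (\<lambda>x. f x *s u)"
  unfolding vector_scalar_mult_def by (intro continuous_on_vec_lambda continuous_intros assms)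

lemma poly_eval_polynomial_curve:
  assumes "\<And>i. \<exists>p. \<forall>x. v x $ i = poly p x"
  shows "\<exists>p. \<forall>x. poly_eval P (v x) = poly p x"
proof -
  obtain p where p: "\<And>i x. v x $ i = poly (p i) x" using assms by metis
  have "poly_eval P (v x) = poly (\<Sum>m\<in>Poly_Mapping.keys P.
     smult (lookup P m) (\<Prod>i\<in>UNIV. p i ^ lookup m i)) x" for x
    by (simp add: poly_eval_def poly_sum poly_prod p)
  then show ?thesis by blast
qed

context singular_cubic_basis
begin

text \<open>The choice of representative does not matter on the line because \<open>param\<close> is
  homogeneous of degree three.\<close>

definition nu :: "cp2 \<Rightarrow> cp2" where
  "nu p = proj (param (rep_cp2 p $ 1) (rep_cp2 p $ 2))"

lemma nu_proj:
  assumes "v \<noteq> 0" "(v$1, v$2) \<noteq> (0, 0)"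
  shows "nu (proj v) = proj (param (v$1) (v$2))"
proof -
  obtain k where k: "k \<noteq> 0" "rep_cp2 (proj v) = k *s v" using rep_proj[OF assms(1)] by blast
  then have "nu (proj v) = proj (k ^ 3 *s param (v$1) (v$2))"
    unfolding nu_def by (simp add: param_scale[symmetric])
  then show ?thesis using proj_scale[OF _ param_nonzero[OF assms(2)], of "k ^ 3"] k(1) by simp
qed

lemma nu_line_point: "line_idx i j \<Longrightarrow> nu (line_point i j z) = proj (param (if i = 1 then 1 else z) (if i = 1 then z else 1))"
  unfolding line_point_def
  by (subst nu_proj[OF line_vec_nonzero]) (auto simp: axis_def)

lemma line_z_xy:
  assumes "p \<in> line_z"
  obtains x y where "(x, y) \<noteq> (0, 0)" "p = proj (x *s axis 1 1 + y *s axis 2 1)" "nu p = proj (param x y)"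
proof -
  let ?v = "rep_cp2 p"
  have 3: "?v $ 3 = 0" using assms by (simp add: line_z_def)
  then have xy: "(?v$1, ?v$2) \<noteq> (0, 0)" using rep_nonzero[of p] by (auto simp: vec_eq_iff forall_3)
  have "?v = ?v$1 *s axis 1 1 + ?v$2 *s axis 2 1" using 3 by (simp add: vec_eq_iff forall_3 axis_def)
  then have "p = proj (?v$1 *s axis 1 1 + ?v$2 *s axis 2 1)" by (metis proj_rep)
  then show ?thesis using that xy nu_def by blast
qed

lemma xy_line_z:
  assumes "(x, y) \<noteq> (0, 0)"
  shows "proj (x *s axis 1 1 + y *s axis 2 1) \<in> line_z"
    "nu (proj (x *s axis 1 1 + y *s axis 2 1)) = proj (param x y)"
proof -
  let ?v = "x *s axis 1 1 + y *s axis 2 1 :: complex^3"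
  have c: "?v $ 1 = x" "?v $ 2 = y" "?v $ 3 = 0" by (simp_all add: axis_def)
  then have "?v \<noteq> 0" using assms by (metis zero_index)
  then show "proj ?v \<in> line_z" "nu (proj ?v) = proj (param x y)"
    using proj_in_line_z nu_proj c assms by metis+
qed

lemma nu_image: "nu ` line_z = cubic_curve c"
proof (intro equalityI subsetI)
  fix p assume "p \<in> nu ` line_z"
  then obtain x y where "(x, y) \<noteq> (0, 0)" "p = proj (param x y)" using line_z_xy by (metis imageE)
  then show "p \<in> cubic_curve c" using proj_in_cubic_curve param_nonzero cubic_param by metis
next
  fix p assume "p \<in> cubic_curve c"
  then obtain v where v: "v \<noteq> 0" "cubic c v = 0" "p = proj v" by (auto simp: cubic_curve_def)
  then obtain x y k where xy: "(x, y) \<noteq> (0, 0)" "k \<noteq> 0" "param x y = k *s v" using param_surj by blast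
  then have "nu (proj (x *s axis 1 1 + y *s axis 2 1)) = p"
    using xy_line_z v proj_scale by metis
  then show "p \<in> nu ` line_z" using xy_line_z(1)[OF xy(1)] by blast
qed

lemma nu_eq_singular: "(x, y) \<noteq> (0, 0) \<Longrightarrow> proj (param x y) = proj q \<longleftrightarrow> tang x y = 0"
proof
  assume xy: "(x, y) \<noteq> (0, 0)" and "proj (param x y) = proj q"
  then obtain k where "param x y = k *s q"
    using proj_eq_iff[OF q_nonzero param_nonzero[OF xy]] by metis
  then have "param x y = 0 *s u + 0 *s w + k *s q" by simp
  then have "tang x y * x = 0" "tang x y * y = 0" unfolding param_def coords_inject by auto
  then show "tang x y = 0" using xy by auto
next
  assume xy: "(x, y) \<noteq> (0, 0)" and 0: "tang x y = 0"
  have "param x y = (- rest x y) *s q" using 0 by (simp add: param_def)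
  then show "proj (param x y) = proj q"
    using proj_scale[of "- rest x y" q] no_common_zero[OF xy 0] q_nonzero by simp
qed

text \<open>The preimages of \<open>q\<close> are the zeros of \<open>tang\<close>. By
  \<open>lead\<close> this is a nonzero quadratic polynomial in the chart \<open>y = 1\<close>, and
  a single point of the line lies outside that chart.\<close>

lemma finite_nu_singular: "finite {p \<in> line_z. nu p = proj q}"
proof -
  have "finite {z. poly [:3 * polar c q w w, 6 * polar c q u w, 3 * polar c q u u:] z = 0}"
    using lead by (intro poly_roots_finite) simp
  then have fin: "finite {z. tang z 1 = 0}" by (simp add: tang_def algebra_simps power2_eq_square)
  have "{p \<in> line_z. nu p = proj q} \<subseteq> insert (line_point 1 2 0) (line_point 2 1 ` {z. tang z 1 = 0})"
  proof
    fix p assume "p \<in> {p \<in> line_z. nu p = proj q}"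
    then have p: "p \<in> line_z" "nu p = proj q" by auto
    show "p \<in> insert (line_point 1 2 0) (line_point 2 1 ` {z. tang z 1 = 0})"
    proof (cases "p \<in> affine_chart 2")
      case True
      then obtain z where z: "p = line_point 2 1 z" using line_z_range[of 2 1] p(1) by blast
      then have "tang z 1 = 0" using p(2) nu_line_point[of 2 1 z] nu_eq_singular[of z 1] by simp
      then show ?thesis using z by blast
    next
      case False
      then have "p \<in> line_part 1" using line_z_cover p(1) by blast
      moreover have "affine_coord 1 2 p = 0" using False by (simp add: affine_chart_def affine_coord_def)
      ultimately show ?thesis using line_point_coord[of 1 2 p] by simp
    qed
  qed
  then show ?thesis using fin by (simp add: finite_subset)
qed

lemma inj_nu: "inj_on nu {p \<in> line_z. nu p \<noteq> proj q}"
proof (rule inj_onI)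
  fix p p' assume a: "p \<in> {p \<in> line_z. nu p \<noteq> proj q}" "p' \<in> {p \<in> line_z. nu p \<noteq> proj q}" "nu p = nu p'"
  obtain x y where xy: "(x, y) \<noteq> (0, 0)" "p = proj (x *s axis 1 1 + y *s axis 2 1)" "nu p = proj (param x y)"
    using line_z_xy a(1) by blast
  obtain x' y' where xy': "(x', y') \<noteq> (0, 0)" "p' = proj (x' *s axis 1 1 + y' *s axis 2 1)" "nu p' = proj (param x' y')"
    using line_z_xy a(2) by blast
  have "tang x y \<noteq> 0" using a(1) xy nu_eq_singular by auto
  moreover obtain k where k: "param x' y' = k *s param x y"
    using a(3) xy xy' proj_eq_iff[OF param_nonzero param_nonzero] by metis
  moreover have "k \<noteq> 0" using k param_nonzero[OF xy'(1)] by auto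
  ultimately have e: "x' * y = x * y'" using param_inject by blast
  have "\<exists>m. m \<noteq> 0 \<and> x' = m * x \<and> y' = m * y"
  proof (cases "x = 0")
    case True
    then have "y \<noteq> 0" "x' = 0" using xy(1) e by auto
    then show ?thesis using xy'(1) True by (intro exI[of _ "y' / y"]) auto
  next
    case False
    have "x' \<noteq> 0" using e False xy'(1) by auto
    have "y' = x' / x * y" using e False by (metis nonzero_mult_div_cancel_left times_divide_eq_left)
    then show ?thesis using False \<open>x' \<noteq> 0\<close> by (intro exI[of _ "x' / x"]) auto
  qed
  then obtain m where m: "m \<noteq> 0" "x' = m * x" "y' = m * y" by blast
  have "x *s axis 1 1 + y *s axis 2 1 \<noteq> (0 :: complex^3)"
    using xy(1) by (auto simp: vec_eq_iff forall_3 axis_def)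
  moreover have "x' *s axis 1 1 + y' *s axis 2 1 = m *s (x *s axis 1 1 + y *s axis 2 1 :: complex^3)"
    using m by (simp add: vec_eq_iff axis_def)
  ultimately show "p = p'" using xy(2) xy'(2) proj_scale[OF m(1)] by metis
qed

lemma continuous_nu: "continuous_on line_z nu"
proof -
  \<comment> \<open>The open set of points other than (0 : 0 : 1). It contains the line, and on it
    the formula for \<open>nu\<close> is legitimate, so continuity can be tested on vectors.\<close>
  let ?S = "affine_chart 1 \<union> affine_chart 2"
  have nz: "v \<noteq> 0 \<and> (v$1, v$2) \<noteq> (0, 0)" if "v \<noteq> 0 \<and> proj v \<in> ?S" for v
    using that affine_chart_proj by auto
  have "continuous_on {v. v \<noteq> 0 \<and> proj v \<in> ?S} (\<lambda>v. param (v$1) (v$2))"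
    unfolding param_def tang_def rest_def
    by (intro continuous_intros continuous_on_smult_vec)
  then have "continuous_on {v. v \<noteq> 0 \<and> proj v \<in> ?S} (proj \<circ> (\<lambda>v. param (v$1) (v$2)))"
    by (rule continuous_on_compose) (rule continuous_on_subset[OF continuous_proj], use nz param_nonzero in auto)
  then have "continuous_on {v. v \<noteq> 0 \<and> proj v \<in> ?S} (\<lambda>v. nu (proj v))"
    by (rule continuous_on_eq) (use nz nu_proj in auto)
  then have "continuous_on ?S nu"
    by (intro continuous_on_cp2I open_Un open_affine_chart)
  then show ?thesis by (rule continuous_on_subset) (use line_z_cover in auto)
qed

lemma holomorphic_nu: "holomorphic_map_cp2 (top_of_set line_z) line_atlas nu"
proof -
  have hol: "(\<lambda>z. affine_coord a b (nu (inv_into (line_part i) (affine_coord i j) z)))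
      holomorphic_on affine_coord i j ` {p \<in> line_part i. nu p \<in> affine_chart a}"
    (is "?f holomorphic_on ?S") if ij: "line_idx i j" for i j a b
  proof -
    define N where "N z = param (if i = 1 then 1 else z) (if i = 1 then z else 1)" for z
    have N0: "N z \<noteq> 0" for z unfolding N_def by (rule param_nonzero) auto
    have f: "?f z = N z $ b / N z $ a" for z
      using affine_coord_proj[OF N0] nu_line_point[OF ij] inv_line_chart[OF ij] by (simp add: N_def)
    have S: "N z $ a \<noteq> 0" if z: "z \<in> ?S" for z
    proof -
      obtain p where p: "p \<in> line_part i" "nu p \<in> affine_chart a" "z = affine_coord i j p"
        using z by blast
      then have "nu p = proj (N z)" using line_point_coord[OF ij p(1)] nu_line_point[OF ij, of z] by (simp add: N_def)
      then show ?thesis using p(2) affine_chart_proj[OF N0] by simp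
    qed
    have hN: "(\<lambda>z. N z $ l) holomorphic_on ?S" for l
      unfolding N_def param_def tang_def rest_def
      by (cases "i = 1") (auto intro!: holomorphic_intros)
    have "(\<lambda>z. N z $ b / N z $ a) holomorphic_on ?S"
      by (intro holomorphic_on_divide hN S)
    then show ?thesis unfolding f .
  qed
  show ?thesis
    unfolding holomorphic_map_cp2_def
    using continuous_nu hol[of 1 2] hol[of 2 1]
    by (simp add: line_atlas_def line_chart_def)
qed

lemma has_genus_cubic: "has_geometric_genus (cubic_curve c) 0"
  unfolding has_geometric_genus_def is_normalization_def
  using riemann_surface_line compact_line holomorphic_nu nu_image finite_nu_singular inj_nu has_genus_line
  by (intro exI[of _ "top_of_set line_z"] exI[of _ line_atlas] exI[of _ nu])
    (simp add: singular_points_cubic compact_space_subtopology)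

text \<open>Along \<open>x \<mapsto> param x 1\<close> an algebraic proper subset of the curve pulls
  back into the zeros of a nonzero polynomial. Two such subsets cannot cover the curve, since the
  product of the polynomials would vanish everywhere.\<close>

lemma irreducible_cubic: "irreducible_set (cubic_curve c)"
  unfolding irreducible_set_def
proof (intro conjI allI impI)
  show "cubic_curve c \<noteq> {}"
    using proj_in_cubic_curve[OF param_nonzero, of 1 0] cubic_param by force
  fix Y Z assume a: "algebraic_set Y \<and> algebraic_set Z \<and> cubic_curve c = Y \<union> Z"
  have sep: "\<exists>F p. (\<forall>x. poly_eval F (param x 1) = poly p x) \<and> p \<noteq> 0 \<and>
      (\<forall>x. proj (param x 1) \<in> W \<longrightarrow> poly p x = 0)"
    if W: "algebraic_set W" "W \<subseteq> cubic_curve c" "W \<noteq> cubic_curve c" for W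
  proof -
    obtain S where S: "\<forall>F\<in>S. \<exists>d. homogeneous d F" "W = (\<Inter>F\<in>S. zero_locus F)"
      using W(1) unfolding algebraic_set_def by blast
    obtain p0 where "p0 \<in> cubic_curve c" "p0 \<notin> W" using W(2,3) by blast
    then obtain F where F: "F \<in> S" "p0 \<notin> zero_locus F" using S by blast
    obtain d where d: "homogeneous d F" using S F by blast
    have "\<exists>p. \<forall>x. param x 1 $ i = poly p x" for i
    proof -
      have "param x 1 $ i = poly ([:3 * polar c q w w, 6 * polar c q u w, 3 * polar c q u u:] * [:w$i, u$i:]
         - smult (q$i) [:polar c w w w, 3 * polar c u w w, 3 * polar c u u w, polar c u u u:]) x" for x
        by (simp add: param_def tang_def rest_def algebra_simps power2_eq_square power3_eq_cube)
      then show ?thesis by blast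
    qed
    then obtain p where p: "\<forall>x. poly_eval F (param x 1) = poly p x"
      using poly_eval_polynomial_curve[of "\<lambda>x. param x 1" F] by blast
    have "p \<noteq> 0"
    proof
      assume p0: "p = 0"
      \<comment> \<open>Homogeneity carries the vanishing from \<open>y = 1\<close> to all
        \<open>y \<noteq> 0\<close>, and continuity to \<open>y = 0\<close>; so \<open>F\<close>
        would vanish on the whole curve, including \<open>p0\<close>.\<close>
      have y: "poly_eval F (param x y) = 0" if "y \<noteq> 0" for x y
        using p p0 param_scale[of y "x / y" 1] that poly_eval_scale[OF d] by simp
      have "poly_eval F (param x y) = 0" for x y
      proof -
        have "continuous_on UNIV (\<lambda>y. poly_eval F (param x y))"
          unfolding poly_eval_def param_def tang_def rest_def
          by (auto intro!: continuous_intros)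
        moreover have "closure (- {0 :: complex}) = UNIV" by (simp add: closure_complement)
        ultimately show ?thesis
          using continuous_constant_on_closure[of "- {0}" "\<lambda>y. poly_eval F (param x y)" 0 y] y by auto
      qed
      moreover obtain x y where "(x, y) \<noteq> (0, 0)" "p0 = proj (param x y)"
        using \<open>p0 \<in> cubic_curve c\<close> nu_image line_z_xy by (metis imageE)
      ultimately show False using F(2) proj_in_zero_locus[OF d param_nonzero] by metis
    qed
    moreover have "poly p x = 0" if "proj (param x 1) \<in> W" for x
    proof -
      have "proj (param x 1) \<in> zero_locus F" using that S(2) F(1) by blast
      then show ?thesis using proj_in_zero_locus[OF d param_nonzero, of x 1] p by simp
    qed
    ultimately show ?thesis using p by blast
  qed
  show "cubic_curve c = Y \<or> cubic_curve c = Z"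
  proof (rule ccontr)
    assume "\<not> (cubic_curve c = Y \<or> cubic_curve c = Z)"
    then obtain p p' where p: "p \<noteq> 0" "\<forall>x. proj (param x 1) \<in> Y \<longrightarrow> poly p x = 0"
      and p': "p' \<noteq> 0" "\<forall>x. proj (param x 1) \<in> Z \<longrightarrow> poly p' x = 0"
      using sep[of Y] sep[of Z] a by blast
    have "poly (p * p') x = 0" for x
    proof -
      have "proj (param x 1) \<in> cubic_curve c"
        using proj_in_cubic_curve[OF param_nonzero, of x 1] cubic_param by simp
      then show ?thesis using a p p' by auto
    qed
    then show False using p(1) p'(1) poly_all_0_iff_0 by (metis mult_eq_0_iff)
  qed
qed

end

context singular_cubic
begin

lemma singular_cubic_rational:
  "plane_curve 3 (cubic_curve c)" "rational_curve (cubic_curve c)"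
  "(\<And>v. cubic c v = 0 \<Longrightarrow> cubic d v = 0) \<Longrightarrow> \<exists>k. \<forall>v. cubic d v = k * cubic c v"
proof -
  obtain u w where "basis3 u w q" "polar c q u u \<noteq> 0" by (rule singular_basis)
  then interpret singular_cubic_basis c q u w by unfold_locales
  show "plane_curve 3 (cubic_curve c)" by (rule plane_curve_cubic)
  show "rational_curve (cubic_curve c)"
    unfolding rational_curve_def using irreducible_cubic has_genus_cubic by blast
  show "\<exists>k. \<forall>v. cubic d v = k * cubic c v" if "\<And>v. cubic c v = 0 \<Longrightarrow> cubic d v = 0"
    using vanishing_cubic[of d] that by metis
qed

end

section \<open>Smooth cubics are not rational\<close>

definition crossp :: "complex^3 \<Rightarrow> complex^3 \<Rightarrow> complex^3" where
  "crossp a b = vector [a$2 * b$3 - a$3 * b$2, a$3 * b$1 - a$1 * b$3, a$1 * b$2 - a$2 * b$1]"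

definition gradient :: "(nat \<Rightarrow> complex) \<Rightarrow> complex^3 \<Rightarrow> complex^3" where
  "gradient c v = (\<chi> j. polar c v v (axis j 1))"

lemma crossp_components:
  "crossp a b $ 1 = a$2 * b$3 - a$3 * b$2" "crossp a b $ 2 = a$3 * b$1 - a$1 * b$3"
  "crossp a b $ 3 = a$1 * b$2 - a$2 * b$1"
  by (simp_all add: crossp_def vector_3)

lemma gradient_sum: "polar c v v h = gradient c v $ 1 * h$1 + gradient c v $ 2 * h$2 + gradient c v $ 3 * h$3"
proof -
  have "polar c v v h = polar c v v (h$1 *s axis 1 1 + h$2 *s axis 2 1 + h$3 *s axis 3 1)"
    using axis_scale_sum[of h] by simp
  then show ?thesis by (simp add: polar_add polar_scale gradient_def mult.commute)
qed

text \<open>Both vectors lie in the kernel of the nonzero functional \<open>g\<close>. This is a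
  plane, and its normal direction is unique.\<close>

lemma crossp_parallel:
  assumes "g \<noteq> 0" "g$1 * a$1 + g$2 * a$2 + g$3 * a$3 = 0" "g$1 * b$1 + g$2 * b$2 + g$3 * b$3 = 0"
  shows "\<exists>m. crossp a b = m *s g"
proof -
  have "a$3 * (g$1 * b$1 + g$2 * b$2 + g$3 * b$3) - b$3 * (g$1 * a$1 + g$2 * a$2 + g$3 * a$3) = 0"
    "b$2 * (g$1 * a$1 + g$2 * a$2 + g$3 * a$3) - a$2 * (g$1 * b$1 + g$2 * b$2 + g$3 * b$3) = 0"
    "a$1 * (g$1 * b$1 + g$2 * b$2 + g$3 * b$3) - b$1 * (g$1 * a$1 + g$2 * a$2 + g$3 * a$3) = 0"
    unfolding assms(2,3) by simp_all
  then have "g$1 * (a$3 * b$1 - a$1 * b$3) = g$2 * (a$2 * b$3 - a$3 * b$2)"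
    "g$1 * (a$1 * b$2 - a$2 * b$1) = g$3 * (a$2 * b$3 - a$3 * b$2)"
    "g$2 * (a$1 * b$2 - a$2 * b$1) = g$3 * (a$3 * b$1 - a$1 * b$3)"
    by (simp_all add: algebra_simps)
  note eqs = this
  consider "g$1 \<noteq> 0" | "g$2 \<noteq> 0" | "g$3 \<noteq> 0" using assms(1) by (auto simp: vec_eq_iff forall_3)
  then show ?thesis
  proof cases
    case 1
    then show ?thesis using eqs
      by (intro exI[of _ "crossp a b $ 1 / g$1"]) (simp add: vec_eq_iff forall_3 crossp_components field_simps)
  next
    case 2
    then show ?thesis using eqs
      by (intro exI[of _ "crossp a b $ 2 / g$2"]) (simp add: vec_eq_iff forall_3 crossp_components field_simps)
  next
    case 3
    then show ?thesis using eqs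
      by (intro exI[of _ "crossp a b $ 3 / g$3"]) (simp add: vec_eq_iff forall_3 crossp_components field_simps)
  qed
qed

lemma smult_cancel_vec: "m *s g = m' *s g \<Longrightarrow> g \<noteq> 0 \<Longrightarrow> m = m'" for g :: "complex^3"
  by (auto simp: vec_eq_iff)

lemma has_derivative_cubic:
  assumes "\<And>j. ((\<lambda>z. V z $ j) has_field_derivative V' $ j) (at z)"
  shows "((\<lambda>z. cubic c (V z)) has_field_derivative 3 * polar c (V z) (V z) V') (at z)"
  unfolding cubic_def
  by (rule derivative_eq_intros assms refl)+
    (simp add: polar_def field_simps power2_eq_square)

lemma cubic_plane_root:
  "\<exists>s t. (s, t) \<noteq> (0, 0) \<and> cubic c (s *s a + t *s b) = 0"
proof -
  have "cubic c (s *s a + t *s b + 0 *s 0) = polar c a a a * s ^ 3 + 3 * polar c a a b * s\<^sup>2 * t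
     + 3 * polar c a b b * s * t\<^sup>2 + polar c b b b * t ^ 3" for s t
    unfolding cubic_expand by (simp add: polar_zero)
  then show ?thesis
    using binary_cubic_root[of "polar c a a a" "3 * polar c a a b" "3 * polar c a b b" "polar c b b b"] by simp
qed

text \<open>Ensures that a map onto the curve is not constant. The second point is taken on a
  coordinate line that misses the first one.\<close>

lemma cubic_curve_two_points: "\<exists>p p'. p \<in> cubic_curve c \<and> p' \<in> cubic_curve c \<and> p \<noteq> p'"
proof -
  have plane: "\<exists>v. v \<noteq> 0 \<and> cubic c v = 0 \<and> v $ i = 0" if "distinct [i, j, k]" for i j k :: 3
  proof -
    obtain s t where st: "(s, t) \<noteq> (0, 0)" "cubic c (s *s axis j 1 + t *s axis k 1) = 0"
      using cubic_plane_root by blast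
    let ?v = "s *s axis j 1 + t *s axis k 1 :: complex^3"
    have "?v $ i = 0" "?v $ j = s" "?v $ k = t" using that by (auto simp: axis_def)
    moreover from this have "?v \<noteq> 0" using st(1) by (metis zero_index)
    ultimately show ?thesis using st(2) by blast
  qed
  obtain v where v: "v \<noteq> 0" "cubic c v = 0" "v $ 3 = 0" using plane[of 3 1 2] by auto
  then have "v $ 1 \<noteq> 0 \<or> v $ 2 \<noteq> 0" by (auto simp: vec_eq_iff forall_3)
  then obtain i :: 3 where i: "v $ i \<noteq> 0" "i = 1 \<or> i = 2" by blast
  obtain w where w: "w \<noteq> 0" "cubic c w = 0" "w $ i = 0" using plane[of 1 2 3] plane[of 2 1 3] i(2) by auto
  have "proj v \<noteq> proj w" using affine_chart_proj[OF v(1), of i] affine_chart_proj[OF w(1), of i] i(1) w(3) by auto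
  then show ?thesis using proj_in_cubic_curve v w by blast
qed

text \<open>The geometric genus is 0 as soon as one normalization has genus 0, so every candidate
  surface over the smooth curve has to be refuted. The plan is to exhibit a holomorphic form on it
  that cannot be zero.\<close>

locale smooth_cubic_cover =
  fixes c :: "nat \<Rightarrow> complex" and X :: "'a topology" and A :: "'a chart set" and \<nu> :: "'a \<Rightarrow> cp2"
  assumes smooth: "\<And>v. v \<noteq> 0 \<Longrightarrow> cubic c v = 0 \<Longrightarrow> \<exists>h. polar c v v h \<noteq> 0"
    and surface: "riemann_surface X A"
    and hol: "holomorphic_map_cp2 X A \<nu>"
    and image: "\<nu> ` topspace X = cubic_curve c"
begin

abbreviation inv_chart :: "'a chart \<Rightarrow> complex \<Rightarrow> 'a" where
  "inv_chart k \<equiv> inv_into (fst k) (snd k)"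

text \<open>The representative of \<open>\<nu>\<close> in \<complex>^3 whose coordinate
  \<open>i\<close> is 1; it is holomorphic where that coordinate does not vanish.\<close>

definition lift :: "3 \<Rightarrow> 'a chart \<Rightarrow> complex \<Rightarrow> complex^3" where
  "lift i k z = (\<chi> j. affine_coord i j (\<nu> (inv_chart k z)))"

definition dlift :: "3 \<Rightarrow> 'a chart \<Rightarrow> complex \<Rightarrow> complex^3" where
  "dlift i k z = (\<chi> j. deriv (\<lambda>z. lift i k z $ j) z)"

definition dom :: "3 \<Rightarrow> 'a chart \<Rightarrow> complex set" where
  "dom i k = snd k ` {x \<in> fst k. \<nu> x \<in> affine_chart i}"

lemma chart:
  assumes "k \<in> A"
  shows "openin X (fst k)" "open (snd k ` fst k)"
    "homeomorphic_map (subtopology X (fst k)) (top_of_set (snd k ` fst k)) (snd k)"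
  using surface assms unfolding riemann_surface_def complex_atlas_def by auto

lemma chart_subset: "k \<in> A \<Longrightarrow> fst k \<subseteq> topspace X"
  using chart(1) openin_subset by blast

lemma chart_inj: "k \<in> A \<Longrightarrow> inj_on (snd k) (fst k)"
  using homeomorphic_imp_injective_map[OF chart(3)[of k]] chart_subset[of k]
  by (simp add: topspace_subtopology Int_absorb1)

lemma inv_chart [simp]: "k \<in> A \<Longrightarrow> x \<in> fst k \<Longrightarrow> inv_chart k (snd k x) = x"
  using chart_inj by (rule inv_into_f_f)

lemma open_chart_image:
  assumes "k \<in> A" "openin X W" "W \<subseteq> fst k"
  shows "open (snd k ` W)"
proof -
  have "open_map (subtopology X (fst k)) (top_of_set (snd k ` fst k)) (snd k)"
    using chart(3)[OF assms(1)] by (rule homeomorphic_imp_open_map)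
  moreover have "openin (subtopology X (fst k)) W"
    using assms(2,3) by (auto simp: openin_subtopology)
  ultimately have "openin (top_of_set (snd k ` fst k)) (snd k ` W)" unfolding open_map_def by blast
  then show ?thesis using chart(2)[OF assms(1)] openin_open_trans by blast
qed

lemma continuous_nu: "continuous_map X euclidean \<nu>"
  using hol by (simp add: holomorphic_map_cp2_def)

lemma openin_preimage: "open W \<Longrightarrow> openin X {x \<in> topspace X. \<nu> x \<in> W}"
  using continuous_nu by (simp add: continuous_map_def)

lemma open_dom: "k \<in> A \<Longrightarrow> open (dom i k)"
proof -
  assume k: "k \<in> A"
  have "{x \<in> fst k. \<nu> x \<in> affine_chart i} = fst k \<inter> {x \<in> topspace X. \<nu> x \<in> affine_chart i}"
    using chart_subset[OF k] by auto
  then have "openin X {x \<in> fst k. \<nu> x \<in> affine_chart i}"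
    using chart(1)[OF k] openin_preimage[OF open_affine_chart] by (simp add: openin_Int)
  then show ?thesis unfolding dom_def by (intro open_chart_image[OF k]) auto
qed

lemma lift_nth: "lift i k z $ j = affine_coord i j (\<nu> (inv_chart k z))"
  by (simp add: lift_def)

lemma dom_iff:
  assumes "k \<in> A" "z \<in> snd k ` fst k"
  shows "z \<in> dom i k \<longleftrightarrow> \<nu> (inv_chart k z) \<in> affine_chart i"
proof -
  obtain x where "x \<in> fst k" "z = snd k x" using assms(2) by blast
  then show ?thesis using assms(1) chart_inj[OF assms(1)] unfolding dom_def by (auto dest: inj_onD)
qed

lemma dom_subset: "dom i k \<subseteq> snd k ` fst k"
  by (auto simp: dom_def)

lemma dom_cover:
  assumes "z \<in> snd k ` fst k" "k \<in> A"
  obtains i where "z \<in> dom i k"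
proof -
  have "\<exists>i. rep_cp2 (\<nu> (inv_chart k z)) $ i \<noteq> 0" using rep_nonzero by (metis vec_eq_iff zero_index)
  then show ?thesis using that dom_iff[OF assms(2,1)] by (auto simp: affine_chart_def)
qed

lemma lift_index: "k \<in> A \<Longrightarrow> z \<in> dom i k \<Longrightarrow> lift i k z $ i = 1"
  using dom_iff[of k z i] dom_subset[of i k] by (auto simp: lift_nth affine_coord_def affine_chart_def)

lemma lift_nonzero: "k \<in> A \<Longrightarrow> z \<in> dom i k \<Longrightarrow> lift i k z \<noteq> 0"
  using lift_index by (metis zero_index zero_neq_one)

lemma proj_lift:
  assumes "k \<in> A" "z \<in> dom i k"
  shows "proj (lift i k z) = \<nu> (inv_chart k z)"
proof -
  let ?v = "rep_cp2 (\<nu> (inv_chart k z))"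
  have n: "?v $ i \<noteq> 0" using assms dom_iff[of k z i] dom_subset[of i k] by (auto simp: affine_chart_def)
  have "lift i k z = inverse (?v $ i) *s ?v"
    by (simp add: vec_eq_iff lift_nth affine_coord_def field_simps)
  then show ?thesis using n proj_scale[of "inverse (?v $ i)" ?v] by simp
qed

lemma cubic_lift: "k \<in> A \<Longrightarrow> z \<in> dom i k \<Longrightarrow> cubic c (lift i k z) = 0"
proof -
  assume k: "k \<in> A" "z \<in> dom i k"
  then have "inv_chart k z \<in> topspace X"
    using dom_subset[of i k] chart_subset[of k] by (meson inv_into_into subsetD)
  then have "proj (lift i k z) \<in> cubic_curve c" using proj_lift[OF k] image by auto
  then show ?thesis using proj_in_cubic_curve lift_nonzero k by blast
qed

lemma hol_lift: "k \<in> A \<Longrightarrow> (\<lambda>z. lift i k z $ j) holomorphic_on dom i k"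
  using hol unfolding holomorphic_map_cp2_def lift_nth dom_def by (auto simp: case_prod_beta)

lemma deriv_lift: "k \<in> A \<Longrightarrow> z \<in> dom i k \<Longrightarrow> ((\<lambda>z. lift i k z $ j) has_field_derivative dlift i k z $ j) (at z)"
  using holomorphic_derivI[OF hol_lift open_dom] by (simp add: dlift_def)

lemma gradient_lift: "k \<in> A \<Longrightarrow> z \<in> dom i k \<Longrightarrow> gradient c (lift i k z) \<noteq> 0"
proof
  assume k: "k \<in> A" "z \<in> dom i k" and g: "gradient c (lift i k z) = 0"
  obtain h where "polar c (lift i k z) (lift i k z) h \<noteq> 0"
    using smooth[OF lift_nonzero[OF k] cubic_lift[OF k]] by blast
  then show False unfolding gradient_sum g by simp
qed

text \<open>The gradient annihilates the lift by Euler's relation and its derivative by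
  differentiating the equation of the curve along the lift.\<close>

lemma form_exists:
  assumes k: "k \<in> A" "z \<in> dom i k"
  shows "\<exists>m. crossp (lift i k z) (dlift i k z) = m *s gradient c (lift i k z)"
proof (rule crossp_parallel[OF gradient_lift[OF k]])
  show "gradient c (lift i k z) $ 1 * lift i k z $ 1 + gradient c (lift i k z) $ 2 * lift i k z $ 2 +
    gradient c (lift i k z) $ 3 * lift i k z $ 3 = 0"
    using cubic_lift[OF k] gradient_sum[of c "lift i k z" "lift i k z"] by (simp add: cubic_polar)
  have "((\<lambda>z. cubic c (lift i k z)) has_field_derivative 3 * polar c (lift i k z) (lift i k z) (dlift i k z)) (at z)"
    by (rule has_derivative_cubic) (rule deriv_lift[OF k])
  moreover have "((\<lambda>z. cubic c (lift i k z)) has_field_derivative 0) (at z)"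
    by (rule has_field_derivative_transform_within_open[OF DERIV_const[of 0] open_dom[OF k(1)] k(2)])
      (simp add: cubic_lift[OF k(1)])
  ultimately have "polar c (lift i k z) (lift i k z) (dlift i k z) = 0"
    using DERIV_unique by fastforce
  then show "gradient c (lift i k z) $ 1 * dlift i k z $ 1 + gradient c (lift i k z) $ 2 * dlift i k z $ 2 +
    gradient c (lift i k z) $ 3 * dlift i k z $ 3 = 0"
    by (simp add: gradient_sum)
qed

lemma gradient_scale: "gradient c (s *s v) = s\<^sup>2 *s gradient c v"
  by (simp add: gradient_def vec_eq_iff polar_scale power2_eq_square)

text \<open>The two lifts differ by a scalar function \<open>s\<close>. The term with
  \<open>s'\<close> is parallel to the lift and drops out of the cross product, which keeps the
  factor \<open>s^2\<close>; the gradient of a cubic acquires the same factor.\<close>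

lemma form_index_independent:
  assumes k: "k \<in> A" "z \<in> dom i k" "z \<in> dom i' k"
    and m: "crossp (lift i k z) (dlift i k z) = m *s gradient c (lift i k z)"
  shows "crossp (lift i' k z) (dlift i' k z) = m *s gradient c (lift i' k z)"
proof -
  let ?V = "lift i k z" and ?dV = "dlift i k z"
  have ne: "lift i k y $ i' \<noteq> 0" if "y \<in> dom i k \<inter> dom i' k" for y
  proof -
    have y: "y \<in> dom i k" "y \<in> dom i' k" using that by auto
    then have "\<nu> (inv_chart k y) \<in> affine_chart i'" using dom_iff[OF k(1), of y i'] dom_subset[of i' k] by auto
    then have "proj (lift i k y) \<in> affine_chart i'" using proj_lift[OF k(1) y(1)] by simp
    then show ?thesis using affine_chart_proj lift_nonzero k(1) that by blast
  qed
  have eq: "lift i' k y $ j = lift i k y $ j / lift i k y $ i'" if y: "y \<in> dom i k \<inter> dom i' k" for y j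
  proof -
    have "lift i' k y $ j = affine_coord i' j (proj (lift i k y))"
      using y proj_lift[OF k(1)] by (simp add: lift_nth)
    then show ?thesis using affine_coord_proj lift_nonzero k(1) y by simp
  qed
  define s where "s = inverse (?V $ i')"
  have z: "z \<in> dom i k \<inter> dom i' k" using k by blast
  have V: "lift i' k z = s *s ?V" using eq[OF z] by (simp add: vec_eq_iff s_def field_simps)
  have dl: "dlift i' k z $ j = s * ?dV $ j - s\<^sup>2 * ?dV $ i' * ?V $ j" for j
  proof -
    have "((\<lambda>y. lift i k y $ j / lift i k y $ i') has_field_derivative s * ?dV $ j - s\<^sup>2 * ?dV $ i' * ?V $ j) (at z)"
      by (rule derivative_eq_intros deriv_lift k ne z refl)+
        (use ne[OF z] in \<open>simp add: s_def field_simps power2_eq_square\<close>)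
    then have "((\<lambda>y. lift i' k y $ j) has_field_derivative s * ?dV $ j - s\<^sup>2 * ?dV $ i' * ?V $ j) (at z)"
      by (rule has_field_derivative_transform_within_open[OF _ open_Int[OF open_dom[OF k(1)] open_dom[OF k(1)]] z])
        (simp add: eq)
    then show ?thesis using DERIV_unique deriv_lift[OF k(1,3)] by blast
  qed
  have "crossp (lift i' k z) (dlift i' k z) = s\<^sup>2 *s crossp ?V ?dV"
    unfolding V vec_eq_iff forall_3
    by (simp add: crossp_components dl) (simp add: algebra_simps power2_eq_square)
  then show ?thesis unfolding V gradient_scale m by (simp add: vec_eq_iff)
qed

text \<open>The Poincare residue of the cubic in homogeneous coordinates, pulled back by
  \<open>\<nu>\<close>. The description is unique by \<open>form_index_independent\<close>; the
  value 0 off the charts is what \<open>holomorphic_forms\<close> asks for.\<close>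

definition residue_form :: "'a form" where
  "residue_form k z = (if k \<in> A \<and> z \<in> snd k ` fst k
     then THE m. \<exists>i. z \<in> dom i k \<and> crossp (lift i k z) (dlift i k z) = m *s gradient c (lift i k z) else 0)"

lemma residue_form_eq:
  assumes k: "k \<in> A" "z \<in> dom i k"
  shows "crossp (lift i k z) (dlift i k z) = residue_form k z *s gradient c (lift i k z)"
proof -
  obtain m where m: "crossp (lift i k z) (dlift i k z) = m *s gradient c (lift i k z)"
    using form_exists[OF k] by blast
  have "m' = m" if "z \<in> dom i' k" "crossp (lift i' k z) (dlift i' k z) = m' *s gradient c (lift i' k z)" for m' i'
    using form_index_independent[OF k that(1) m] that gradient_lift[OF k(1) that(1)] smult_cancel_vec by metis
  then have "(THE m. \<exists>i. z \<in> dom i k \<and> crossp (lift i k z) (dlift i k z) = m *s gradient c (lift i k z)) = m"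
    using m k by (intro the_equality) blast+
  then show ?thesis using m k dom_subset[of i k] by (auto simp: residue_form_def)
qed

lemma residue_form_unique:
  assumes "k \<in> A" "z \<in> dom i k" "crossp (lift i k z) (dlift i k z) = m *s gradient c (lift i k z)"
  shows "residue_form k z = m"
  using residue_form_eq[OF assms(1,2)] assms gradient_lift smult_cancel_vec by metis

lemma holomorphic_residue_form:
  assumes k: "k \<in> A"
  shows "residue_form k holomorphic_on snd k ` fst k"
proof -
  \<comment> \<open>On \<open>W i j\<close> the form is a quotient by entry \<open>j\<close> of the
    gradient. As the gradient never vanishes on the smooth curve, these sets cover the
    chart.\<close>
  define W where "W i j = dom i k \<inter> (\<lambda>z. gradient c (lift i k z) $ j) -` (- {0})" for i j
  have hg: "(\<lambda>z. gradient c (lift i k z) $ j) holomorphic_on dom i k" for i j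
    unfolding gradient_def polar_def
    by (auto intro!: holomorphic_intros hol_lift[OF k])
  have open_W: "open (W i j)" for i j
    unfolding W_def using open_dom[OF k] holomorphic_on_imp_continuous_on[OF hg]
    by (intro continuous_open_preimage) auto
  have hd: "(\<lambda>z. dlift i k z $ j) holomorphic_on dom i k" for i j
    unfolding dlift_def using holomorphic_deriv[OF hol_lift[OF k] open_dom[OF k]] by simp
  have hc: "(\<lambda>z. crossp (lift i k z) (dlift i k z) $ j) holomorphic_on dom i k" for i j
    using exhaust_3[of j] by (auto simp: crossp_components intro!: holomorphic_intros hol_lift[OF k] hd)
  have "(\<lambda>z. crossp (lift i k z) (dlift i k z) $ j / gradient c (lift i k z) $ j) holomorphic_on W i j" for i j
    by (intro holomorphic_on_divide holomorphic_on_subset[OF hc] holomorphic_on_subset[OF hg]) (auto simp: W_def)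
  then have "residue_form k holomorphic_on W i j" for i j
    by (rule holomorphic_transform) (auto simp: W_def residue_form_eq[OF k])
  then have "residue_form k holomorphic_on (\<Union>p\<in>UNIV. W (fst p) (snd p))"
    by (intro holomorphic_on_UN_open open_W)
  moreover have "snd k ` fst k \<subseteq> (\<Union>p\<in>UNIV. W (fst p) (snd p))"
  proof
    fix z assume "z \<in> snd k ` fst k"
    then obtain i where i: "z \<in> dom i k" using dom_cover k by blast
    then obtain j where "gradient c (lift i k z) $ j \<noteq> 0"
      using gradient_lift[OF k] by (metis vec_eq_iff zero_index)
    then have "z \<in> W i j" using i by (simp add: W_def)
    then show "z \<in> (\<Union>p\<in>UNIV. W (fst p) (snd p))" by force
  qed
  ultimately show ?thesis by (rule holomorphic_on_subset)
qed

lemma residue_form_transition: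
  assumes k: "k \<in> A" and l: "l \<in> A" and z: "z \<in> snd k ` (fst k \<inter> fst l)"
  shows "residue_form k z = residue_form l (transition k l z) * deriv (transition k l) z"
proof -
  let ?O = "snd k ` (fst k \<inter> fst l)" and ?t = "transition k l"
  have O: "open ?O" using k l by (intro open_chart_image openin_Int chart) auto
  have "?t holomorphic_on ?O"
    using surface k l unfolding riemann_surface_def complex_atlas_def by blast
  then have dt: "(?t has_field_derivative deriv ?t z) (at z)" using holomorphic_derivI O z by blast
  have t: "inv_chart l (?t y) = inv_chart k y" if "y \<in> ?O" for y
    using that k l by (auto simp: transition_def)
  have mem: "?t z \<in> snd l ` fst l" "z \<in> snd k ` fst k" using z k by (auto simp: transition_def)
  obtain i where i: "z \<in> dom i k" using dom_cover[OF mem(2) k] by blast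
  have i': "?t z \<in> dom i l"
    using i dom_iff[OF k mem(2)] dom_iff[OF l mem(1)] t[OF z] by simp
  have V: "lift i k y = lift i l (?t y)" if "y \<in> ?O" for y
    using t[OF that] by (simp add: lift_def)
  have "dlift i k z $ j = dlift i l (?t z) $ j * deriv ?t z" for j
  proof -
    have "((\<lambda>y. lift i l (?t y) $ j) has_field_derivative dlift i l (?t z) $ j * deriv ?t z) (at z)"
      by (rule DERIV_chain2[OF deriv_lift[OF l i'] dt])
    then have "((\<lambda>y. lift i k y $ j) has_field_derivative dlift i l (?t z) $ j * deriv ?t z) (at z)"
      by (rule has_field_derivative_transform_within_open[OF _ O z]) (simp add: V)
    then show ?thesis using DERIV_unique deriv_lift[OF k i] by blast
  qed
  then have "crossp (lift i k z) (dlift i k z) = deriv ?t z *s crossp (lift i l (?t z)) (dlift i l (?t z))"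
    unfolding V[OF z] by (simp add: vec_eq_iff forall_3 crossp_components algebra_simps)
  also have "\<dots> = (residue_form l (?t z) * deriv ?t z) *s gradient c (lift i k z)"
    unfolding V[OF z] residue_form_eq[OF l i'] by (simp add: vec_eq_iff)
  finally show ?thesis by (rule residue_form_unique[OF k i])
qed

lemma residue_form_holomorphic_form: "residue_form \<in> holomorphic_forms A"
  unfolding holomorphic_forms_def
proof (intro CollectI conjI ballI allI impI)
  fix k z assume "k \<notin> A \<or> z \<notin> snd k ` fst k"
  then show "residue_form k z = 0" by (auto simp: residue_form_def)
qed (fact holomorphic_residue_form residue_form_transition)+

text \<open>A zero form means that lift and derivative are parallel. Since coordinate
  \<open>i\<close> of the lift is constantly 1, that of the derivative is 0, so the derivative
  vanishes altogether.\<close>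

lemma nu_locally_constant:
  assumes "residue_form = (\<lambda>k z. 0)" "x \<in> topspace X"
  shows "\<exists>W. openin X W \<and> x \<in> W \<and> (\<forall>y\<in>W. \<nu> y = \<nu> x)"
proof -
  obtain k where k: "k \<in> A" "x \<in> fst k"
    using surface assms(2) unfolding riemann_surface_def complex_atlas_def by blast
  let ?z = "snd k x"
  obtain i where i: "?z \<in> dom i k" using dom_cover k by blast
  obtain r where r: "r > 0" "ball ?z r \<subseteq> dom i k" using open_dom[OF k(1)] i open_contains_ball by metis
  have d0: "dlift i k y $ j = 0" if "y \<in> dom i k" for y j
  proof -
    have "((\<lambda>y. lift i k y $ i) has_field_derivative 0) (at y)"
      by (rule has_field_derivative_transform_within_open[OF DERIV_const[of 1] open_dom[OF k(1)] that])
        (simp add: lift_index[OF k(1)])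
    then have di: "dlift i k y $ i = 0" using DERIV_unique deriv_lift[OF k(1) that] by blast
    have "crossp (lift i k y) (dlift i k y) = 0"
      using residue_form_eq[OF k(1) that] assms(1) by simp
    then show ?thesis
      using di lift_index[OF k(1) that] exhaust_3[of i] exhaust_3[of j]
      by (auto simp: vec_eq_iff forall_3 crossp_components)
  qed
  have const: "lift i k y = lift i k ?z" if "y \<in> ball ?z r" for y
  proof -
    have "lift i k y $ j = lift i k ?z $ j" for j
    proof -
      have "((\<lambda>z. lift i k z $ j) has_field_derivative 0) (at y within ball ?z r)" if "y \<in> ball ?z r" for y
      proof -
        have "y \<in> dom i k" using that r by blast
        then show ?thesis using deriv_lift[OF k(1), of y i j] d0 by (simp add: has_field_derivative_at_within)
      qed
      then obtain a where "\<forall>y\<in>ball ?z r. lift i k y $ j = a"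
        using has_field_derivative_zero_constant[OF convex_ball] by blast
      then show ?thesis using that r(1) by simp
    qed
    then show ?thesis by (simp add: vec_eq_iff)
  qed
  define W where "W = {y \<in> fst k. snd k y \<in> ball ?z r}"
  have "continuous_map (subtopology X (fst k)) (top_of_set (snd k ` fst k)) (snd k)"
    using chart(3)[OF k(1)] by (rule homeomorphic_imp_continuous_map)
  then have "openin (subtopology X (fst k)) {y \<in> topspace (subtopology X (fst k)). snd k y \<in> snd k ` fst k \<inter> ball ?z r}"
    using openin_open_Int[OF open_ball] unfolding continuous_map_def by blast
  moreover have "{y \<in> topspace (subtopology X (fst k)). snd k y \<in> snd k ` fst k \<inter> ball ?z r} = W"
    using chart_subset[OF k(1)] by (auto simp: W_def topspace_subtopology)
  ultimately have "openin X W" using chart(1)[OF k(1)] openin_trans_full by metis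
  moreover have "x \<in> W" using k r by (simp add: W_def)
  moreover have "\<nu> y = \<nu> x" if "y \<in> W" for y
  proof -
    have y: "y \<in> fst k" "snd k y \<in> ball ?z r" using that by (auto simp: W_def)
    then have "proj (lift i k (snd k y)) = \<nu> y" "proj (lift i k ?z) = \<nu> x"
      using proj_lift[OF k(1), of "snd k y" i] proj_lift[OF k(1) i] r k by auto
    then show ?thesis using const[OF y(2)] by simp
  qed
  ultimately show ?thesis by blast
qed

lemma not_genus_0: "\<not> has_genus A 0"
proof
  assume "has_genus A 0"
  then obtain B where "finite B" "card B = 0" "form_space.span B = holomorphic_forms A"
    unfolding has_genus_def by blast
  then have "holomorphic_forms A = {0}" by (auto simp: form_space.span_empty)
  then have "residue_form = 0" using residue_form_holomorphic_form by blast
  then have z: "residue_form = (\<lambda>k z. 0)" by (simp add: fun_eq_iff)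
  obtain p p' where p: "p \<in> cubic_curve c" "p' \<in> cubic_curve c" "p \<noteq> p'"
    using cubic_curve_two_points by blast
  \<comment> \<open>With \<open>\<nu>\<close> locally constant, fibres and their complements are
    open; connectedness then leaves only one fibre.\<close>
  have op: "openin X {x \<in> topspace X. P (\<nu> x)}" for P
    unfolding openin_subopen[of X "{x \<in> topspace X. P (\<nu> x)}"]
  proof
    fix x assume x: "x \<in> {x \<in> topspace X. P (\<nu> x)}"
    then obtain W where "openin X W" "x \<in> W" "\<forall>y\<in>W. \<nu> y = \<nu> x" using nu_locally_constant[OF z] by blast
    moreover have "W \<subseteq> {x \<in> topspace X. P (\<nu> x)}"
    proof
      fix y assume y: "y \<in> W"
      then have "\<nu> y = \<nu> x" using calculation(3) by blast
      then show "y \<in> {x \<in> topspace X. P (\<nu> x)}"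
        using x y openin_subset[OF calculation(1)] by (metis (mono_tags, lifting) mem_Collect_eq subsetD)
    qed
    ultimately show "\<exists>T. openin X T \<and> x \<in> T \<and> T \<subseteq> {x \<in> topspace X. P (\<nu> x)}" by blast
  qed
  have "topspace X - {x \<in> topspace X. \<nu> x = p} = {x \<in> topspace X. \<nu> x \<noteq> p}" by blast
  then have "closedin X {x \<in> topspace X. \<nu> x = p}"
    unfolding closedin_def using op[of "\<lambda>y. y \<noteq> p"] by (metis (no_types, lifting) mem_Collect_eq subsetI)
  then have "{x \<in> topspace X. \<nu> x = p} = {} \<or> {x \<in> topspace X. \<nu> x = p} = topspace X"
    using surface op[of "\<lambda>y. y = p"] unfolding riemann_surface_def connected_space_clopen_in by metis
  moreover obtain x x' where "x \<in> topspace X" "\<nu> x = p" "x' \<in> topspace X" "\<nu> x' = p'"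
    using p(1,2) unfolding image[symmetric] by blast
  ultimately have "x' \<in> {x \<in> topspace X. \<nu> x = p}" by (metis (mono_tags, lifting) empty_Collect_eq)
  then show False using p(3) \<open>\<nu> x' = p'\<close> by simp
qed

end

lemma smooth_cubic_not_rational:
  assumes "\<And>v. v \<noteq> 0 \<Longrightarrow> cubic c v = 0 \<Longrightarrow> \<exists>h. polar c v v h \<noteq> 0"
  shows "\<not> rational_curve (cubic_curve c)"
proof
  assume "rational_curve (cubic_curve c)"
  then obtain X A \<nu> where n: "is_normalization (cubic_curve c) (X :: cp2 topology) A \<nu>" "has_genus A 0"
    unfolding rational_curve_def has_geometric_genus_def by blast
  interpret smooth_cubic_cover c X A \<nu>
    using assms n(1) by unfold_locales (auto simp: is_normalization_def)
  show False using not_genus_0 n(2) by blast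
qed

section \<open>The discriminant of a cubic seen from one of its points\<close>

text \<open>\<open>4 I^3 - J^2\<close> for the two invariants of a binary quartic, of degrees 2 and
  3 in its coefficients; this is 27 times the discriminant. It stays meaningful for
  \<open>a = 0\<close>, when a root lies at infinity.\<close>

definition quartic_disc :: "'a::comm_ring_1 \<Rightarrow> 'a \<Rightarrow> 'a \<Rightarrow> 'a \<Rightarrow> 'a \<Rightarrow> 'a" where
  "quartic_disc a b c d e = 4 * (12 * a * e - 3 * b * d + c^2) ^ 3
     - (72 * a * c * e + 9 * b * c * d - 27 * a * d^2 - 27 * e * b^2 - 2 * c^3) ^ 2"

text \<open>Up to sign and scale, \<open>P\<close>, \<open>Q\<close> and \<open>P + Q\<close> are
  meant to be the differences of the roots of the resolvent cubic. In these terms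
  \<open>4 I^3 - J^2\<close> becomes 27 times a square.\<close>

lemma quartic_disc_eq:
  fixes P Q :: complex
  assumes "12 * a * e - 3 * b * d + c^2 = k^2 * (P^2 + P * Q + Q^2)"
    and "72 * a * c * e + 9 * b * c * d - 27 * a * d^2 - 27 * e * b^2 - 2 * c^3
      = k^3 * ((P - Q) * (2 * Q + P) * (2 * P + Q))"
  shows "quartic_disc a b c d e = 27 * k^6 * (P * Q * (P + Q))^2"
  unfolding quartic_disc_def assms by Groebner_Basis.algebra

text \<open>The hypotheses are the two partial derivatives of the binary quartic, so
  \<open>(x, y)\<close> is a double root. At infinity this means \<open>a = b = 0\<close>; otherwise
  \<open>d\<close> and \<open>e\<close> can be solved for in terms of \<open>a\<close>,
  \<open>b\<close>, \<open>c\<close> and the root, and a polynomial identity remains.\<close>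

lemma quartic_double_root_imp_disc:
  fixes a b c d e x y :: complex
  assumes "(x, y) \<noteq> (0, 0)"
    and x: "4 * a * x^3 + 3 * b * x^2 * y + 2 * c * x * y^2 + d * y^3 = 0"
    and y: "b * x^3 + 2 * c * x^2 * y + 3 * d * x * y^2 + 4 * e * y^3 = 0"
  shows "quartic_disc a b c d e = 0"
proof (cases "y = 0")
  case True
  then have "x \<noteq> 0" using assms(1) by auto
  then have "a = 0" "b = 0" using x y True by auto
  then show ?thesis by (simp add: quartic_disc_def power_mult_distrib)
next
  case False
  define r where "r = x / y"
  have xr: "x = r * y" using False by (simp add: r_def)
  have "y^3 * (4 * a * r^3 + 3 * b * r^2 + 2 * c * r + d) = 0"
    using x unfolding xr by Groebner_Basis.algebra
  then have d: "d = - (4 * a * r^3 + 3 * b * r^2 + 2 * c * r)" using False by Groebner_Basis.algebra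
  have "y^3 * (b * r^3 + 2 * c * r^2 + 3 * d * r + 4 * e) = 0"
    using y unfolding xr by Groebner_Basis.algebra
  then have e: "e = 3 * a * r^4 + 2 * b * r^3 + c * r^2" unfolding d using False by Groebner_Basis.algebra
  show ?thesis unfolding quartic_disc_def d e by Groebner_Basis.algebra
qed

lemma size_Suc_iff: "size M = Suc n \<longleftrightarrow> (\<exists>x N. M = add_mset x N \<and> size N = n)"
  by (metis size_add_mset size_eq_Suc_imp_eq_union nat.inject)

text \<open>For \<open>a \<noteq> 0\<close> each of \<open>P\<close>, \<open>Q\<close>,
  \<open>P + Q\<close> is a product of two differences of roots, so two roots coincide. For
  \<open>a = 0\<close> one root is at infinity and a cubic remains; if \<open>b = 0\<close> as well,
  the root at infinity is double, whence the witness \<open>(1, 0)\<close>.\<close>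

lemma quartic_disc_imp_double_root:
  fixes a b c d e :: complex
  assumes disc: "quartic_disc a b c d e = 0"
  shows "\<exists>x y. (x, y) \<noteq> (0, 0) \<and> 4 * a * x^3 + 3 * b * x^2 * y + 2 * c * x * y^2 + d * y^3 = 0
    \<and> b * x^3 + 2 * c * x^2 * y + 3 * d * x * y^2 + 4 * e * y^3 = 0"
proof -
  have root: ?thesis if "4 * a * r^3 + 3 * b * r^2 + 2 * c * r + d = 0" "b * r^3 + 2 * c * r^2 + 3 * d * r + 4 * e = 0" for r
    using that by (intro exI[of _ r] exI[of _ 1]) simp
  consider "a \<noteq> 0" | "a = 0" "b \<noteq> 0" | "a = 0" "b = 0" by blast
  then show ?thesis
  proof cases
    case 1
    let ?p = "[:e, d, c, b, a:]"
    have deg: "degree ?p = 4" "lead_coeff ?p = a" using 1 by auto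
    obtain M where M: "size M = degree ?p" "?p = smult (lead_coeff ?p) (\<Prod>x\<in>#M. [:- x, 1:])"
      using alg_closed_imp_factorization[of ?p] 1 by auto
    have "size M = Suc (Suc (Suc (Suc 0)))" using M(1) deg by simp
    then obtain r s t u where "M = {#r, s, t, u#}" by (auto simp: size_Suc_iff)
    then have "?p = smult a ([:- r, 1:] * ([:- s, 1:] * ([:- t, 1:] * [:- u, 1:])))"
      using M(2) deg by simp
    then have co: "b = - a * (r + s + t + u)" "c = a * (r * s + r * t + r * u + s * t + s * u + t * u)"
      "d = - a * (r * s * t + r * s * u + r * t * u + s * t * u)" "e = a * (r * s * t * u)"
      by (simp_all add: algebra_simps)
    have "quartic_disc a b c d e = 27 * a^6 * (((r - t) * (u - s)) * ((r - s) * (t - u)) * ((r - t) * (u - s) + (r - s) * (t - u)))^2"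
    proof (rule quartic_disc_eq)
      show "12 * a * e - 3 * b * d + c^2 = a^2 * (((r - t) * (u - s))^2 + (r - t) * (u - s) * ((r - s) * (t - u)) + ((r - s) * (t - u))^2)"
        unfolding co by Groebner_Basis.algebra
      show "72 * a * c * e + 9 * b * c * d - 27 * a * d^2 - 27 * e * b^2 - 2 * c^3
        = a^3 * (((r - t) * (u - s) - (r - s) * (t - u)) * (2 * ((r - s) * (t - u)) + (r - t) * (u - s)) * (2 * ((r - t) * (u - s)) + (r - s) * (t - u)))"
        unfolding co by Groebner_Basis.algebra
    qed
    also have "(r - t) * (u - s) + (r - s) * (t - u) = (r - u) * (t - s)" by Groebner_Basis.algebra
    finally consider "r = s" | "r = t" | "r = u" | "s = t" | "s = u" | "t = u" using disc 1 by auto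
    then show ?thesis
    proof cases
      case 1 show ?thesis by (rule root[of r]) (use co 1 in Groebner_Basis.algebra)+
    next
      case 2 show ?thesis by (rule root[of r]) (use co 2 in Groebner_Basis.algebra)+
    next
      case 3 show ?thesis by (rule root[of r]) (use co 3 in Groebner_Basis.algebra)+
    next
      case 4 show ?thesis by (rule root[of s]) (use co 4 in Groebner_Basis.algebra)+
    next
      case 5 show ?thesis by (rule root[of s]) (use co 5 in Groebner_Basis.algebra)+
    next
      case 6 show ?thesis by (rule root[of t]) (use co 6 in Groebner_Basis.algebra)+
    qed
  next
    case 2
    let ?p = "[:e, d, c, b:]"
    have deg: "degree ?p = 3" "lead_coeff ?p = b" using 2 by auto
    obtain M where M: "size M = degree ?p" "?p = smult (lead_coeff ?p) (\<Prod>x\<in>#M. [:- x, 1:])"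
      using alg_closed_imp_factorization[of ?p] 2 by auto
    have "size M = Suc (Suc (Suc 0))" using M(1) deg by simp
    then obtain r s t where "M = {#r, s, t#}" by (auto simp: size_Suc_iff)
    then have "?p = smult b ([:- r, 1:] * ([:- s, 1:] * [:- t, 1:]))"
      using M(2) deg by simp
    then have co: "c = - b * (r + s + t)" "d = b * (r * s + r * t + s * t)" "e = - b * (r * s * t)"
      by (simp_all add: algebra_simps)
    have "quartic_disc a b c d e = 27 * b^6 * ((r - s) * (s - t) * ((r - s) + (s - t)))^2"
    proof (rule quartic_disc_eq)
      show "12 * a * e - 3 * b * d + c^2 = b^2 * ((r - s)^2 + (r - s) * (s - t) + (s - t)^2)"
        unfolding co 2(1) by Groebner_Basis.algebra
      show "72 * a * c * e + 9 * b * c * d - 27 * a * d^2 - 27 * e * b^2 - 2 * c^3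
        = b^3 * (((r - s) - (s - t)) * (2 * (s - t) + (r - s)) * (2 * (r - s) + (s - t)))"
        unfolding co 2(1) by Groebner_Basis.algebra
    qed
    also have "(r - s) + (s - t) = r - t" by simp
    finally have "r = s \<or> s = t \<or> r = t" using disc 2 by simp
    then consider "r = s" | "s = t" | "r = t" by blast
    then show ?thesis
    proof cases
      case 1
      show ?thesis by (rule root[of r]) (use co \<open>a = 0\<close> 1 in Groebner_Basis.algebra)+
    next
      case 2
      show ?thesis by (rule root[of s]) (use co \<open>a = 0\<close> 2 in Groebner_Basis.algebra)+
    next
      case 3
      show ?thesis by (rule root[of r]) (use co \<open>a = 0\<close> 3 in Groebner_Basis.algebra)+
    qed
  next
    case 3
    then show ?thesis by (intro exI[of _ 1] exI[of _ 0]) simp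
  qed
qed

text \<open>\<open>F = z\<^sup>2 L + z Q + K\<close> with binary forms \<open>L, Q, K\<close> of degrees 1, 2, 3; the branch points of the
  projection from \<open>z = 1\<close> are the roots of the quartic \<open>Q\<^sup>2 - 4 L K\<close>.\<close>

definition branch_disc ::
  "'a::comm_ring_1 \<Rightarrow> 'a \<Rightarrow> 'a \<Rightarrow> 'a \<Rightarrow> 'a \<Rightarrow> 'a \<Rightarrow> 'a \<Rightarrow> 'a \<Rightarrow> 'a \<Rightarrow> 'a" where
  "branch_disc k0 k1 k2 k3 q0 q1 q2 l0 l1 = quartic_disc
     (q0^2 - 4 * l0 * k0) (2 * q0 * q1 - 4 * (l0 * k1 + l1 * k0))
     (q1^2 + 2 * q0 * q2 - 4 * (l0 * k2 + l1 * k1)) (2 * q1 * q2 - 4 * (l0 * k3 + l1 * k2))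
     (q2^2 - 4 * l1 * k3)"

definition cubic_disc :: "(nat \<Rightarrow> complex) \<Rightarrow> complex^3 \<Rightarrow> complex^3 \<Rightarrow> complex^3 \<Rightarrow> complex" where
  "cubic_disc c u w p = branch_disc (polar c u u u) (3 * polar c u u w) (3 * polar c u w w) (polar c w w w)
     (3 * polar c p u u) (6 * polar c p u w) (3 * polar c p w w) (3 * polar c p p u) (3 * polar c p p w)"

text \<open>The two equations are the partial derivatives of \<open>Q^2 - 4 L K\<close>, divided by
  2 and with the product rule written out. In this form they can be combined with the derivatives of
  the cubic.\<close>

lemma branch_disc_eq_0_iff:
  fixes k0 k1 k2 k3 q0 q1 q2 l0 l1 :: complex
  defines "K x y \<equiv> k0 * x^3 + k1 * x^2 * y + k2 * x * y^2 + k3 * y^3"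
    and "Q x y \<equiv> q0 * x^2 + q1 * x * y + q2 * y^2"
    and "L x y \<equiv> l0 * x + l1 * y"
  shows "branch_disc k0 k1 k2 k3 q0 q1 q2 l0 l1 = 0 \<longleftrightarrow> (\<exists>x y. (x, y) \<noteq> (0, 0)
    \<and> Q x y * (2 * q0 * x + q1 * y) = 2 * l0 * K x y + 2 * L x y * (3 * k0 * x^2 + 2 * k1 * x * y + k2 * y^2)
    \<and> Q x y * (q1 * x + 2 * q2 * y) = 2 * l1 * K x y + 2 * L x y * (k1 * x^2 + 2 * k2 * x * y + 3 * k3 * y^2))"
proof -
  define a where "a = q0^2 - 4 * l0 * k0"
  define b where "b = 2 * q0 * q1 - 4 * (l0 * k1 + l1 * k0)"
  define c where "c = q1^2 + 2 * q0 * q2 - 4 * (l0 * k2 + l1 * k1)"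
  define d where "d = 2 * q1 * q2 - 4 * (l0 * k3 + l1 * k2)"
  define e where "e = q2^2 - 4 * l1 * k3"
  have 1: "4 * a * x^3 + 3 * b * x^2 * y + 2 * c * x * y^2 + d * y^3 =
     2 * (Q x y * (2 * q0 * x + q1 * y) - (2 * l0 * K x y + 2 * L x y * (3 * k0 * x^2 + 2 * k1 * x * y + k2 * y^2)))" for x y
    unfolding a_def b_def c_def d_def K_def Q_def L_def by Groebner_Basis.algebra
  have 2: "b * x^3 + 2 * c * x^2 * y + 3 * d * x * y^2 + 4 * e * y^3 =
     2 * (Q x y * (q1 * x + 2 * q2 * y) - (2 * l1 * K x y + 2 * L x y * (k1 * x^2 + 2 * k2 * x * y + 3 * k3 * y^2)))" for x y
    unfolding b_def c_def d_def e_def K_def Q_def L_def by Groebner_Basis.algebra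
  have "branch_disc k0 k1 k2 k3 q0 q1 q2 l0 l1 = quartic_disc a b c d e"
    by (simp add: branch_disc_def a_def b_def c_def d_def e_def)
  moreover have "quartic_disc a b c d e = 0 \<longleftrightarrow> (\<exists>x y. (x, y) \<noteq> (0, 0)
    \<and> 4 * a * x^3 + 3 * b * x^2 * y + 2 * c * x * y^2 + d * y^3 = 0
    \<and> b * x^3 + 2 * c * x^2 * y + 3 * d * x * y^2 + 4 * e * y^3 = 0)"
    using quartic_disc_imp_double_root[of a b c d e] quartic_double_root_imp_disc[of _ _ a b c d e] by blast
  moreover have "2 * (A - B) = 0 \<longleftrightarrow> A = B" for A B :: complex by simp
  ultimately show ?thesis unfolding 1 2 by (simp only:)
qed

text \<open>On the line through \<open>p\<close> in direction \<open>(x, y)\<close> the cubic is a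
  quadratic in \<open>z\<close> with discriminant \<open>Q^2 - 4 L K\<close>. A double root of the
  quartic with \<open>L \<noteq> 0\<close> lifts to a singular point by the double root in
  \<open>z\<close>. If \<open>L = 0\<close> there, then \<open>Q = 0\<close>, and
  \<open>K \<noteq> 0\<close> as the line is not on the curve; the equations then force
  \<open>l0 = l1 = 0\<close>, so \<open>p\<close> itself is singular.\<close>

lemma cubic_disc_eq_0_iff:
  assumes basis: "basis3 u w p" and p: "cubic c p = 0" and no_line: "no_line c"
  shows "cubic_disc c u w p = 0 \<longleftrightarrow> (\<exists>v. v \<noteq> 0 \<and> (\<forall>h. polar c v v h = 0))"
proof -
  define k0 where "k0 = polar c u u u"
  define k1 where "k1 = 3 * polar c u u w"
  define k2 where "k2 = 3 * polar c u w w"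
  define k3 where "k3 = polar c w w w"
  define q0 where "q0 = 3 * polar c p u u"
  define q1 where "q1 = 6 * polar c p u w"
  define q2 where "q2 = 3 * polar c p w w"
  define l0 where "l0 = 3 * polar c p p u"
  define l1 where "l1 = 3 * polar c p p w"
  define K where "K x y = k0 * x^3 + k1 * x^2 * y + k2 * x * y^2 + k3 * y^3" for x y
  define Kx where "Kx x y = 3 * k0 * x^2 + 2 * k1 * x * y + k2 * y^2" for x y
  define Ky where "Ky x y = k1 * x^2 + 2 * k2 * x * y + 3 * k3 * y^2" for x y
  define Q where "Q x y = q0 * x^2 + q1 * x * y + q2 * y^2" for x y
  define L where "L x y = l0 * x + l1 * y" for x y
  have ppp: "polar c p p p = 0" using p by (simp add: cubic_polar)
  have F: "cubic c (x *s u + y *s w + z *s p) = z^2 * L x y + z * Q x y + K x y" for x y z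
    unfolding cubic_expand ppp
    by (simp add: L_def Q_def K_def k0_def k1_def k2_def k3_def q0_def q1_def q2_def l0_def l1_def)
  let ?v = "\<lambda>x y z. x *s u + y *s w + z *s p"
  have Fz: "3 * polar c (?v x y z) (?v x y z) p = 2 * z * L x y + Q x y" for x y z
    unfolding L_def Q_def q0_def q1_def q2_def l0_def l1_def
    by (simp add: polar_add polar_scale polar_commute ppp) (simp add: algebra_simps power2_eq_square)
  have Fx: "3 * polar c (?v x y z) (?v x y z) u = z^2 * l0 + z * (2 * q0 * x + q1 * y) + Kx x y" for x y z
    unfolding Kx_def k0_def k1_def k2_def q0_def q1_def l0_def
    by (simp add: polar_add polar_scale polar_commute ppp) (simp add: algebra_simps power2_eq_square)
  have Fy: "3 * polar c (?v x y z) (?v x y z) w = z^2 * l1 + z * (q1 * x + 2 * q2 * y) + Ky x y" for x y z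
    unfolding Ky_def k1_def k2_def k3_def q1_def q2_def l1_def
    by (simp add: polar_add polar_scale polar_commute ppp) (simp add: algebra_simps power2_eq_square)
  have sing: "(\<forall>h. polar c v v h = 0) \<longleftrightarrow> 3 * polar c v v u = 0 \<and> 3 * polar c v v w = 0 \<and> 3 * polar c v v p = 0" for v
  proof
    assume a: "3 * polar c v v u = 0 \<and> 3 * polar c v v w = 0 \<and> 3 * polar c v v p = 0"
    show "\<forall>h. polar c v v h = 0"
    proof
      fix h
      obtain x y z where "h = ?v x y z" using basis unfolding basis3_def by blast
      then show "polar c v v h = 0" using a by (simp add: polar_add polar_scale)
    qed
  qed simp
  have v0: "?v x y z = 0 \<longleftrightarrow> x = 0 \<and> y = 0 \<and> z = 0" for x y z
    using basis unfolding basis3_def by auto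
  have D: "cubic_disc c u w p = 0 \<longleftrightarrow> (\<exists>x y. (x, y) \<noteq> (0, 0)
    \<and> Q x y * (2 * q0 * x + q1 * y) = 2 * l0 * K x y + 2 * L x y * Kx x y
    \<and> Q x y * (q1 * x + 2 * q2 * y) = 2 * l1 * K x y + 2 * L x y * Ky x y)"
    unfolding cubic_disc_def k0_def[symmetric] k1_def[symmetric] k2_def[symmetric] k3_def[symmetric]
      q0_def[symmetric] q1_def[symmetric] q2_def[symmetric] l0_def[symmetric] l1_def[symmetric]
      branch_disc_eq_0_iff K_def Kx_def Ky_def Q_def L_def ..
  show ?thesis
  proof
    assume "cubic_disc c u w p = 0"
    then obtain x y where xy: "(x, y) \<noteq> (0, 0)"
      and ex: "Q x y * (2 * q0 * x + q1 * y) = 2 * l0 * K x y + 2 * L x y * Kx x y"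
      and ey: "Q x y * (q1 * x + 2 * q2 * y) = 2 * l1 * K x y + 2 * L x y * Ky x y"
      unfolding D by blast
    have e: "x * Kx x y + y * Ky x y = 3 * K x y" "x * (2 * q0 * x + q1 * y) + y * (q1 * x + 2 * q2 * y) = 2 * Q x y"
      by (simp_all add: Kx_def Ky_def K_def Q_def algebra_simps power2_eq_square power3_eq_cube)
    have e': "l0 * x + l1 * y = L x y" by (simp add: L_def)
    \<comment> \<open>By Euler's relations \<open>e\<close> and \<open>e'\<close>, \<open>x\<close>
      times \<open>ex\<close> plus \<open>y\<close> times \<open>ey\<close> is
      \<open>2 Q^2 = 8 L K\<close>.\<close>
    have disc: "Q x y ^ 2 = 4 * L x y * K x y"
      using ex ey e e' by Groebner_Basis.algebra
    show "\<exists>v. v \<noteq> 0 \<and> (\<forall>h. polar c v v h = 0)"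
    proof (cases "L x y = 0")
      case False
      \<comment> \<open>The double root of \<open>z^2 L + z Q + K\<close>.\<close>
      define z where "z = - Q x y / (2 * L x y)"
      have z: "2 * z * L x y + Q x y = 0" using False by (simp add: z_def)
      have k: "K x y = z^2 * L x y"
      proof -
        have "4 * L x y * (K x y - z^2 * L x y) = 0" using z disc by Groebner_Basis.algebra
        then show ?thesis using False by simp
      qed
      have "L x y * (z^2 * l0 + z * (2 * q0 * x + q1 * y) + Kx x y) = 0" using z k ex by Groebner_Basis.algebra
      then have "3 * polar c (?v x y z) (?v x y z) u = 0" unfolding Fx using False by simp
      moreover have "L x y * (z^2 * l1 + z * (q1 * x + 2 * q2 * y) + Ky x y) = 0" using z k ey by Groebner_Basis.algebra
      then have "3 * polar c (?v x y z) (?v x y z) w = 0" unfolding Fy using False by simp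
      moreover have "?v x y z \<noteq> 0" unfolding v0 using xy by auto
      ultimately show ?thesis using sing[of "?v x y z"] Fz[of x y z] z by auto
    next
      case True
      then have Q0: "Q x y = 0" using disc by simp
      have "K x y \<noteq> 0"
      proof
        assume K0: "K x y = 0"
        have eq: "s *s (x *s u + y *s w) + t *s p = ?v (s * x) (s * y) t" for s t
          by (simp add: vec_eq_iff algebra_simps)
        have "L (s * x) (s * y) = s * L x y" "Q (s * x) (s * y) = s^2 * Q x y" "K (s * x) (s * y) = s^3 * K x y" for s
          unfolding K_def Q_def L_def by Groebner_Basis.algebra+
        then have "\<forall>s t. cubic c (s *s (x *s u + y *s w) + t *s p) = 0"
          unfolding eq F using True Q0 K0 by simp
        then obtain s t where st: "(s, t) \<noteq> (0, 0)" "s *s (x *s u + y *s w) + t *s p = 0"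
          using no_line unfolding no_line_def by meson
        then show False unfolding eq v0 using xy by auto
      qed
      then have l: "l0 = 0" "l1 = 0" using ex ey True Q0 by auto
      have "p \<noteq> 0" using v0[of 0 0 1] by simp
      moreover have "\<forall>h. polar c p p h = 0" unfolding sing using l ppp by (simp add: l0_def l1_def)
      ultimately show ?thesis by blast
    qed
  next
    assume "\<exists>v. v \<noteq> 0 \<and> (\<forall>h. polar c v v h = 0)"
    then obtain v where v: "v \<noteq> 0" "\<forall>h. polar c v v h = 0" by blast
    obtain x y z where vz: "v = ?v x y z" using basis unfolding basis3_def by blast
    have s: "z^2 * l0 + z * (2 * q0 * x + q1 * y) + Kx x y = 0" "z^2 * l1 + z * (q1 * x + 2 * q2 * y) + Ky x y = 0"
      "2 * z * L x y + Q x y = 0"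
      using Fx[of x y z] Fy[of x y z] Fz[of x y z] v(2) unfolding vz[symmetric] by auto
    have f: "z^2 * L x y + z * Q x y + K x y = 0"
      using F[of x y z] v(2) unfolding vz[symmetric] by (simp add: cubic_polar)
    show "cubic_disc c u w p = 0"
    proof (cases "(x, y) = (0, 0)")
      case True
      then have "z \<noteq> 0" using v(1) vz by auto
      then have l: "l0 = 0" "l1 = 0" using s True by (simp_all add: Kx_def Ky_def)
      \<comment> \<open>With \<open>p\<close> singular, \<open>L\<close> vanishes identically and
        the quartic is \<open>Q^2\<close>; every root of \<open>Q\<close> is a double root of
        it.\<close>
      obtain x' y' where "(x', y') \<noteq> (0, 0)" "Q x' y' = 0"
        using binary_quadratic_root[of q0 q1 q2] unfolding Q_def by blast
      then show ?thesis unfolding D using l by (intro exI[of _ x'] exI[of _ y']) (simp add: L_def)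
    next
      case False
      have "Q x y * (2 * q0 * x + q1 * y) = 2 * l0 * K x y + 2 * L x y * Kx x y" using s f by Groebner_Basis.algebra
      moreover have "Q x y * (q1 * x + 2 * q2 * y) = 2 * l1 * K x y + 2 * L x y * Ky x y" using s f by Groebner_Basis.algebra
      ultimately show ?thesis unfolding D using False by blast
    qed
  qed
qed

section \<open>Polynomial conditions on tuples of vectors\<close>

text \<open>Being polynomial along every line is all that density needs, and it avoids multivariate polynomials.\<close>

definition polyfun :: "((complex^3)^'n \<Rightarrow> complex) \<Rightarrow> bool" where
  "polyfun f \<longleftrightarrow> continuous_on UNIV f \<and> (\<forall>v w. \<exists>p. \<forall>s. f (\<chi> i. v$i + s *s w$i) = poly p s)"

lemma polyfun_const [intro]: "polyfun (\<lambda>v. k)"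
  unfolding polyfun_def by (auto intro!: exI[of _ "[:k:]"])

lemma polyfun_coord [intro]: "polyfun (\<lambda>v :: (complex^3)^'n. v $ i $ j)"
proof -
  have "\<forall>s. (\<chi> l. v$l + s *s w$l) $ i $ j = poly [:v$i$j, w$i$j:] s" for v w :: "(complex^3)^'n"
    by simp
  moreover have "continuous_on UNIV (\<lambda>v :: (complex^3)^'n. v $ i $ j)" by (intro continuous_intros)
  ultimately show ?thesis unfolding polyfun_def by blast
qed

lemma polyfun_add [intro]: "polyfun f \<Longrightarrow> polyfun g \<Longrightarrow> polyfun (\<lambda>v. f v + g v)"
  unfolding polyfun_def by (metis (no_types) continuous_on_add poly_add)

lemma polyfun_mult [intro]: "polyfun f \<Longrightarrow> polyfun g \<Longrightarrow> polyfun (\<lambda>v. f v * g v)"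
  unfolding polyfun_def by (metis (no_types) continuous_on_mult poly_mult)

lemma polyfun_diff [intro]: "polyfun f \<Longrightarrow> polyfun g \<Longrightarrow> polyfun (\<lambda>v. f v - g v)"
  unfolding polyfun_def by (metis (no_types) continuous_on_diff poly_diff)

lemma polyfun_divide [intro]: "polyfun f \<Longrightarrow> polyfun (\<lambda>v. f v / k)"
  using polyfun_mult[OF _ polyfun_const, of f "inverse k"] by (simp add: divide_inverse)

lemma polyfun_power [intro]: "polyfun f \<Longrightarrow> polyfun (\<lambda>v. f v ^ n)"
  by (induction n) auto

lemma polyfun_sum [intro]: "(\<And>x. x \<in> A \<Longrightarrow> polyfun (f x)) \<Longrightarrow> polyfun (\<lambda>v. \<Sum>x\<in>A. f x v)"
  by (induction A rule: infinite_finite_induct) auto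

lemma polyfun_prod [intro]: "(\<And>x. x \<in> A \<Longrightarrow> polyfun (f x)) \<Longrightarrow> polyfun (\<lambda>v. \<Prod>x\<in>A. f x v)"
  by (induction A rule: infinite_finite_induct) auto

lemma polyfun_det:
  assumes "\<And>v. A v \<in> carrier_mat n n" "\<And>i j. i < n \<Longrightarrow> j < n \<Longrightarrow> polyfun (\<lambda>v. A v $$ (i, j))"
  shows "polyfun (\<lambda>v. det (A v))"
  unfolding det_def'[OF assms(1)]
proof (intro polyfun_sum polyfun_mult polyfun_const polyfun_prod)
  fix p i assume "p \<in> {p. p permutes {0..<n}}" "i \<in> {0..<n}"
  then show "polyfun (\<lambda>v. A v $$ (i, p i))"
    using permutes_in_image[of p "{0..<n}" i] by (intro assms(2)) auto
qed

lemma open_polyfun: "polyfun f \<Longrightarrow> open {v. f v \<noteq> 0}"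
  unfolding polyfun_def by (intro open_Collect_neq) auto

text \<open>On the line joining \<open>v\<close> to \<open>w\<close> the function is a polynomial
  that is nonzero at \<open>w\<close>; its zeros are finite in number, so \<open>v\<close> is a
  limit of points where it does not vanish.\<close>

lemma dense_polyfun:
  fixes f :: "(complex^3)^'n \<Rightarrow> complex"
  assumes f: "polyfun f" and w: "f w \<noteq> 0"
  shows "closure {v. f v \<noteq> 0} = UNIV"
proof (intro equalityI subset_UNIV subsetI)
  fix v :: "(complex^3)^'n"
  define g where "g s = (\<chi> i. v$i + s *s (w - v)$i)" for s :: complex
  obtain p where p: "\<And>s. f (g s) = poly p s" using f unfolding polyfun_def g_def by blast
  have "g 1 = w" by (simp add: g_def vec_eq_iff)
  then have "p \<noteq> 0" using p[of 1] w by auto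
  then have "finite {s. poly p s = 0}" by (rule poly_roots_finite)
  then have ev: "\<forall>\<^sub>F s in at 0. poly p s \<noteq> 0"
    using islimpt_finite[of "{s. poly p s = 0}" 0] by (simp add: islimpt_iff_eventually)
  have "continuous_on UNIV g"
    unfolding g_def by (intro continuous_on_vec_lambda continuous_on_add continuous_on_const continuous_on_smult_vec continuous_on_id)
  then have "(g \<longlongrightarrow> g 0) (at 0)" by (simp add: continuous_on_def)
  moreover have "g 0 = v" by (simp add: g_def vec_eq_iff)
  ultimately have lim: "(g \<longlongrightarrow> v) (at 0)" by simp
  show "v \<in> closure {v. f v \<noteq> 0}"
    unfolding closure_approachable
  proof (intro allI impI)
    fix e :: real assume "e > 0"
    then have "\<forall>\<^sub>F s in at 0. dist (g s) v < e" using lim by (rule tendstoD[rotated])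
    then have "\<forall>\<^sub>F s in at 0. dist (g s) v < e \<and> poly p s \<noteq> 0" using ev by (rule eventually_conj)
    then obtain s where "dist (g s) v < e" "poly p s \<noteq> 0"
      using eventually_happens'[OF at_neq_bot] by blast
    then show "\<exists>y\<in>{v. f v \<noteq> 0}. dist y v < e" using p by (intro bexI[of _ "g s"]) auto
  qed
qed

lemma dense_open_Int:
  assumes "open A" "closure A = UNIV" "closure B = UNIV"
  shows "closure (A \<inter> B) = UNIV"
proof -
  have "A \<subseteq> closure (A \<inter> B)" using open_Int_closure_subset[OF assms(1), of B] assms(3) by simp
  then have "closure A \<subseteq> closure (A \<inter> B)" by (simp add: closure_minimal)
  then show ?thesis using assms(2) by auto
qed

lemma finite_polyfun_dense:
  assumes "finite I" "\<And>f. f \<in> I \<Longrightarrow> polyfun f" "\<And>f. f \<in> I \<Longrightarrow> \<exists>w. f w \<noteq> 0"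
  shows "open {v. \<forall>f\<in>I. f v \<noteq> 0} \<and> closure {v. \<forall>f\<in>I. f v \<noteq> 0} = UNIV"
  using assms
proof (induction I rule: finite_induct)
  case (insert f I)
  have eq: "{v. \<forall>g\<in>insert f I. g v \<noteq> 0} = {v. f v \<noteq> 0} \<inter> {v. \<forall>g\<in>I. g v \<noteq> 0}" by auto
  obtain w where "f w \<noteq> 0" using insert.prems(2) by blast
  then have f: "closure {v. f v \<noteq> 0} = UNIV" "open {v. f v \<noteq> 0}"
    using dense_polyfun open_polyfun insert.prems(1) by blast+
  have "open {v. \<forall>f\<in>I. f v \<noteq> 0} \<and> closure {v. \<forall>f\<in>I. f v \<noteq> 0} = UNIV"
    using insert by blast
  then show ?case unfolding eq using dense_open_Int[OF f(2,1)] open_Int[OF f(2)] by blast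
qed simp

lemma open_box: "(\<And>i. open (A i)) \<Longrightarrow> open {v :: 'a::topological_space ^ 'n. \<forall>i. v $ i \<in> A i}"
  unfolding open_vec_def by blast

text \<open>Conditions are polynomial in representatives, not in points. Taking classes entrywise is
  open on nonzero vectors, and the tuples over a nonempty open box of classes form a nonempty open
  set, which the dense \<open>W\<close> meets. So the image of \<open>W\<close> is open and
  dense.\<close>

lemma general_pointsI:
  fixes W :: "((complex^3)^'n) set" and R :: "cp2^'n \<Rightarrow> bool"
  assumes W: "open W" "closure W = UNIV" "\<And>v i. v \<in> W \<Longrightarrow> v $ i \<noteq> 0"
    and R: "\<And>v. v \<in> W \<Longrightarrow> R (\<chi> i. proj (v $ i))"
  shows "for_general_points R"
proof -
  define U where "U = (\<lambda>v. \<chi> i. proj (v $ i)) ` W"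
  have "open U"
    unfolding open_vec_def
  proof
    fix p assume "p \<in> U"
    then obtain v where v: "v \<in> W" "p = (\<chi> i. proj (v $ i))" unfolding U_def by blast
    have "\<exists>A. (\<forall>i. open (A i) \<and> v $ i \<in> A i) \<and> (\<forall>y. (\<forall>i. y $ i \<in> A i) \<longrightarrow> y \<in> W)"
      using W(1) v(1) unfolding open_vec_def by (rule bspec)
    then obtain A where A: "\<forall>i. open (A i) \<and> v $ i \<in> A i" "\<forall>y. (\<forall>i. y $ i \<in> A i) \<longrightarrow> y \<in> W"
      by (elim exE conjE)
    show "\<exists>A. (\<forall>i. open (A i) \<and> p $ i \<in> A i) \<and> (\<forall>y. (\<forall>i. y $ i \<in> A i) \<longrightarrow> y \<in> U)"
    proof (intro exI[of _ "\<lambda>i. proj ` (A i - {0})"] conjI allI impI)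
      fix i
      show "open (proj ` (A i - {0}))" using A(1) by (intro open_proj_image) (auto intro: open_delete)
      show "p $ i \<in> proj ` (A i - {0})" using A(1) v W(3) by auto
    next
      fix y assume "\<forall>i. y $ i \<in> proj ` (A i - {0})"
      then have "\<forall>i. \<exists>a. a \<in> A i \<and> y $ i = proj a" by blast
      then obtain a where a: "\<And>i. a i \<in> A i" "\<And>i. y $ i = proj (a i)" by metis
      then have "(\<chi> i. a i) \<in> W" using A(2) by simp
      moreover have "y = (\<chi> i. proj ((\<chi> i. a i) $ i))" using a(2) by (simp add: vec_eq_iff)
      ultimately show "y \<in> U" unfolding U_def by blast
    qed
  qed
  moreover have "closure U = UNIV"
  proof (rule ccontr)
    assume "closure U \<noteq> UNIV"
    then obtain p where "p \<in> - closure U" by blast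
    moreover have "open (- closure U)" by (rule open_Compl[OF closed_closure])
    ultimately obtain B where B: "\<forall>i. open (B i) \<and> p $ i \<in> B i" "\<forall>y. (\<forall>i. y $ i \<in> B i) \<longrightarrow> y \<in> - closure U"
      unfolding open_vec_def by blast
    let ?A = "\<lambda>i. {v. v \<noteq> 0 \<and> proj v \<in> B i}"
    have "open {v. \<forall>i. v $ i \<in> ?A i}" using B(1) by (intro open_box) (simp add: open_cp2_iff)
    moreover have "(\<chi> i. rep_cp2 (p $ i)) \<in> {v. \<forall>i. v $ i \<in> ?A i}" using B(1) by simp
    ultimately have "{v. \<forall>i. v $ i \<in> ?A i} \<inter> W \<noteq> {}"
      using W(2) open_Int_closure_eq_empty[of "{v. \<forall>i. v $ i \<in> ?A i}" W] by blast
    then obtain v where v: "v \<in> W" "\<forall>i. v $ i \<in> ?A i" by blast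
    then have "(\<chi> i. proj (v $ i)) \<in> - closure U" using B(2) by simp
    moreover have "(\<chi> i. proj (v $ i)) \<in> U" using v(1) unfolding U_def by blast
    ultimately show False using closure_subset by blast
  qed
  ultimately show ?thesis unfolding for_general_points_def U_def using R by blast
qed

subsection \<open>Position of points with respect to lines and conics\<close>

definition det3 :: "complex^3 \<Rightarrow> complex^3 \<Rightarrow> complex^3 \<Rightarrow> complex" where
  "det3 a b d = a$1 * (b$2 * d$3 - b$3 * d$2) + a$2 * (b$3 * d$1 - b$1 * d$3) + a$3 * (b$1 * d$2 - b$2 * d$1)"

lemma det3_add:
  "det3 (a + a') b d = det3 a b d + det3 a' b d" "det3 a (b + b') d = det3 a b d + det3 a b' d"
  "det3 a b (d + d') = det3 a b d + det3 a b d'"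
  by (simp_all add: det3_def algebra_simps)

lemma det3_scale: "det3 (k *s a) b d = k * det3 a b d" "det3 a (k *s b) d = k * det3 a b d" "det3 a b (k *s d) = k * det3 a b d"
  by (simp_all add: det3_def algebra_simps)

lemma det3_repeat: "det3 a a d = 0" "det3 a b a = 0" "det3 a b b = 0"
  by (simp_all add: det3_def algebra_simps)

lemma cramer3: "det3 a b d *s v = det3 v b d *s a + det3 a v d *s b + det3 a b v *s d"
  unfolding vec_eq_iff forall_3 by (simp add: det3_def algebra_simps)

lemma det3_basis: "det3 a b d \<noteq> 0 \<Longrightarrow> basis3 a b d"
  unfolding basis3_def
proof (intro conjI allI impI)
  assume n: "det3 a b d \<noteq> 0"
  fix v :: "complex^3"
  have "v = inverse (det3 a b d) *s (det3 a b d *s v)" using n by (simp add: vector_smult_assoc)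
  also have "\<dots> = (inverse (det3 a b d) * det3 v b d) *s a + (inverse (det3 a b d) * det3 a v d) *s b
      + (inverse (det3 a b d) * det3 a b v) *s d"
    unfolding cramer3[of a b d v] by (simp only: vector_add_ldistrib vector_smult_assoc)
  finally show "\<exists>x y z. v = x *s a + y *s b + z *s d" by blast
next
  fix x y z assume n: "det3 a b d \<noteq> 0" and 0: "x *s a + y *s b + z *s d = 0"
  have "det3 (x *s a + y *s b + z *s d) b d = x * det3 a b d" "det3 a (x *s a + y *s b + z *s d) d = y * det3 a b d"
    "det3 a b (x *s a + y *s b + z *s d) = z * det3 a b d"
    by (simp_all add: det3_add det3_scale det3_repeat)
  moreover have "det3 0 b d = 0" "det3 a 0 d = 0" "det3 a b 0 = 0" by (simp_all add: det3_def)
  ultimately show "x = 0" "y = 0" "z = 0" using n unfolding 0 by auto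
qed

text \<open>Otherwise all 2 by 2 minors of \<open>a\<close> and \<open>b\<close> vanish, and these
  relations between \<open>a\<close> and \<open>b\<close> force \<open>a = 0\<close>.\<close>

lemma extend_to_basis:
  assumes "\<And>s t. s *s a + t *s b = 0 \<Longrightarrow> (s, t) = (0, 0)"
  shows "\<exists>d. det3 a b d \<noteq> 0"
proof (rule ccontr)
  assume "\<nexists>d. det3 a b d \<noteq> 0"
  then have z: "det3 a b (axis i 1) = 0" for i by blast
  have c: "a$1 * b$2 = a$2 * b$1" "a$1 * b$3 = a$3 * b$1" "a$2 * b$3 = a$3 * b$2"
    using z[of 1] z[of 2] z[of 3] by (simp_all add: det3_def axis_def)
  have "b $ i *s a + (- a $ i) *s b = 0" for i
    using c exhaust_3[of i] by (auto simp: vec_eq_iff forall_3 mult.commute)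
  then have "a $ i = 0" for i using assms by fastforce
  then have "1 *s a + 0 *s b = 0" by (simp add: vec_eq_iff)
  then show False using assms by fastforce
qed

text \<open>In the basis \<open>p1, p2, p3\<close> the conics through these points are the combinations of \<open>xy, xz, yz\<close>.\<close>

definition conic_det :: "complex^3 \<Rightarrow> complex^3 \<Rightarrow> complex^3 \<Rightarrow> complex^3 \<Rightarrow> complex^3 \<Rightarrow> complex^3 \<Rightarrow> complex" where
  "conic_det p1 p2 p3 p4 p5 p6 = (let r = (\<lambda>p. vector [det3 p p2 p3 * det3 p1 p p3,
     det3 p p2 p3 * det3 p1 p2 p, det3 p1 p p3 * det3 p1 p2 p]) in det3 (r p4) (r p5) (r p6))"

text \<open>Vanishing at \<open>p1, p2, p3\<close> leaves three unknowns \<open>B p1 p2\<close>,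
  \<open>B p1 p3\<close>, \<open>B p2 p3\<close>. The other three points give a homogeneous linear
  system for them, with determinant \<open>conic_det\<close>.\<close>

lemma conic_vanishes:
  fixes B :: "complex^3 \<Rightarrow> complex^3 \<Rightarrow> complex"
  assumes add: "\<And>u v w. B (u + v) w = B u w + B v w" and scale: "\<And>k u v. B (k *s u) v = k * B u v"
    and sym: "\<And>u v. B u v = B v u"
    and ind: "det3 p1 p2 p3 \<noteq> 0" and conic: "conic_det p1 p2 p3 p4 p5 p6 \<noteq> 0"
    and van: "\<And>p. p \<in> {p1, p2, p3, p4, p5, p6} \<Longrightarrow> B p p = 0"
  shows "B v v = 0"
proof -
  have add': "B w (u + v) = B w u + B w v" for u v w using add sym by metis
  have scale': "B v (k *s u) = k * B v u" for k u v using scale sym by metis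
  have ex: "B (x *s p1 + y *s p2 + z *s p3) (x *s p1 + y *s p2 + z *s p3)
      = 2 * (x * y * B p1 p2 + x * z * B p1 p3 + y * z * B p2 p3)" for x y z
    using van[of p1] van[of p2] van[of p3] sym[of p2 p1] sym[of p3 p1] sym[of p3 p2]
    by (simp add: add add' scale scale' algebra_simps)
  have row: "det3 p p2 p3 * det3 p1 p p3 * B p1 p2 + det3 p p2 p3 * det3 p1 p2 p * B p1 p3
     + det3 p1 p p3 * det3 p1 p2 p * B p2 p3 = 0" if "B p p = 0" for p
  proof -
    \<comment> \<open>Scaled by the determinant, \<open>p\<close> is expanded by Cramer's rule
      without division.\<close>
    have "B (det3 p1 p2 p3 *s p) (det3 p1 p2 p3 *s p) = 0" using that by (simp add: scale scale')
    then show ?thesis unfolding cramer3[of p1 p2 p3 p] ex by (metis mult_eq_0_iff zero_neq_numeral)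
  qed
  define r where "r p = (vector [det3 p p2 p3 * det3 p1 p p3,
     det3 p p2 p3 * det3 p1 p2 p, det3 p1 p p3 * det3 p1 p2 p] :: complex^3)" for p
  have eq: "r p $ 1 * B p1 p2 + r p $ 2 * B p1 p3 + r p $ 3 * B p2 p3 = 0" if "p \<in> {p4, p5, p6}" for p
    using row[OF van[of p]] that by (auto simp: r_def vector_3)
  have cd: "conic_det p1 p2 p3 p4 p5 p6 = det3 (r p4) (r p5) (r p6)"
    by (simp add: conic_det_def r_def Let_def)
  note eqs = eq[of p4] eq[of p5] eq[of p6]
  have "det3 (r p4) (r p5) (r p6) * B p1 p2 = 0" "det3 (r p4) (r p5) (r p6) * B p1 p3 = 0" "det3 (r p4) (r p5) (r p6) * B p2 p3 = 0"
    using eqs unfolding det3_def by simp_all (Groebner_Basis.algebra, Groebner_Basis.algebra, Groebner_Basis.algebra)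
  then have "B p1 p2 = 0" "B p1 p3 = 0" "B p2 p3 = 0" using conic unfolding cd by auto
  moreover obtain x y z where "v = x *s p1 + y *s p2 + z *s p3" using det3_basis[OF ind] unfolding basis3_def by blast
  ultimately show ?thesis using ex by simp
qed

text \<open>In the basis \<open>a\<close>, \<open>b\<close>, \<open>e\<close> the terms free of
  \<open>z\<close> are the restriction to the line and vanish, so \<open>z\<close>, that is
  \<open>det3 a b v\<close> up to a factor, divides the cubic. The cofactor is kept as a symmetric
  bilinear form for use in \<open>conic_vanishes\<close>; clearing the denominators of Cramer's rule
  produces the cube of the determinant.\<close>

lemma line_factor:
  assumes line: "\<And>s t. cubic c (s *s a + t *s b) = 0" and ind: "det3 a b e \<noteq> 0"
  shows "\<exists>B. (\<forall>u v w. B (u + v) w = B u w + B v w) \<and> (\<forall>k u v. B (k *s u) v = k * B u v)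
    \<and> (\<forall>u v. B u v = B v u) \<and> (\<forall>v. det3 a b e ^ 3 * cubic c v = det3 a b v * B v v)"
proof -
  have l: "polar c a a a * s ^ 3 + 3 * polar c a a b * s\<^sup>2 * t + 3 * polar c a b b * s * t\<^sup>2 + polar c b b b * t ^ 3 = 0" for s t
    using line[of s t] cubic_expand[of c s a t b 0 0] by simp
  have aaa: "polar c a a a = 0" using l[of 1 0] by simp
  have bbb: "polar c b b b = 0" using l[of 0 1] by simp
  \<comment> \<open>The values at \<open>(1, 1)\<close> and \<open>(1, -1)\<close> separate the two
    mixed coefficients.\<close>
  have "3 * polar c a a b + 3 * polar c a b b = 0" using l[of 1 1] aaa bbb by simp
  moreover have "- (3 * polar c a a b) + 3 * polar c a b b = 0" using l[of 1 "-1"] aaa bbb by simp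
  ultimately have aab: "polar c a a b = 0" "polar c a b b = 0" by Groebner_Basis.algebra+
  define x where "x v = det3 v b e" for v
  define y where "y v = det3 a v e" for v
  define z where "z v = det3 a b v" for v
  \<comment> \<open>Half the coefficient, because a mixed term of \<open>B v v\<close> collects two
    equal summands.\<close>
  define k where "k = 3 / 2 * polar c e e a"
  define l where "l = 3 / 2 * polar c e e b"
  have kl: "3 * polar c e e a = 2 * k" "3 * polar c e e b = 2 * l" by (simp_all add: k_def l_def)
  define B where "B u v = z u * z v * polar c e e e + k * (x u * z v + z u * x v)
    + l * (y u * z v + z u * y v) + 3 * polar c e a a * (x u * x v)
    + 3 * polar c e a b * (x u * y v + y u * x v) + 3 * polar c e b b * (y u * y v)" for u v
  have lin: "x (u + v) = x u + x v" "y (u + v) = y u + y v" "z (u + v) = z u + z v"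
    "x (m *s u) = m * x u" "y (m *s u) = m * y u" "z (m *s u) = m * z u" for u v m
    by (simp_all add: x_def y_def z_def det3_add det3_scale)
  have "det3 a b e ^ 3 * cubic c v = det3 a b v * B v v" for v
  proof -
    have "det3 a b e ^ 3 * cubic c v = cubic c (x v *s a + y v *s b + z v *s e)"
      unfolding cubic_scale[symmetric] cramer3[of a b e v] x_def y_def z_def ..
    also have "\<dots> = z v * B v v"
      unfolding cubic_expand aaa bbb aab B_def kl
      by (simp add: algebra_simps power2_eq_square power3_eq_cube)
    finally show ?thesis by (simp add: z_def)
  qed
  moreover have "B (u + v) w = B u w + B v w" for u v w by (simp add: B_def lin algebra_simps)
  moreover have "B (m *s u) v = m * B u v" for m u v by (simp add: B_def lin algebra_simps)
  moreover have "B u v = B v u" for u v by (simp add: B_def mult.commute add.commute)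
  ultimately show ?thesis by blast
qed

text \<open>Split off the line: no three of the points are collinear, so at least six of the eight
  lie off it and are zeros of the residual quadratic form. Such a form is zero by
  \<open>conic_vanishes\<close>, and so would be the cubic.\<close>

lemma no_line_if_general:
  fixes v :: "(complex^3)^8"
  assumes coll: "\<And>xs. distinct xs \<Longrightarrow> length xs = 3 \<Longrightarrow> det3 (v $ (xs!0)) (v $ (xs!1)) (v $ (xs!2)) \<noteq> 0"
    and conic: "\<And>xs. distinct xs \<Longrightarrow> length xs = 6 \<Longrightarrow>
      conic_det (v $ (xs!0)) (v $ (xs!1)) (v $ (xs!2)) (v $ (xs!3)) (v $ (xs!4)) (v $ (xs!5)) \<noteq> 0"
    and van: "\<And>i. cubic c (v $ i) = 0" and nonzero: "cubic c x \<noteq> 0"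
  shows "no_line c"
  unfolding no_line_def
proof (intro allI impI, rule ccontr)
  fix a b assume line: "\<forall>s t. cubic c (s *s a + t *s b) = 0"
    and "\<not> (\<exists>s t. (s, t) \<noteq> (0, 0) \<and> s *s a + t *s b = 0)"
  then obtain e where e: "det3 a b e \<noteq> 0" using extend_to_basis by blast
  obtain B where B: "\<forall>u v w. B (u + v) w = B u w + B v w" "\<forall>k u v. B (k *s u) v = k * B u v"
    "\<forall>u v. B u v = B v u" "\<forall>v. det3 a b e ^ 3 * cubic c v = det3 a b v * B v v"
    using line_factor[OF line[rule_format] e] by (elim exE conjE)
  define S where "S = {i. det3 a b (v $ i) = 0}"
  have "card S < 3"
  proof (rule ccontr)
    assume "\<not> card S < 3"
    then obtain T where T: "T \<subseteq> S" "card T = 3" using obtain_subset_with_card_n by (metis not_less)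
    then have "finite T" by (metis card.infinite zero_neq_numeral)
    then obtain xs where xs: "set xs = T" "distinct xs" "length xs = 3"
      using T(2) finite_distinct_list distinct_card by metis
    have sp: "det3 a b e *s v $ i = det3 (v $ i) b e *s a + det3 a (v $ i) e *s b" if "i \<in> S" for i
      using that cramer3[of a b e "v $ i"] by (simp add: S_def)
    have "xs ! k \<in> S" if "k < 3" for k using that xs T(1) by (metis nth_mem subsetD)
    then have mem: "xs!0 \<in> S" "xs!1 \<in> S" "xs!2 \<in> S" by simp_all
    have "det3 (det3 a b e *s v $ (xs!0)) (det3 a b e *s v $ (xs!1)) (det3 a b e *s v $ (xs!2)) = 0"
      unfolding sp[OF mem(1)] sp[OF mem(2)] sp[OF mem(3)]
      by (simp add: det3_add det3_scale det3_repeat)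
    then show False using coll[OF xs(2,3)] e by (simp add: det3_scale)
  qed
  moreover have "card (- S) = 8 - card S" using card_Diff_subset[of S UNIV] by (simp add: Compl_eq_Diff_UNIV)
  ultimately have "6 \<le> card (- S)" by simp
  then obtain T where T: "T \<subseteq> - S" "card T = 6" using obtain_subset_with_card_n by metis
  then have "finite T" by (metis card.infinite zero_neq_numeral)
  then obtain xs where xs: "set xs = T" "distinct xs" "length xs = 6"
    using T(2) finite_distinct_list distinct_card by metis
  have Bv: "B (v $ i) (v $ i) = 0" if "i \<in> - S" for i
    using that B(4)[rule_format, of "v $ i"] van by (simp add: S_def)
  have mem: "B (v $ (xs!k)) (v $ (xs!k)) = 0" if "k < 6" for k
    using Bv that xs T(1) by (metis nth_mem subsetD)
  have "distinct (take 3 xs)" "length (take 3 xs) = 3" using xs by auto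
  then have "det3 (v $ (xs!0)) (v $ (xs!1)) (v $ (xs!2)) \<noteq> 0" using coll[of "take 3 xs"] by simp
  then have "B u u = 0" for u
    by (rule conic_vanishes[OF B(1)[rule_format] B(2)[rule_format] B(3)[rule_format] _ conic[OF xs(2,3)]]) (use mem in auto)
  then show False using B(4)[rule_format, of x] nonzero e by simp
qed

section \<open>The pencil of cubics through eight points\<close>

definition mono :: "nat \<Rightarrow> complex^3 \<Rightarrow> complex" where
  "mono k v = [v$1^3, v$1^2 * v$2, v$1 * v$2^2, v$2^3, v$1^2 * v$3, v$1 * v$2 * v$3, v$2^2 * v$3,
     v$1 * v$3^2, v$2 * v$3^2, v$3^3] ! k"

lemma lessThan_10: "{..<10 :: nat} = {0, 1, 2, 3, 4, 5, 6, 7, 8, 9}"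
  by auto

lemma cubic_mono: "cubic c v = (\<Sum>k<10. c k * mono k v)"
  unfolding lessThan_10 by (simp add: cubic_def mono_def)

lemma polyfun_mono: "k < 10 \<Longrightarrow> polyfun (\<lambda>v. mono k (v $ i))"
proof -
  assume "k < 10"
  then have "k \<in> {0, 1, 2, 3, 4, 5, 6, 7, 8, 9}" by auto
  then show ?thesis by (auto simp: mono_def intro!: polyfun_mult polyfun_power polyfun_coord)
qed

text \<open>The last two rows cut a basis out of the pencil through the eight points; they are adapted to
  the pencil used in \<open>example_pencil\<close> below.\<close>

definition alpha :: "nat \<Rightarrow> complex" where
  "alpha j = (if j = 2 then 1 else 0)"

definition beta :: "nat \<Rightarrow> complex" where
  "beta j = (if j = 7 then 1 else if j = 6 then -1 else 0)"

definition point_mat :: "(complex^3)^8 \<Rightarrow> complex mat" where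
  "point_mat v = mat 10 10 (\<lambda>(i, j). if i < 8 then mono j (v $ of_nat i) else if i = 8 then alpha j else beta j)"

text \<open>By Laplace expansion the cofactors of a row are orthogonal to every other row. They
  solve the linear system without division, which keeps the coefficients polynomial in the
  points.\<close>

definition pencil1 :: "(complex^3)^8 \<Rightarrow> nat \<Rightarrow> complex" where
  "pencil1 v k = cofactor (point_mat v) 9 k"

definition pencil2 :: "(complex^3)^8 \<Rightarrow> nat \<Rightarrow> complex" where
  "pencil2 v k = cofactor (point_mat v) 8 k"

lemma of_nat_8_surj: "\<exists>i<8. x = (of_nat i :: 8)"
proof (cases x)
  case (of_int z)
  then show ?thesis by (intro exI[of _ "nat z"]) auto
qed

lemma point_mat_carrier: "point_mat v \<in> carrier_mat 10 10"
  by (simp add: point_mat_def)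

lemma sum_alpha: "(\<Sum>j<10. alpha j * c j) = c 2"
  unfolding lessThan_10 by (simp add: alpha_def)

lemma sum_beta: "(\<Sum>j<10. beta j * c j) = c 7 - c 6"
  unfolding lessThan_10 by (simp add: beta_def)

lemma point_mat_row:
  "i < 8 \<Longrightarrow> (\<Sum>j<10. point_mat v $$ (i, j) * c j) = cubic c (v $ of_nat i)"
  "(\<Sum>j<10. point_mat v $$ (8, j) * c j) = c 2"
  "(\<Sum>j<10. point_mat v $$ (9, j) * c j) = c 7 - c 6"
proof -
  show "(\<Sum>j<10. point_mat v $$ (i, j) * c j) = cubic c (v $ of_nat i)" if "i < 8"
    unfolding cubic_mono using that by (intro sum.cong) (auto simp: point_mat_def)
  show "(\<Sum>j<10. point_mat v $$ (8, j) * c j) = c 2"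
    unfolding sum_alpha[symmetric] by (intro sum.cong) (auto simp: point_mat_def)
  show "(\<Sum>j<10. point_mat v $$ (9, j) * c j) = c 7 - c 6"
    unfolding sum_beta[symmetric] by (intro sum.cong) (auto simp: point_mat_def)
qed

lemma row_cofactor:
  fixes A :: "complex mat"
  assumes A: "A \<in> carrier_mat n n" and i: "i < n" "r < n"
  shows "(\<Sum>j<n. A $$ (i, j) * cofactor A r j) = (if i = r then det A else 0)"
proof -
  have "(A * adj_mat A) $$ (i, r) = (\<Sum>j<n. A $$ (i, j) * cofactor A r j)"
    using A i unfolding times_mat_def scalar_prod_def adj_mat_def by (auto intro: sum.cong)
  moreover have "(det A \<cdot>\<^sub>m 1\<^sub>m n) $$ (i, r) = (if i = r then det A else 0)" using i by simp
  ultimately show ?thesis using adj_mat(2)[OF A] by simp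
qed

lemma pencil_vanishes: "cubic (pencil1 v) (v $ i) = 0" "cubic (pencil2 v) (v $ i) = 0"
proof -
  obtain k where k: "k < 8" "i = of_nat k" using of_nat_8_surj by blast
  show "cubic (pencil1 v) (v $ i) = 0" "cubic (pencil2 v) (v $ i) = 0"
    using row_cofactor[OF point_mat_carrier, of k 9 v] row_cofactor[OF point_mat_carrier, of k 8 v]
      point_mat_row(1)[OF k(1)] k
    by (simp_all add: pencil1_def[abs_def] pencil2_def[abs_def])
qed

lemma pencil_coeffs:
  "pencil1 v 2 = 0" "pencil1 v 7 - pencil1 v 6 = det (point_mat v)"
  "pencil2 v 2 = det (point_mat v)" "pencil2 v 7 - pencil2 v 6 = 0"
  using row_cofactor[OF point_mat_carrier, of 8 9 v] row_cofactor[OF point_mat_carrier, of 9 9 v]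
    row_cofactor[OF point_mat_carrier, of 8 8 v] row_cofactor[OF point_mat_carrier, of 9 8 v]
    point_mat_row(2)[of v "pencil1 v"] point_mat_row(3)[of v "pencil1 v"]
    point_mat_row(2)[of v "pencil2 v"] point_mat_row(3)[of v "pencil2 v"]
  by (simp_all add: pencil1_def[abs_def] pencil2_def[abs_def])

lemma point_mat_kernel:
  "det (point_mat v) = 0 \<longleftrightarrow> (\<exists>c. (\<forall>i. cubic c (v $ i) = 0) \<and> c 2 = 0 \<and> c 7 - c 6 = 0 \<and> (\<exists>k<10. c k \<noteq> 0))"
proof -
  have "(\<exists>x. x \<in> carrier_vec 10 \<and> x \<noteq> 0\<^sub>v 10 \<and> point_mat v *\<^sub>v x = 0\<^sub>v 10) \<longleftrightarrow>
    (\<exists>c. (\<forall>i<10. (\<Sum>j<10. point_mat v $$ (i, j) * c j) = 0) \<and> (\<exists>k<10. c k \<noteq> 0))"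
    (is "?L \<longleftrightarrow> ?R")
  proof
    assume ?L
    then obtain x where x: "x \<in> carrier_vec 10" "x \<noteq> 0\<^sub>v 10" "point_mat v *\<^sub>v x = 0\<^sub>v 10" by blast
    have "(\<Sum>j<10. point_mat v $$ (i, j) * vec_index x j) = 0" if "i < 10" for i
    proof -
      have "vec_index (point_mat v *\<^sub>v x) i = (\<Sum>j<10. point_mat v $$ (i, j) * vec_index x j)"
        using that x(1) point_mat_carrier[of v]
        by (auto simp: mult_mat_vec_def scalar_prod_def lessThan_atLeast0 intro!: sum.cong)
      then show ?thesis using that x(3) by simp
    qed
    moreover have "\<exists>k<10. vec_index x k \<noteq> 0"
      using x(1,2) by (metis carrier_vecD eq_vecI index_zero_vec)
    ultimately show ?R by blast
  next
    assume ?R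
    then obtain c k where c: "\<forall>i<10. (\<Sum>j<10. point_mat v $$ (i, j) * c j) = 0" "k < 10" "c k \<noteq> 0" by blast
    have "vec_index (vec 10 c) k \<noteq> vec_index (0\<^sub>v 10) k" using c(2,3) by simp
    then have "vec 10 c \<noteq> 0\<^sub>v 10" by metis
    moreover have "point_mat v *\<^sub>v vec 10 c = 0\<^sub>v 10"
    proof (rule eq_vecI)
      fix i assume "i < dim_vec (0\<^sub>v 10 :: complex Matrix.vec)"
      then have i: "i < 10" by simp
      have "vec_index (point_mat v *\<^sub>v vec 10 c) i = (\<Sum>j<10. point_mat v $$ (i, j) * c j)"
        using i point_mat_carrier[of v]
        by (auto simp: mult_mat_vec_def scalar_prod_def lessThan_atLeast0 intro!: sum.cong)
      then show "vec_index (point_mat v *\<^sub>v vec 10 c) i = vec_index (0\<^sub>v 10) i" using c(1) i by simp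
    qed (use point_mat_carrier[of v] in auto)
    ultimately show ?L by (metis vec_carrier)
  qed
  moreover have "(\<forall>i<10. (\<Sum>j<10. point_mat v $$ (i, j) * c j) = 0) \<longleftrightarrow>
    (\<forall>i. cubic c (v $ i) = 0) \<and> c 2 = 0 \<and> c 7 - c 6 = 0" for c
  proof -
    have "(\<forall>i<10. (\<Sum>j<10. point_mat v $$ (i, j) * c j) = 0) \<longleftrightarrow>
      (\<forall>i<8. (\<Sum>j<10. point_mat v $$ (i, j) * c j) = 0) \<and>
      (\<Sum>j<10. point_mat v $$ (8, j) * c j) = 0 \<and> (\<Sum>j<10. point_mat v $$ (9, j) * c j) = 0"
      (is "?l = ?r")
    proof
      assume r: ?r
      show ?l
      proof (intro allI impI)
        fix i :: nat assume "i < 10"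
        then have "i < 8 \<or> i = 8 \<or> i = 9" by auto
        then show "(\<Sum>j<10. point_mat v $$ (i, j) * c j) = 0" using r by blast
      qed
    qed simp
    also have "\<dots> \<longleftrightarrow> (\<forall>i<8. cubic c (v $ of_nat i) = 0) \<and> c 2 = 0 \<and> c 7 - c 6 = 0"
      by (simp add: point_mat_row)
    also have "(\<forall>i<8. cubic c (v $ of_nat i) = 0) \<longleftrightarrow> (\<forall>i. cubic c (v $ i) = 0)"
      using of_nat_8_surj by metis
    finally show ?thesis .
  qed
  ultimately show ?thesis using det_0_iff_vec_prod_zero_field[OF point_mat_carrier] by simp
qed

text \<open>The functionals \<open>c 2\<close> and \<open>c 7 - c 6\<close> of the last two rows
  take the values 0 and \<open>det\<close> on \<open>pencil1\<close>, \<open>det\<close> and 0 on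
  \<open>pencil2\<close>. Subtracting the combination that they dictate leaves a vector in the
  kernel of \<open>point_mat v\<close>.\<close>

lemma pencil_spans:
  assumes det: "det (point_mat v) \<noteq> 0" and d: "\<And>i. cubic d (v $ i) = 0" and k: "k < 10"
  shows "det (point_mat v) * d k = (d 7 - d 6) * pencil1 v k + d 2 * pencil2 v k"
proof -
  define e where "e j = det (point_mat v) * d j + (-1) * ((d 7 - d 6) * pencil1 v j + d 2 * pencil2 v j)" for j
  have "cubic e (v $ i) = 0" for i
    unfolding e_def cubic_lincomb by (simp add: d pencil_vanishes)
  moreover have "e 2 = 0" using pencil_coeffs[of v] by (simp add: e_def)
  moreover have "e 7 - e 6 = det (point_mat v) * (d 7 - d 6) - ((d 7 - d 6) * (pencil1 v 7 - pencil1 v 6) + d 2 * (pencil2 v 7 - pencil2 v 6))"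
    by (simp add: e_def algebra_simps)
  then have "e 7 - e 6 = 0" unfolding pencil_coeffs by simp
  ultimately have "e k = 0" using det k point_mat_kernel[of v] by blast
  then show ?thesis unfolding e_def by Groebner_Basis.algebra
qed

subsection \<open>The discriminant of a pencil\<close>

text \<open>\<open>branch_disc\<close> is defined over any commutative ring so that its entries may
  be polynomials in the parameter. Evaluation at \<open>t\<close> gives the discriminant of the
  member \<open>F + t G\<close>, and entries of degree at most 1 bound the degree by 12.\<close>

definition disc_poly :: "(nat \<Rightarrow> complex) \<Rightarrow> (nat \<Rightarrow> complex) \<Rightarrow> complex^3 \<Rightarrow> complex^3 \<Rightarrow> complex^3 \<Rightarrow> complex poly" where
  "disc_poly F G u w p = branch_disc
     [:polar F u u u, polar G u u u:] [:3 * polar F u u w, 3 * polar G u u w:]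
     [:3 * polar F u w w, 3 * polar G u w w:] [:polar F w w w, polar G w w w:]
     [:3 * polar F p u u, 3 * polar G p u u:] [:6 * polar F p u w, 6 * polar G p u w:]
     [:3 * polar F p w w, 3 * polar G p w w:]
     [:3 * polar F p p u, 3 * polar G p p u:] [:3 * polar F p p w, 3 * polar G p p w:]"

lemma poly_branch_disc: "poly (branch_disc k0 k1 k2 k3 q0 q1 q2 l0 l1) t =
  branch_disc (poly k0 t) (poly k1 t) (poly k2 t) (poly k3 t) (poly q0 t) (poly q1 t) (poly q2 t) (poly l0 t) (poly l1 t)"
  for k0 :: "complex poly"
  by (simp add: branch_disc_def quartic_disc_def)

lemma poly_disc_poly: "poly (disc_poly F G u w p) t = cubic_disc (\<lambda>k. F k + t * G k) u w p"
  unfolding disc_poly_def poly_branch_disc cubic_disc_def polar_lincomb'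
  by (simp add: algebra_simps)

lemma degree_numeral_mult_le: "degree p \<le> n \<Longrightarrow> degree (numeral k * p) \<le> n" for p :: "complex poly"
  using degree_mult_le[of "numeral k" p] by simp

lemma degree_power_le': "degree p \<le> n \<Longrightarrow> degree (p ^ k) \<le> k * n" for p :: "complex poly"
  using degree_power_le[of p k] by (metis le_trans mult.commute mult_le_mono1)

lemma degree_mult_le': "degree p \<le> m \<Longrightarrow> degree q \<le> n \<Longrightarrow> degree (p * q) \<le> m + n" for p q :: "complex poly"
  using degree_mult_le[of p q] by simp

lemma degree_quartic_disc:
  fixes a b c d e :: "complex poly"
  assumes "degree a \<le> 2" "degree b \<le> 2" "degree c \<le> 2" "degree d \<le> 2" "degree e \<le> 2"
  shows "degree (quartic_disc a b c d e) \<le> 12"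
proof -
  have 1: "degree (12 * a * e - 3 * b * d + c^2) \<le> 4"
    using degree_mult_le'[OF degree_numeral_mult_le[OF assms(1)] assms(5)]
      degree_mult_le'[OF degree_numeral_mult_le[OF assms(2)] assms(4)] degree_power_le'[OF assms(3), of 2]
    by (intro degree_add_le degree_diff_le) simp_all
  have 2: "degree (72 * a * c * e + 9 * b * c * d - 27 * a * d^2 - 27 * e * b^2 - 2 * c^3) \<le> 6"
    using degree_mult_le'[OF degree_mult_le'[OF degree_numeral_mult_le[OF assms(1)] assms(3)] assms(5)]
      degree_mult_le'[OF degree_mult_le'[OF degree_numeral_mult_le[OF assms(2)] assms(3)] assms(4)]
      degree_mult_le'[OF degree_numeral_mult_le[OF assms(1)] degree_power_le'[OF assms(4), of 2]]
      degree_mult_le'[OF degree_numeral_mult_le[OF assms(5)] degree_power_le'[OF assms(2), of 2]]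
      degree_numeral_mult_le[OF degree_power_le'[OF assms(3), of 3]]
    by (intro degree_add_le degree_diff_le) simp_all
  show ?thesis
    unfolding quartic_disc_def
    using degree_numeral_mult_le[OF degree_power_le'[OF 1, of 3]] degree_power_le'[OF 2, of 2]
    by (intro degree_diff_le) simp_all
qed

lemma degree_branch_disc:
  fixes k0 k1 k2 k3 q0 q1 q2 l0 l1 :: "complex poly"
  assumes "degree k0 \<le> 1" "degree k1 \<le> 1" "degree k2 \<le> 1" "degree k3 \<le> 1" "degree q0 \<le> 1"
    "degree q1 \<le> 1" "degree q2 \<le> 1" "degree l0 \<le> 1" "degree l1 \<le> 1"
  shows "degree (branch_disc k0 k1 k2 k3 q0 q1 q2 l0 l1) \<le> 12"
proof -
  have m: "degree (p * q) \<le> 2" if "degree p \<le> 1" "degree q \<le> 1" for p q :: "complex poly"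
    using degree_mult_le'[OF that] by simp
  show ?thesis
    unfolding branch_disc_def power2_eq_square
    by (intro degree_quartic_disc degree_add_le degree_diff_le m degree_numeral_mult_le assms)
qed

lemma degree_disc_poly: "degree (disc_poly F G u w p) \<le> 12"
  unfolding disc_poly_def by (rule degree_branch_disc) simp_all

text \<open>The quartic is quadratic in the entries and its discriminant has degree 6. The lemma
  serves to compare the pencil made of cofactors with the explicit one, from which it differs by the
  factor \<open>det (point_mat v)\<close>.\<close>

lemma branch_disc_scale:
  fixes m :: complex
  shows "branch_disc (smult m k0) (smult m k1) (smult m k2) (smult m k3) (smult m q0) (smult m q1) (smult m q2)
    (smult m l0) (smult m l1) = smult (m ^ 12) (branch_disc k0 k1 k2 k3 q0 q1 q2 l0 l1)"
proof -
  have q: "quartic_disc (n * a) (n * b) (n * c) (n * d) (n * e) = n ^ 6 * quartic_disc a b c d e" for n a b c d e :: complex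
    unfolding quartic_disc_def by Groebner_Basis.algebra
  have "branch_disc (m * k0) (m * k1) (m * k2) (m * k3) (m * q0) (m * q1) (m * q2) (m * l0) (m * l1)
      = m ^ 12 * branch_disc k0 k1 k2 k3 q0 q1 q2 l0 l1" for k0 k1 k2 k3 q0 q1 q2 l0 l1
  proof -
    have "branch_disc (m * k0) (m * k1) (m * k2) (m * k3) (m * q0) (m * q1) (m * q2) (m * l0) (m * l1)
       = quartic_disc (m^2 * (q0^2 - 4 * l0 * k0)) (m^2 * (2 * q0 * q1 - 4 * (l0 * k1 + l1 * k0)))
        (m^2 * (q1^2 + 2 * q0 * q2 - 4 * (l0 * k2 + l1 * k1))) (m^2 * (2 * q1 * q2 - 4 * (l0 * k3 + l1 * k2)))
        (m^2 * (q2^2 - 4 * l1 * k3))"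
      unfolding branch_disc_def by (simp add: algebra_simps power2_eq_square)
    then show ?thesis unfolding q branch_disc_def by simp
  qed
  then show ?thesis by (intro poly_ext) (simp add: poly_branch_disc)
qed

lemma polar_scale_coeffs: "polar (\<lambda>k. m * F k) u v w = m * polar F u v w"
  using polar_lincomb[of m F 0 F u v w] by simp

lemma disc_poly_scale: "disc_poly (\<lambda>k. m * F k) (\<lambda>k. m * G k) u w p = smult (m ^ 12) (disc_poly F G u w p)"
  unfolding disc_poly_def branch_disc_scale[symmetric] polar_scale_coeffs by (simp add: mult.left_commute)

lemma polar_cong: "(\<And>k. k < 10 \<Longrightarrow> c k = d k) \<Longrightarrow> polar c u v w = polar d u v w"
  by (simp add: polar_def)

lemma disc_poly_cong:
  assumes "\<And>k. k < 10 \<Longrightarrow> F k = F' k" "\<And>k. k < 10 \<Longrightarrow> G k = G' k"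
  shows "disc_poly F G u w p = disc_poly F' G' u w p"
proof -
  have "polar F a b d = polar F' a b d" "polar G a b d = polar G' a b d" for a b d
    using assms polar_cong by blast+
  then show ?thesis unfolding disc_poly_def by simp
qed

text \<open>The centre of projection is the base point \<open>v $ 1\<close>. Completing it by the
  first two coordinate vectors, which do not depend on \<open>v\<close>, keeps everything
  polynomial; this is a basis when its third coordinate is nonzero.\<close>

definition pencil_disc :: "(complex^3)^8 \<Rightarrow> complex poly" where
  "pencil_disc v = disc_poly (pencil1 v) (pencil2 v) (axis 1 1) (axis 2 1) (v $ 1)"

section \<open>Polynomial dependence of the discriminant and its resultant on the points\<close>

definition polyfam :: "((complex^3)^'n \<Rightarrow> complex poly) \<Rightarrow> bool" where
  "polyfam D \<longleftrightarrow> (\<forall>n. polyfun (\<lambda>v. coeff (D v) n))"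

lemma polyfam_pCons: "polyfun f \<Longrightarrow> polyfun g \<Longrightarrow> polyfam (\<lambda>v. [:f v, g v:])"
  unfolding polyfam_def
proof
  fix n assume "polyfun f" "polyfun g"
  then show "polyfun (\<lambda>v. coeff [:f v, g v:] n)"
    by (cases n; cases "n - 1") (simp_all add: coeff_pCons polyfun_const)
qed

lemma polyfam_const: "polyfam (\<lambda>v. p)"
  unfolding polyfam_def by auto

lemma polyfam_add: "polyfam D \<Longrightarrow> polyfam E \<Longrightarrow> polyfam (\<lambda>v. D v + E v)"
  unfolding polyfam_def by auto

lemma polyfam_diff: "polyfam D \<Longrightarrow> polyfam E \<Longrightarrow> polyfam (\<lambda>v. D v - E v)"
  unfolding polyfam_def by auto

lemma polyfam_mult: "polyfam D \<Longrightarrow> polyfam E \<Longrightarrow> polyfam (\<lambda>v. D v * E v)"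
  unfolding polyfam_def coeff_mult by (intro allI polyfun_sum polyfun_mult) auto

lemma polyfam_power: "polyfam D \<Longrightarrow> polyfam (\<lambda>v. D v ^ k)"
  by (induction k) (auto intro: polyfam_mult polyfam_const)

lemma polyfam_branch_disc:
  assumes "polyfam k0" "polyfam k1" "polyfam k2" "polyfam k3" "polyfam q0" "polyfam q1" "polyfam q2" "polyfam l0" "polyfam l1"
  shows "polyfam (\<lambda>v. branch_disc (k0 v) (k1 v) (k2 v) (k3 v) (q0 v) (q1 v) (q2 v) (l0 v) (l1 v))"
  unfolding branch_disc_def quartic_disc_def
  by (intro polyfam_add polyfam_diff polyfam_mult polyfam_power polyfam_const assms)

lemma polyfun_polar:
  assumes "\<And>k. k < 10 \<Longrightarrow> polyfun (\<lambda>v. c v k)" "\<And>i. polyfun (\<lambda>v. a v $ i)" "\<And>i. polyfun (\<lambda>v. b v $ i)" "\<And>i. polyfun (\<lambda>v. d v $ i)"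
  shows "polyfun (\<lambda>v. polar (c v) (a v) (b v) (d v))"
  unfolding polar_def
  by (intro polyfun_add polyfun_mult polyfun_divide assms) simp_all

lemma polyfun_point_mat: "i < 10 \<Longrightarrow> j < 10 \<Longrightarrow> polyfun (\<lambda>v. point_mat v $$ (i, j))"
  by (cases "i < 8") (auto simp: point_mat_def intro: polyfun_mono)

lemma polyfun_det_point_mat: "polyfun (\<lambda>v. det (point_mat v))"
  by (rule polyfun_det[OF point_mat_carrier polyfun_point_mat])

lemma polyfun_cofactor: "r < 10 \<Longrightarrow> k < 10 \<Longrightarrow> polyfun (\<lambda>v. cofactor (point_mat v) r k)"
  unfolding cofactor_def
proof (intro polyfun_mult polyfun_const polyfun_det)
  fix v show "mat_delete (point_mat v) r k \<in> carrier_mat 9 9"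
    using mat_delete_carrier[OF point_mat_carrier, of v r k] by simp
next
  fix i j :: nat assume ij: "i < 9" "j < 9"
  have dim: "dim_row (point_mat v) = 10" "dim_col (point_mat v) = 10" for v using point_mat_carrier[of v] by auto
  have "mat_delete (point_mat v) r k $$ (i, j) = point_mat v $$ (if i < r then i else Suc i, if j < k then j else Suc j)" for v
    using ij by (simp add: mat_delete_def dim)
  then show "polyfun (\<lambda>v. mat_delete (point_mat v) r k $$ (i, j))"
    using ij by (simp add: polyfun_point_mat)
qed

lemma polyfun_pencil: "k < 10 \<Longrightarrow> polyfun (\<lambda>v. pencil1 v k)" "k < 10 \<Longrightarrow> polyfun (\<lambda>v. pencil2 v k)"
  unfolding pencil1_def pencil2_def by (simp_all add: polyfun_cofactor)

lemma polyfun_if: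
  "(P \<Longrightarrow> polyfun f) \<Longrightarrow> (\<not> P \<Longrightarrow> polyfun g) \<Longrightarrow> polyfun (\<lambda>v. if P then f v else g v)"
  by (cases P) simp_all

lemma polyfam_pencil_disc: "polyfam pencil_disc"
proof -
  have c: "polyfun (\<lambda>v. axis i 1 $ j)" "polyfun (\<lambda>v. v $ 1 $ j)" for i j :: 3 by auto
  have "polyfam (\<lambda>v. pencil_disc v)"
    unfolding pencil_disc_def disc_poly_def
    by (intro polyfam_branch_disc polyfam_pCons polyfun_mult polyfun_const polyfun_polar polyfun_pencil c)
  then show ?thesis .
qed

lemma polyfun_cubic_disc_pencil2: "polyfun (\<lambda>v. cubic_disc (pencil2 v) (axis 1 1) (axis 2 1) (v $ 1))"
proof -
  have c: "polyfun (\<lambda>v. axis i 1 $ j)" "polyfun (\<lambda>v. v $ 1 $ j)" for i j :: 3 by auto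
  show ?thesis
    unfolding cubic_disc_def branch_disc_def quartic_disc_def
    by (intro polyfun_add polyfun_diff polyfun_mult polyfun_power polyfun_const polyfun_polar polyfun_pencil c)
qed

text \<open>The resultant of \<open>pencil_disc v\<close> and its derivative; the generic degrees 12 and 11 are built in to
  make it polynomial in \<open>v\<close>.\<close>

definition pencil_res :: "(complex^3)^8 \<Rightarrow> complex" where
  "pencil_res v = det (sylvester_mat_sub 12 11 (pencil_disc v) (pderiv (pencil_disc v)))"

lemma polyfun_pencil_res: "polyfun pencil_res"
proof -
  have "polyfun (\<lambda>v. det (sylvester_mat_sub 12 11 (pencil_disc v) (pderiv (pencil_disc v))))"
  proof (rule polyfun_det)
    fix i j :: nat assume ij: "i < 12 + 11" "j < 12 + 11"
    have D: "polyfun (\<lambda>v. coeff (pencil_disc v) n)" "polyfun (\<lambda>v. coeff (pderiv (pencil_disc v)) n)" for n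
      using polyfam_pencil_disc by (auto simp: polyfam_def coeff_pderiv)
    show "polyfun (\<lambda>v. sylvester_mat_sub 12 11 (pencil_disc v) (pderiv (pencil_disc v)) $$ (i, j))"
      unfolding sylvester_mat_sub_index[OF ij] by (intro polyfun_if polyfun_const D)
  qed (rule sylvester_mat_sub_carrier)
  then show ?thesis by (simp add: pencil_res_def[abs_def])
qed

text \<open>A nonzero coefficient at 12 makes the degrees 12 and 11 the true ones, so the
  determinant is the resultant. It vanishes iff there is a common factor, which over \<complex>
  means a common root.\<close>

lemma pencil_res_iff:
  assumes "coeff (pencil_disc v) 12 \<noteq> 0"
  shows "pencil_res v \<noteq> 0 \<longleftrightarrow> (\<forall>x. \<not> (poly (pencil_disc v) x = 0 \<and> poly (pderiv (pencil_disc v)) x = 0))"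
proof -
  let ?D = "pencil_disc v"
  have "degree ?D \<le> 12" unfolding pencil_disc_def by (rule degree_disc_poly)
  then have deg: "degree ?D = 12" using assms le_degree[of ?D 12] by simp
  then have D0: "?D \<noteq> 0" by auto
  have "degree (pderiv ?D) = 11" using deg by (simp add: degree_pderiv)
  then have "pencil_res v = resultant ?D (pderiv ?D)"
    by (simp add: pencil_res_def resultant_sub resultant_sub_def deg)
  then have "pencil_res v \<noteq> 0 \<longleftrightarrow> degree (gcd ?D (pderiv ?D)) = 0" by (simp add: resultant_0_gcd)
  also have "\<dots> \<longleftrightarrow> (\<forall>x. \<not> (poly ?D x = 0 \<and> poly (pderiv ?D) x = 0))"
  proof
    assume g: "degree (gcd ?D (pderiv ?D)) = 0"
    show "\<forall>x. \<not> (poly ?D x = 0 \<and> poly (pderiv ?D) x = 0)"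
    proof (intro allI notI)
      fix x assume "poly ?D x = 0 \<and> poly (pderiv ?D) x = 0"
      then have "[:- x, 1:] dvd gcd ?D (pderiv ?D)" by (simp add: poly_eq_0_iff_dvd)
      then have "degree [:- x, 1:] \<le> degree (gcd ?D (pderiv ?D))"
        using D0 by (intro dvd_imp_degree_le) auto
      then show False using g by simp
    qed
  next
    assume "\<forall>x. \<not> (poly ?D x = 0 \<and> poly (pderiv ?D) x = 0)"
    then have "coprime ?D (pderiv ?D)" by (intro coprime_no_common_root D0) auto
    then show "degree (gcd ?D (pderiv ?D)) = 0" by simp
  qed
  finally show ?thesis .
qed

subsection \<open>A pencil with twelve nodal members\<close>

text \<open>The diagonal matrix with entries \<open>1, \<omega>, \<omega>\<^sup>2\<close>, where \<open>\<omega>\<close> is a primitive cube root of unity, acts on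
  the cubics \<open>-5x\<^sup>2y + 2y\<^sup>2z + 3xz\<^sup>2\<close> and \<open>xy\<^sup>2 - 6x\<^sup>2z + 5yz\<^sup>2\<close> by the characters \<open>\<omega>\<close> and \<open>\<omega>\<^sup>2\<close>, so the
  base points come in orbits and the discriminant of the pencil is a polynomial in \<open>t\<^sup>3\<close>.\<close>

definition example1 :: "nat \<Rightarrow> complex" where
  "example1 k = (if k = 1 then -5 else if k = 6 then 2 else if k = 7 then 3 else 0)"

definition example2 :: "nat \<Rightarrow> complex" where
  "example2 k = (if k = 2 then 1 else if k = 4 then -6 else if k = 8 then 5 else 0)"

text \<open>The coordinate points are fixed by the diagonal matrix. The point (1, 1, 1) contributes
  a full orbit and (1, -3, -1) two points of another one, whose third point is the ninth base point.
  The last branch is index 0, which equals 8 in this type.\<close>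

definition example_points :: "complex \<Rightarrow> (complex^3)^8" where
  "example_points \<omega> = (\<chi> i. if i = 1 then vector [0, 0, 1] else if i = 2 then vector [1, 0, 0]
     else if i = 3 then vector [0, 1, 0] else if i = 4 then vector [1, 1, 1]
     else if i = 5 then vector [1, \<omega>, \<omega>^2] else if i = 6 then vector [1, \<omega>^2, \<omega>]
     else if i = 7 then vector [1, -3, -1] else vector [1, -3 * \<omega>, - (\<omega>^2)])"

lemma example_points_nth:
  "example_points \<omega> $ 0 = vector [1, -3 * \<omega>, - (\<omega>^2)]" "example_points \<omega> $ 1 = vector [0, 0, 1]"
  "example_points \<omega> $ 2 = vector [1, 0, 0]" "example_points \<omega> $ 3 = vector [0, 1, 0]"
  "example_points \<omega> $ 4 = vector [1, 1, 1]" "example_points \<omega> $ 5 = vector [1, \<omega>, \<omega>^2]"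
  "example_points \<omega> $ 6 = vector [1, \<omega>^2, \<omega>]" "example_points \<omega> $ 7 = vector [1, -3, -1]"
  by (simp_all add: example_points_def)

lemma forall_8: "(\<forall>i :: 8. P i) \<longleftrightarrow> P 0 \<and> P 1 \<and> P 2 \<and> P 3 \<and> P 4 \<and> P 5 \<and> P 6 \<and> P 7"
proof
  assume r: "P 0 \<and> P 1 \<and> P 2 \<and> P 3 \<and> P 4 \<and> P 5 \<and> P 6 \<and> P 7"
  show "\<forall>i. P i"
  proof
    fix i :: 8
    obtain k where "k < 8" "i = of_nat k" using of_nat_8_surj[of i] by (elim exE conjE)
    moreover from this have "k \<in> {0, 1, 2, 3, 4, 5, 6, 7}" by auto
    ultimately have "i = 0 \<or> i = 1 \<or> i = 2 \<or> i = 3 \<or> i = 4 \<or> i = 5 \<or> i = 6 \<or> i = 7"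
      by (elim insertE emptyE) simp_all
    then show "P i" using r by (elim disjE) (simp_all only:)
  qed
qed auto

lemma example_vanishes:
  assumes w: "\<omega>^2 + \<omega> + 1 = 0"
  shows "cubic example1 (example_points \<omega> $ i) = 0" "cubic example2 (example_points \<omega> $ i) = 0"
proof -
  have "\<forall>i. cubic example1 (example_points \<omega> $ i) = 0"
    unfolding forall_8 example_points_nth cubic_def
    by (simp add: example1_def vector_3) (intro conjI; use w in Groebner_Basis.algebra)
  then show "cubic example1 (example_points \<omega> $ i) = 0" by blast
  have "\<forall>i. cubic example2 (example_points \<omega> $ i) = 0"
    unfolding forall_8 example_points_nth cubic_def
    by (simp add: example2_def vector_3) (intro conjI; use w in Groebner_Basis.algebra)
  then show "cubic example2 (example_points \<omega> $ i) = 0" by blast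
qed

text \<open>A kernel vector is a cubic through the points. The coordinate points kill the pure
  cubes; on the orbit of (1, 1, 1) the equations split by the characters of the cyclic group into
  \<open>f\<close>, \<open>g\<close> and the invariant part \<open>c 5\<close>. Likewise for
  \<open>f'\<close>, \<open>g'\<close> on the second orbit, where two points suffice once
  \<open>c 5 = 0\<close>. The last two rows supply what is missing.\<close>

lemma example_det:
  assumes w: "\<omega>^2 + \<omega> + 1 = 0"
  shows "det (point_mat (example_points \<omega>)) \<noteq> 0"
proof
  assume "det (point_mat (example_points \<omega>)) = 0"
  then obtain c k where c: "\<forall>i. cubic c (example_points \<omega> $ i) = 0" "c 2 = 0" "c 7 - c 6 = 0" "k < 10" "c k \<noteq> 0"
    unfolding point_mat_kernel by blast
  note v = c(1)[unfolded forall_8 example_points_nth cubic_def, simplified vector_3]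
  have w3: "\<omega>^3 = 1" using w by Groebner_Basis.algebra
  have c0: "c 0 = 0" "c 3 = 0" "c 9 = 0" using v by simp_all
  define f where "f = c 1 + c 6 + c 7"
  define g where "g = c 4 + c 8"
  have e4: "f + g + c 5 = 0"
    using v c0 c(2) by (simp add: f_def g_def algebra_simps)
  have "c 1 * \<omega> + c 4 * \<omega>^2 + c 5 * (\<omega> * \<omega>^2) + c 6 * (\<omega>^2 * \<omega>^2) + c 7 * (\<omega>^2)^2 + c 8 * (\<omega> * (\<omega>^2)^2) = 0"
    using v c0 c(2) by simp
  then have e5: "f * \<omega> + g * \<omega>^2 + c 5 = 0" unfolding f_def g_def using w3 by Groebner_Basis.algebra
  have "c 1 * \<omega>^2 + c 4 * \<omega> + c 5 * (\<omega>^2 * \<omega>) + c 6 * ((\<omega>^2)^2 * \<omega>) + c 7 * \<omega>^2 + c 8 * (\<omega>^2 * \<omega>^2) = 0"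
    using v c0 c(2) by simp
  then have e6: "f * \<omega>^2 + g * \<omega> + c 5 = 0" unfolding f_def g_def using w3 by Groebner_Basis.algebra
  \<comment> \<open>The sum of the three equations eliminates \<open>f\<close> and \<open>g\<close>,
    since the cube roots of unity add up to 0.\<close>
  have "3 * c 5 = 0" using e4 e5 e6 w by Groebner_Basis.algebra
  then have c5: "c 5 = 0" by simp
  have f0: "f = 0" using e4 e5 c5 w by Groebner_Basis.algebra
  have g0: "g = 0" using e4 f0 c5 by simp
  define f' where "f' = -3 * c 1 - 9 * c 6 + c 7"
  define g' where "g' = - c 4 - 3 * c 8"
  have e7: "f' + g' = 0"
    using v c0 c(2) c5 by (simp add: f'_def g'_def algebra_simps)
  have "cubic c (example_points \<omega> $ 0) = c 0 - 3 * c 1 * \<omega> + 9 * c 2 * \<omega>^2 - 27 * c 3 * \<omega>^3 - c 4 * \<omega>^2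
      + 3 * c 5 * \<omega>^3 - 9 * c 6 * \<omega>^4 + c 7 * \<omega>^4 - 3 * c 8 * \<omega>^5 - c 9 * \<omega>^6"
    unfolding example_points_nth cubic_def vector_3 by (simp add: algebra_simps eval_nat_numeral)
  then have "c 0 - 3 * c 1 * \<omega> + 9 * c 2 * \<omega>^2 - 27 * c 3 * \<omega>^3 - c 4 * \<omega>^2
      + 3 * c 5 * \<omega>^3 - 9 * c 6 * \<omega>^4 + c 7 * \<omega>^4 - 3 * c 8 * \<omega>^5 - c 9 * \<omega>^6 = 0" using c(1) by metis
  then have e0: "f' * \<omega> + g' * \<omega>^2 = 0"
    unfolding f'_def g'_def using w3 c0 c(2) c5 by Groebner_Basis.algebra
  have f'0: "f' = 0" using e7 e0 w by Groebner_Basis.algebra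
  have "c 4 = 0 \<and> c 8 = 0" using g0 e7 f'0 unfolding g_def g'_def by Groebner_Basis.algebra
  moreover have "c 1 = 0 \<and> c 6 = 0 \<and> c 7 = 0" using f0 f'0 c(3) unfolding f_def f'_def by Groebner_Basis.algebra
  moreover have "k \<in> {0, 1, 2, 3, 4, 5, 6, 7, 8, 9}" using c(4) by auto
  ultimately show False using c0 c5 c(2,5) by auto
qed

text \<open>The functionals \<open>c 7 - c 6\<close> and \<open>c 2\<close> take the values 1, 0 on
  \<open>example1\<close> and 0, 1 on \<open>example2\<close>, so \<open>pencil_spans\<close>
  identifies the cofactor pencil with the explicit one up to the determinant.\<close>

lemma example_pencil:
  assumes w: "\<omega>^2 + \<omega> + 1 = 0"
  shows "pencil_disc (example_points \<omega>) = smult (det (point_mat (example_points \<omega>)) ^ 12)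
    (disc_poly example1 example2 (axis 1 1) (axis 2 1) (axis 3 1))"
    "cubic_disc (pencil2 (example_points \<omega>)) (axis 1 1) (axis 2 1) (axis 3 1)
      = det (point_mat (example_points \<omega>)) ^ 12 * cubic_disc example2 (axis 1 1) (axis 2 1) (axis 3 1)"
    "example_points \<omega> $ 1 = axis 3 1"
proof -
  let ?v = "example_points \<omega>"
  show e: "?v $ 1 = axis 3 1"
    unfolding example_points_nth by (simp add: vec_eq_iff forall_3 vector_3 axis_def)
  have 1: "pencil1 ?v k = det (point_mat ?v) * example1 k" if "k < 10" for k
    using pencil_spans[OF example_det[OF w] example_vanishes(1)[OF w] that] by (simp add: example1_def)
  have 2: "pencil2 ?v k = det (point_mat ?v) * example2 k" if "k < 10" for k
    using pencil_spans[OF example_det[OF w] example_vanishes(2)[OF w] that] by (simp add: example2_def)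
  show "pencil_disc ?v = smult (det (point_mat ?v) ^ 12)
    (disc_poly example1 example2 (axis 1 1) (axis 2 1) (axis 3 1))"
    unfolding pencil_disc_def e disc_poly_scale[symmetric] by (intro disc_poly_cong 1 2)
  have "cubic_disc F u w p = poly (disc_poly F (\<lambda>k. 0) u w p) 0" for F u w p
    unfolding poly_disc_poly by simp
  moreover have "disc_poly (pencil2 ?v) (\<lambda>k. 0) u w p = smult (det (point_mat ?v) ^ 12) (disc_poly example2 (\<lambda>k. 0) u w p)" for u w p
    unfolding disc_poly_scale[symmetric] by (intro disc_poly_cong) (simp_all add: 2)
  ultimately show "cubic_disc (pencil2 ?v) (axis 1 1) (axis 2 1) (axis 3 1)
      = det (point_mat ?v) ^ 12 * cubic_disc example2 (axis 1 1) (axis 2 1) (axis 3 1)"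
    by simp
qed

lemma example_disc2: "cubic_disc example2 (axis 1 1) (axis 2 1) (axis 3 1) \<noteq> 0"
  unfolding cubic_disc_def polar_def example2_def
  by (simp add: axis_def branch_disc_def quartic_disc_def)

lemma example_disc_poly: "disc_poly example1 example2 (axis 1 1) (axis 2 1) (axis 3 1) =
  smult 24883200 [:-6075, 0, 0, -17248, 0, 0, 110150, 0, 0, -17248, 0, 0, -6075:]"
  unfolding disc_poly_def polar_def example1_def example2_def
  by (simp add: axis_def branch_disc_def quartic_disc_def power2_eq_square power3_eq_cube numeral_poly)

lemma example_no_double_root:
  fixes x :: complex
  defines "p \<equiv> [:-6075, 0, 0, -17248, 0, 0, 110150, 0, 0, -17248, 0, 0, -6075:]"
  shows "\<not> (poly p x = 0 \<and> poly (pderiv p) x = 0)"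
proof
  assume a: "poly p x = 0 \<and> poly (pderiv p) x = 0"
  define s where "s = x^3"
  have p: "poly p x = -6075 - 17248 * s + 110150 * s^2 - 17248 * s^3 - 6075 * s^4"
    by (simp add: p_def s_def algebra_simps eval_nat_numeral)
  have dp: "poly (pderiv p) x = 3 * x^2 * (-17248 + 220300 * s - 51744 * s^2 - 24300 * s^3)"
    by (simp add: p_def s_def pderiv_pCons algebra_simps eval_nat_numeral)
  \<comment> \<open>The constant term -6075 excludes 0, so the factor \<open>x^2\<close> of the
    derivative can be cancelled.\<close>
  have "x \<noteq> 0" using a p by (auto simp: s_def)
  then have q': "-17248 + 220300 * s - 51744 * s^2 - 24300 * s^3 = 0" using a dp by simp
  have q: "-6075 - 17248 * s + 110150 * s^2 - 17248 * s^3 - 6075 * s^4 = 0" using a p by simp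
  \<comment> \<open>A Bezout identity between the quartic in \<open>s\<close> and its derivative,
    with denominators cleared; a common zero would make the constant on the right vanish.\<close>
  have "(-1326452187200 + 346366333104 * s + 153459141300 * s^2) * (-6075 - 17248 * s + 110150 * s^2 - 17248 * s^3 - 6075 * s^4)
    + (-41378870412 + 675945425525 * s - 113822686868 * s^2 - 38364785325 * s^3) * (-17248 + 220300 * s - 51744 * s^2 - 24300 * s^3)
    = 8771899794106176"
    by (simp add: algebra_simps eval_nat_numeral)
  then show False unfolding q q' by simp
qed

section \<open>Twelve rational cubics through eight general points\<close>

text \<open>\<open>det\<close> makes the cubics through the points a pencil, \<open>lead\<close> and
  \<open>res\<close> give its discriminant twelve simple roots, and \<open>smooth2\<close> deals
  with the member at infinity, which no parameter reaches. \<open>coll\<close> and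
  \<open>conic\<close> exclude lines; indexing them by lists makes a finite family of
  conditions.\<close>

locale general_eight_points =
  fixes v :: "(complex^3)^8"
  assumes coll: "\<And>xs. distinct xs \<Longrightarrow> length xs = 3 \<Longrightarrow> det3 (v $ (xs!0)) (v $ (xs!1)) (v $ (xs!2)) \<noteq> 0"
    and conic: "\<And>xs. distinct xs \<Longrightarrow> length xs = 6 \<Longrightarrow>
      conic_det (v $ (xs!0)) (v $ (xs!1)) (v $ (xs!2)) (v $ (xs!3)) (v $ (xs!4)) (v $ (xs!5)) \<noteq> 0"
    and base: "v $ 1 $ 3 \<noteq> 0"
    and det: "det (point_mat v) \<noteq> 0"
    and lead: "coeff (pencil_disc v) 12 \<noteq> 0"
    and res: "pencil_res v \<noteq> 0"
    and smooth2: "cubic_disc (pencil2 v) (axis 1 1) (axis 2 1) (v $ 1) \<noteq> 0"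
begin

definition member :: "complex \<Rightarrow> nat \<Rightarrow> complex" where
  "member t k = pencil1 v k + t * pencil2 v k"

lemma pencil_nonzero:
  assumes "(a, b) \<noteq> (0, 0)"
  shows "\<exists>x. cubic (\<lambda>k. a * pencil1 v k + b * pencil2 v k) x \<noteq> 0"
proof (rule ccontr)
  assume "\<nexists>x. cubic (\<lambda>k. a * pencil1 v k + b * pencil2 v k) x \<noteq> 0"
  then have 0: "a * pencil1 v k + b * pencil2 v k = 0" if "k < 10" for k
    using cubic_eq_0_coeffs[of "\<lambda>k. a * pencil1 v k + b * pencil2 v k" k] that by blast
  have "b * det (point_mat v) = 0" using 0[of 2] pencil_coeffs[of v] by simp
  moreover have "a * (pencil1 v 7 - pencil1 v 6) + b * (pencil2 v 7 - pencil2 v 6)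
      = (a * pencil1 v 7 + b * pencil2 v 7) - (a * pencil1 v 6 + b * pencil2 v 6)"
    by (simp add: algebra_simps)
  then have "a * (pencil1 v 7 - pencil1 v 6) + b * (pencil2 v 7 - pencil2 v 6) = 0"
    by (simp only: 0[of 7, simplified] 0[of 6, simplified]) simp
  then have "a * det (point_mat v) = 0" unfolding pencil_coeffs by simp
  ultimately show False using assms det by auto
qed

lemma pencil_no_line:
  assumes "(a, b) \<noteq> (0, 0)"
  shows "no_line (\<lambda>k. a * pencil1 v k + b * pencil2 v k)"
proof -
  obtain x where "cubic (\<lambda>k. a * pencil1 v k + b * pencil2 v k) x \<noteq> 0" using pencil_nonzero[OF assms] by blast
  then show ?thesis
    using no_line_if_general[of v "\<lambda>k. a * pencil1 v k + b * pencil2 v k" x] coll conic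
    by (simp add: cubic_lincomb pencil_vanishes)
qed

lemma basis_at_base: "basis3 (axis 1 1) (axis 2 1) (v $ 1)"
  using base by (intro det3_basis) (simp add: det3_def axis_def)

lemma member_lincomb: "member t = (\<lambda>k. 1 * pencil1 v k + t * pencil2 v k)"
  by (simp add: member_def fun_eq_iff)

lemma cubic_member: "cubic (member t) (v $ i) = 0"
  unfolding member_lincomb cubic_lincomb by (simp add: pencil_vanishes)

lemma singular_member_iff:
  "(\<exists>q. q \<noteq> 0 \<and> (\<forall>h. polar (member t) q q h = 0)) \<longleftrightarrow> poly (pencil_disc v) t = 0"
proof -
  have "cubic_disc (member t) (axis 1 1) (axis 2 1) (v $ 1) = poly (pencil_disc v) t"
    unfolding pencil_disc_def poly_disc_poly member_def[abs_def] ..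
  moreover have "no_line (member t)" unfolding member_lincomb by (rule pencil_no_line) simp
  ultimately show ?thesis
    using cubic_disc_eq_0_iff[OF basis_at_base cubic_member] by metis
qed

lemma smooth_pencil2: "\<not> (\<exists>q. q \<noteq> 0 \<and> (\<forall>h. polar (pencil2 v) q q h = 0))"
proof -
  have "no_line (pencil2 v)" using pencil_no_line[of 0 1] by simp
  then show ?thesis
    using cubic_disc_eq_0_iff[OF basis_at_base pencil_vanishes(2)] smooth2 by metis
qed

lemma singular_member:
  assumes "poly (pencil_disc v) t = 0"
  obtains q where "singular_cubic (member t) q"
proof -
  obtain q where "q \<noteq> 0" "\<forall>h. polar (member t) q q h = 0" using assms singular_member_iff by blast
  moreover have "no_line (member t)" unfolding member_lincomb by (rule pencil_no_line) simp
  ultimately have "singular_cubic (member t) q" by unfold_locales auto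
  then show ?thesis using that by blast
qed

abbreviation points :: "cp2^8" where
  "points \<equiv> \<chi> i. proj (v $ i)"

lemma point_nonzero: "v $ i \<noteq> 0"
proof -
  have "distinct [i, 1, 2] \<or> distinct [i, 0, 2] \<or> distinct [i, 0, 1]" by auto
  then obtain j k where "distinct [i, j, k]" by blast
  then show ?thesis using coll[of "[i, j, k]"] by (auto simp: det3_def)
qed

lemma rational_curves_subset:
  assumes C: "C \<in> rational_curves_through 3 points"
  shows "C \<in> (\<lambda>t. cubic_curve (member t)) ` {t. poly (pencil_disc v) t = 0}"
proof -
  have rat: "rational_curve C" and thru: "\<And>i. proj (v $ i) \<in> C" and "plane_curve 3 C"
    using C by (auto simp: rational_curves_through_def)
  then obtain P where "minimal_equation 3 P C" unfolding plane_curve_def by blast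
  then have P: "P \<noteq> 0" "homogeneous 3 P" "C = cubic_curve (coeffs_of P)"
    unfolding minimal_equation_def using zero_locus_cubic by auto
  define d where "d = coeffs_of P"
  have Cd: "C = cubic_curve d" using P by (simp add: d_def)
  have d0: "cubic d (v $ i) = 0" for i
    using thru[of i] proj_in_cubic_curve[OF point_nonzero] unfolding Cd by blast
  define a where "a = (d 7 - d 6) / det (point_mat v)"
  define b where "b = d 2 / det (point_mat v)"
  have dk: "d k = a * pencil1 v k + b * pencil2 v k" if "k < 10" for k
    using pencil_spans[OF det d0 that] det by (simp add: a_def b_def divide_simps mult.commute)
  have ab: "(a, b) \<noteq> (0, 0)"
  proof
    assume "(a, b) = (0, 0)"
    then have "\<And>k. k < 10 \<Longrightarrow> coeffs_of P k = 0" using dk by (simp add: d_def)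
    then show False using coeffs_of_eq_0[OF P(2)] P(1) by blast
  qed
  obtain q where q: "q \<noteq> 0" "\<forall>h. polar d q q h = 0"
    using smooth_cubic_not_rational[of d] rat unfolding Cd by blast
  have pd: "polar d x y z = a * polar (pencil1 v) x y z + b * polar (pencil2 v) x y z" for x y z
    using polar_cong[OF dk] polar_lincomb[of a "pencil1 v" b "pencil2 v" x y z] by simp
  \<comment> \<open>For \<open>a = 0\<close> the curve would be the member at infinity, which is
    smooth.\<close>
  have "a \<noteq> 0"
  proof
    assume "a = 0"
    then have "\<forall>h. polar (pencil2 v) q q h = 0" using q(2) ab by (simp add: pd)
    then show False using smooth_pencil2 q(1) by blast
  qed
  define t where "t = b / a"
  have pm: "polar d x y z = a * polar (member t) x y z" for x y z
    unfolding pd member_def[abs_def] polar_lincomb' using \<open>a \<noteq> 0\<close> by (simp add: t_def algebra_simps)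
  then have "\<forall>h. polar (member t) q q h = 0" using q(2) \<open>a \<noteq> 0\<close> by simp
  then have "poly (pencil_disc v) t = 0" using singular_member_iff q(1) by blast
  moreover have "cubic_curve d = cubic_curve (member t)"
    unfolding cubic_curve_def cubic_polar pm using \<open>a \<noteq> 0\<close> by simp
  ultimately show ?thesis using Cd by blast
qed

lemma member_rational:
  assumes "poly (pencil_disc v) t = 0"
  shows "cubic_curve (member t) \<in> rational_curves_through 3 points"
proof -
  obtain q where "singular_cubic (member t) q" using singular_member[OF assms] .
  then interpret singular_cubic "member t" q .
  have "proj (v $ i) \<in> cubic_curve (member t)" for i
    using proj_in_cubic_curve[OF point_nonzero] cubic_member by blast
  then show ?thesis
    using singular_cubic_rational(1,2) by (simp add: rational_curves_through_def)
qed

text \<open>Equal point sets have proportional equations because the member is a singular cubic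
  without lines. As the two generators of the pencil are linearly independent, the factor is 1 and
  the parameters agree.\<close>

lemma inj_member: "inj_on (\<lambda>t. cubic_curve (member t)) {t. poly (pencil_disc v) t = 0}"
proof (rule inj_onI)
  fix t t'
  assume t: "t \<in> {t. poly (pencil_disc v) t = 0}" and eq: "cubic_curve (member t) = cubic_curve (member t')"
  obtain q where "singular_cubic (member t) q" using singular_member t by blast
  then interpret singular_cubic "member t" q .
  have "cubic (member t') x = 0" if "cubic (member t) x = 0" for x
    using that eq proj_in_cubic_curve[of x] by (cases "x = 0") auto
  then obtain k where k: "\<And>x. cubic (member t') x = k * cubic (member t) x"
    using singular_cubic_rational(3)[of "member t'"] by blast
  have "cubic (\<lambda>j. (1 - k) * pencil1 v j + (t' - k * t) * pencil2 v j) x = 0" for x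
    using k[of x] unfolding member_lincomb cubic_lincomb by (simp add: algebra_simps)
  then have "(1 - k, t' - k * t) = (0, 0)" using pencil_nonzero by blast
  then show "t = t'" by simp
qed

lemma card_roots: "card {t. poly (pencil_disc v) t = 0} = 12"
proof -
  have "degree (pencil_disc v) \<le> 12" unfolding pencil_disc_def by (rule degree_disc_poly)
  then have deg: "degree (pencil_disc v) = 12" using lead le_degree[of "pencil_disc v" 12] by simp
  have "rsquarefree (pencil_disc v)"
    unfolding rsquarefree_roots using pencil_res_iff[OF lead] res by blast
  then have "smult (lead_coeff (pencil_disc v)) (\<Prod>z | poly (pencil_disc v) z = 0. [:- z, 1:]) = pencil_disc v"
    by (rule complex_poly_decompose_rsquarefree)
  moreover have "lead_coeff (pencil_disc v) \<noteq> 0" using lead deg by simp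
  ultimately have "degree (pencil_disc v) = degree (\<Prod>z | poly (pencil_disc v) z = 0. [:- z, 1:])"
    by (metis degree_smult_eq)
  also have "\<dots> = card {t. poly (pencil_disc v) t = 0}"
    by (subst degree_prod_eq_sum_degree) simp_all
  finally show ?thesis using deg by simp
qed

lemma rational_curves: "finite (rational_curves_through 3 points) \<and> card (rational_curves_through 3 points) = 12"
proof -
  have eq: "rational_curves_through 3 points = (\<lambda>t. cubic_curve (member t)) ` {t. poly (pencil_disc v) t = 0}"
    using rational_curves_subset member_rational by blast
  have "card (rational_curves_through 3 points) = 12"
    unfolding eq card_image[OF inj_member] by (rule card_roots)
  then show ?thesis by (metis card.infinite zero_neq_numeral)
qed

end

section \<open>The generic conditions and witnesses for them\<close>

definition conditions :: "((complex^3)^8 \<Rightarrow> complex) set" where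
  "conditions = {\<lambda>v. v $ 1 $ 3, \<lambda>v. det (point_mat v), \<lambda>v. coeff (pencil_disc v) 12, pencil_res,
      \<lambda>v. cubic_disc (pencil2 v) (axis 1 1) (axis 2 1) (v $ 1)}
    \<union> (\<lambda>xs v. det3 (v $ (xs!0)) (v $ (xs!1)) (v $ (xs!2))) ` {xs. distinct xs \<and> length xs = 3}
    \<union> (\<lambda>xs v. conic_det (v $ (xs!0)) (v $ (xs!1)) (v $ (xs!2)) (v $ (xs!3)) (v $ (xs!4)) (v $ (xs!5)))
      ` {xs. distinct xs \<and> length xs = 6}"

lemma finite_conditions: "finite conditions"
proof -
  have "finite {xs :: 8 list. distinct xs \<and> length xs = n}" for n
    using finite_lists_length_eq[of "UNIV :: 8 set" n] by (rule rev_finite_subset) auto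
  then show ?thesis unfolding conditions_def by simp
qed

lemma polyfun_det3:
  assumes "\<And>i. polyfun (\<lambda>v. a v $ i)" "\<And>i. polyfun (\<lambda>v. b v $ i)" "\<And>i. polyfun (\<lambda>v. d v $ i)"
  shows "polyfun (\<lambda>v. det3 (a v) (b v) (d v))"
  unfolding det3_def by (intro polyfun_add polyfun_diff polyfun_mult assms)

lemma polyfun_conic_det: "polyfun (\<lambda>v. conic_det (v $ i1) (v $ i2) (v $ i3) (v $ i4) (v $ i5) (v $ i6))"
proof -
  have vec: "polyfun (\<lambda>v. (vector [f v, g v, h v] :: complex^3) $ i)" if "polyfun f" "polyfun g" "polyfun h" for f g h i
    using that exhaust_3[of i] by (auto simp: vector_3)
  show ?thesis
    unfolding conic_det_def Let_def by (intro polyfun_det3 vec polyfun_mult polyfun_coord)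
qed

lemma polyfun_conditions: "f \<in> conditions \<Longrightarrow> polyfun f"
  using polyfun_coord polyfun_det_point_mat polyfun_pencil_res polyfun_cubic_disc_pencil2 polyfun_conic_det
    polyfam_pencil_disc
  unfolding conditions_def polyfam_def by (auto intro: polyfun_det3)

lemma prescribe_points:
  fixes xs :: "8 list"
  assumes "distinct xs" "length xs = length ps"
  shows "\<exists>v :: (complex^3)^8. \<forall>k<length xs. v $ (xs ! k) = ps ! k"
proof -
  have "(\<chi> i. the (map_of (zip xs ps) i)) $ (xs ! k) = ps ! k" if "k < length xs" for k
    using map_of_zip_nth[OF assms(2,1), of k] that assms(2) by simp
  then show ?thesis by blast
qed

text \<open>Finitely many dense open sets intersect in a dense one, so each condition may have its
  own witness. The explicit pencil serves those on the discriminant, while collinearity and conics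
  are tested on points placed at will.\<close>

lemma conditions_nonzero:
  assumes "f \<in> conditions"
  shows "\<exists>v. f v \<noteq> 0"
proof -
  obtain \<omega> :: complex where "poly [:1, 1, 1:] \<omega> = 0"
    using alg_closed_imp_poly_has_root[of "[:1, 1, 1 :: complex:]"] by auto
  then have w: "\<omega>^2 + \<omega> + 1 = 0" by (simp add: power2_eq_square algebra_simps)
  let ?v = "example_points \<omega>"
  let ?q = "[:-6075, 0, 0, -17248, 0, 0, 110150, 0, 0, -17248, 0, 0, -6075:] :: complex poly"
  define m where "m = det (point_mat ?v) ^ 12 * 24883200"
  have m: "m \<noteq> 0" using example_det[OF w] by (simp add: m_def)
  have D: "pencil_disc ?v = smult m ?q"
    unfolding example_pencil(1)[OF w] example_disc_poly m_def by (simp only: smult_smult)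
  have "coeff ?q 12 \<noteq> 0" by (simp add: coeff_pCons eval_nat_numeral)
  then have lead: "coeff (pencil_disc ?v) 12 \<noteq> 0" unfolding D coeff_smult using m by simp
  have "\<not> (poly (pencil_disc ?v) x = 0 \<and> poly (pderiv (pencil_disc ?v)) x = 0)" for x
    using example_no_double_root[of x] m unfolding D pderiv_smult poly_smult by (metis mult_eq_0_iff)
  then have res: "pencil_res ?v \<noteq> 0" using pencil_res_iff[OF lead] by blast
  have sm: "cubic_disc (pencil2 ?v) (axis 1 1) (axis 2 1) (?v $ 1) \<noteq> 0"
    unfolding example_pencil(2,3)[OF w] using example_det[OF w] example_disc2 by simp
  have base: "?v $ 1 $ 3 \<noteq> 0" unfolding example_pencil(3)[OF w] by (simp add: axis_def)
  have col: "\<exists>v :: (complex^3)^8. det3 (v $ (xs!0)) (v $ (xs!1)) (v $ (xs!2)) \<noteq> 0"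
    if xs: "distinct xs" "length xs = 3" for xs
  proof -
    obtain v :: "(complex^3)^8" where v: "\<forall>k<3. v $ (xs ! k) = [axis 1 1, axis 2 1, axis 3 1] ! k"
      using prescribe_points[of xs "[axis 1 1, axis 2 1, axis 3 1]"] xs by auto
    have "v $ (xs!0) = axis 1 1" "v $ (xs!1) = axis 2 1" "v $ (xs!2) = axis 3 1"
      using v[rule_format, of 0] v[rule_format, of 1] v[rule_format, of 2] by simp_all
    then have "det3 (v $ (xs!0)) (v $ (xs!1)) (v $ (xs!2)) \<noteq> 0" by (simp add: det3_def axis_def)
    then show ?thesis by blast
  qed
  have con: "\<exists>v :: (complex^3)^8. conic_det (v $ (xs!0)) (v $ (xs!1)) (v $ (xs!2)) (v $ (xs!3)) (v $ (xs!4)) (v $ (xs!5)) \<noteq> 0"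
    if xs: "distinct xs" "length xs = 6" for xs
  proof -
    \<comment> \<open>For the last three points the values of \<open>xy, xz, yz\<close> are (1, 1,
      1), (2, 3, 6) and (2, -1, -2), with determinant 8.\<close>
    let ?ps = "[axis 1 1, axis 2 1, axis 3 1, vector [1, 1, 1], vector [1, 2, 3], vector [1, 2, -1]] :: (complex^3) list"
    obtain v :: "(complex^3)^8" where v: "\<forall>k<6. v $ (xs ! k) = ?ps ! k"
      using prescribe_points[of xs ?ps] xs by auto
    have "v $ (xs!0) = axis 1 1" "v $ (xs!1) = axis 2 1" "v $ (xs!2) = axis 3 1"
      "v $ (xs!3) = vector [1, 1, 1]" "v $ (xs!4) = vector [1, 2, 3]" "v $ (xs!5) = vector [1, 2, -1]"
      using v[rule_format, of 0] v[rule_format, of 1] v[rule_format, of 2]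
        v[rule_format, of 3] v[rule_format, of 4] v[rule_format, of 5] by simp_all
    then have "conic_det (v $ (xs!0)) (v $ (xs!1)) (v $ (xs!2)) (v $ (xs!3)) (v $ (xs!4)) (v $ (xs!5)) \<noteq> 0"
      by (simp add: conic_det_def Let_def det3_def axis_def vector_3)
    then show ?thesis by blast
  qed
  from assms consider "f = (\<lambda>v. v $ 1 $ 3)" | "f = (\<lambda>v. det (point_mat v))" | "f = (\<lambda>v. coeff (pencil_disc v) 12)"
    | "f = pencil_res" | "f = (\<lambda>v. cubic_disc (pencil2 v) (axis 1 1) (axis 2 1) (v $ 1))"
    | xs where "distinct xs" "length xs = 3" "f = (\<lambda>v. det3 (v $ (xs!0)) (v $ (xs!1)) (v $ (xs!2)))"
    | xs where "distinct xs" "length xs = 6"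
      "f = (\<lambda>v. conic_det (v $ (xs!0)) (v $ (xs!1)) (v $ (xs!2)) (v $ (xs!3)) (v $ (xs!4)) (v $ (xs!5)))"
    unfolding conditions_def by blast
  then show ?thesis
  proof cases
    case 1 then show ?thesis using base by blast
  next
    case 2 then show ?thesis using example_det[OF w] by blast
  next
    case 3 then show ?thesis using lead by blast
  next
    case 4 then show ?thesis using res by blast
  next
    case 5 then show ?thesis using sm by blast
  next
    case 6 then show ?thesis using col by blast
  next
    case 7 then show ?thesis using con by blast
  qed
qed

theorem mainTheorem1:
  shows "for_general_points
    (\<lambda>p :: cp2 ^ 8. finite (rational_curves_through 3 p) \<and> card (rational_curves_through 3 p) = 12)"
proof (rule general_pointsI)
  let ?W = "{v. \<forall>f\<in>conditions. f v \<noteq> 0}"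
  show "open ?W" "closure ?W = UNIV"
    using finite_polyfun_dense[OF finite_conditions polyfun_conditions conditions_nonzero] by blast+
  fix v assume "v \<in> ?W"
  then interpret general_eight_points v
    by unfold_locales (auto simp: conditions_def)
  show "finite (rational_curves_through 3 points) \<and> card (rational_curves_through 3 points) = 12"
    by (rule rational_curves)
  fix i show "v $ i \<noteq> 0" by (rule point_nonzero)
qed

end
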